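(* Let $k\geq 3$ and let $P:\{0,1\}^k\to\{0,1\}$ be a symmetric predicate other than $k$-EQU. Then for any $\epsilon>0$ and any predicate $Q:\{0,1\}^k\to\{0,1\}$ with $P^{-1}(1)\subseteq Q^{-1}(1)$, there exist $\delta=O(1/\log(k/\epsilon^2))$ and $d=O(1/\epsilon^2)$ such that every $(|Q^{-1}(0)|/2^k-\epsilon)$-tester for CSP($Q$) with degree bound $d$ requires $\Omega(n^{1/2+\delta})$ queries, where $n$ is the number of variables.
   Context: All predicates satisfy $|P^{-1}(1)|>0$. A predicate $P:\{0,1\}^k\to\{0,1\}$ is symmetric if (i) $P(x)=P(y)$ whenever $x,y$ have the same Hamming weight and (ii) $P(x)=P(\overline{x})$ for all $x$, where $\overline{x}=(1,\dots,1)-x$. $k$-EQU is the predicate satisfied iff all $k$ inputs are equal. An instance of CSP($Q$) consists of Boolean variables and constraints, each on a $k$-tuple of variables $(x_1,\dots,x_k)$ and of the form $Q(x_1+b_1,\dots,x_k+b_k)=1$ for some literal vector $b\in\{0,1\}^k$ (addition mod 2). Bounded-degree model with degree bound $d$: each variable appears in at most $d$ constraints; an algorithm accesses the instance only via an oracle that, given a variable $x$ and an index $1\le i\le d$, returns the $i$-th constraint containing $x$ (or a special symbol if none exists); query complexity is the number of oracle calls. An instance is $\epsilon$-far from satisfiability if at least $\epsilon dn/k$ constraints must be removed to make it satisfiable, and $\epsilon$-close if removing at most $\epsilon dn/k$ constraints suffices. A $(\gamma,\epsilon)$-tester is a randomized algorithm that accepts with probability at least $2/3$ every instance $\gamma$-close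 to satisfiability and rejects with probability at least $2/3$ every instance $\epsilon$-far from satisfiability; an $\epsilon$-tester is a $(0,\epsilon)$-tester. *)

theory Defs
  imports "HOL-Probability.Probability"
begin

text \<open>
  Predicates on \<open>{0,1}^k\<close> are functions on Boolean lists, of which only the values on
  lists of length \<open>k\<close> matter.
\<close>

type_synonym predicate = "bool list \<Rightarrow> bool"

definition cube :: "nat \<Rightarrow> bool list set" where
  "cube k = {x. length x = k}"

definition ones :: "nat \<Rightarrow> predicate \<Rightarrow> bool list set" where
  "ones k P = {x \<in> cube k. P x}"

definition zeros :: "nat \<Rightarrow> predicate \<Rightarrow> bool list set" where
  "zeros k P = {x \<in> cube k. \<not> P x}"

definition hamming_weight :: "bool list \<Rightarrow> nat" where
  "hamming_weight x = count_list x True"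

definition symmetric_pred :: "nat \<Rightarrow> predicate \<Rightarrow> bool" where
  "symmetric_pred k P \<longleftrightarrow>
     (\<forall>x\<in>cube k. \<forall>y\<in>cube k. hamming_weight x = hamming_weight y \<longrightarrow> P x = P y) \<and>
     (\<forall>x\<in>cube k. P x = P (map Not x))"

definition EQU :: predicate where
  "EQU x \<longleftrightarrow> (\<forall>a\<in>set x. \<forall>b\<in>set x. a = b)"


text \<open>
  A constraint is the list of the pairs \<open>(x\<^sub>j, b\<^sub>j)\<close>. Variables are natural numbers, and a
  tuple may repeat a variable.
\<close>

type_synonym constraint = "(nat \<times> bool) list"

definition vars :: "constraint \<Rightarrow> nat set" where
  "vars c = fst ` set c"

text \<open>Addition modulo 2 on \<open>bool\<close> is inequality.\<close>

definition sat_constraint :: "predicate \<Rightarrow> (nat \<Rightarrow> bool) \<Rightarrow> constraint \<Rightarrow> bool" where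
  "sat_constraint Q a c \<longleftrightarrow> Q (map (\<lambda>(x, b). a x \<noteq> b) c)"

text \<open>
  The field \<open>incidence\<close> fixes which constraint is the \<open>i\<close>-th one containing a given variable;
  the order may be chosen independently for each variable. It lists positions in
  \<open>constraints\<close>, in which a constraint may occur several times.
\<close>

record csp_instance =
  constraints :: "constraint list"
  incidence :: "nat \<Rightarrow> nat list"

definition csp_instances :: "nat \<Rightarrow> nat \<Rightarrow> nat \<Rightarrow> csp_instance set" where
  "csp_instances k d n =
     {I. (\<forall>c\<in>set (constraints I). length c = k \<and> vars c \<subseteq> {..<n}) \<and>
         (\<forall>x<n. distinct (incidence I x) \<and>
                set (incidence I x) =
                  {j. j < length (constraints I) \<and> x \<in> vars (constraints I ! j)} \<and>
                length (incidence I x) \<le> d)}"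

definition satisfiable_without :: "predicate \<Rightarrow> csp_instance \<Rightarrow> nat set \<Rightarrow> bool" where
  "satisfiable_without Q I R \<longleftrightarrow>
     (\<exists>a. \<forall>j<length (constraints I). j \<notin> R \<longrightarrow> sat_constraint Q a (constraints I ! j))"

definition far_from_sat ::
    "predicate \<Rightarrow> nat \<Rightarrow> nat \<Rightarrow> nat \<Rightarrow> real \<Rightarrow> csp_instance \<Rightarrow> bool" where
  "far_from_sat Q k d n \<epsilon> I \<longleftrightarrow>
     (\<forall>R \<subseteq> {..<length (constraints I)}. satisfiable_without Q I R \<longrightarrow>
        real (card R) \<ge> \<epsilon> * real d * real n / real k)"

definition close_to_sat ::
    "predicate \<Rightarrow> nat \<Rightarrow> nat \<Rightarrow> nat \<Rightarrow> real \<Rightarrow> csp_instance \<Rightarrow> bool" where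
  "close_to_sat Q k d n \<epsilon> I \<longleftrightarrow>
     (\<exists>R \<subseteq> {..<length (constraints I)}. satisfiable_without Q I R \<and>
        real (card R) \<le> \<epsilon> * real d * real n / real k)"

text \<open>The indices \<open>i\<close> start at 1; \<open>None\<close> is the special symbol.\<close>

definition csp_oracle :: "nat \<Rightarrow> csp_instance \<Rightarrow> nat \<Rightarrow> nat \<Rightarrow> constraint option" where
  "csp_oracle n I x i =
     (if x < n \<and> 1 \<le> i \<and> i \<le> length (incidence I x)
      then Some (constraints I ! (incidence I x ! (i - 1))) else None)"

text \<open>
  A deterministic adaptive algorithm is a decision tree whose inner nodes query the instance;
  a randomized one is a probability distribution on decision trees. The trees may depend on
  \<open>n\<close>, \<open>k\<close>, \<open>d\<close> and \<open>Q\<close>.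
\<close>

datatype dtree = Output bool | Query nat nat "constraint option \<Rightarrow> dtree"

primrec run :: "(nat \<Rightarrow> nat \<Rightarrow> constraint option) \<Rightarrow> dtree \<Rightarrow> bool" where
  "run orc (Output b) = b"
| "run orc (Query x i f) = run orc (f (orc x i))"

primrec queries :: "(nat \<Rightarrow> nat \<Rightarrow> constraint option) \<Rightarrow> dtree \<Rightarrow> nat" where
  "queries orc (Output b) = 0"
| "queries orc (Query x i f) = Suc (queries orc (f (orc x i)))"

definition tester2 ::
    "predicate \<Rightarrow> nat \<Rightarrow> nat \<Rightarrow> nat \<Rightarrow> real \<Rightarrow> real \<Rightarrow> dtree pmf \<Rightarrow> bool" where
  "tester2 Q k d n \<gamma> \<epsilon> T \<longleftrightarrow>
     (\<forall>I\<in>csp_instances k d n.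
        (close_to_sat Q k d n \<gamma> I \<longrightarrow>
           measure_pmf.prob T {t. run (csp_oracle n I) t} \<ge> 2 / 3) \<and>
        (far_from_sat Q k d n \<epsilon> I \<longrightarrow>
           measure_pmf.prob T {t. \<not> run (csp_oracle n I) t} \<ge> 2 / 3))"

definition tester ::
    "predicate \<Rightarrow> nat \<Rightarrow> nat \<Rightarrow> nat \<Rightarrow> real \<Rightarrow> dtree pmf \<Rightarrow> bool" where
  "tester Q k d n \<epsilon> T \<longleftrightarrow> tester2 Q k d n 0 \<epsilon> T"

definition query_complexity_le :: "nat \<Rightarrow> nat \<Rightarrow> nat \<Rightarrow> dtree pmf \<Rightarrow> nat \<Rightarrow> bool" where
  "query_complexity_le k d n T q \<longleftrightarrow>
     (\<forall>I\<in>csp_instances k d n. \<forall>t\<in>set_pmf T. queries (csp_oracle n I) t \<le> q)"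

definition testers_require ::
    "predicate \<Rightarrow> nat \<Rightarrow> nat \<Rightarrow> real \<Rightarrow> (nat \<Rightarrow> real) \<Rightarrow> bool" where
  "testers_require Q k d \<epsilon> f \<longleftrightarrow>
     (\<exists>c>0. \<forall>\<^sub>F n in sequentially. \<forall>T q.
        tester Q k d n \<epsilon> T \<and> query_complexity_le k d n T q \<longrightarrow> real q \<ge> c * f n)"

end

theory Submission
  imports Defs "HOL-Real_Asymp.Real_Asymp"
begin

text \<open>
  All instances live on the same random hypergraph: the variables form \<open>k\<close> blocks of size
  \<open>N = n div k\<close>, and each of \<open>d\<close> layers matches the blocks by random permutations. With uniform
  literals, a Chernoff bound makes the instance far from satisfiable. In the planted instances the
  literals are such that under a hidden random assignment every constraint receives a uniform
  element of \<open>A = ones k P\<close>. Symmetry of \<open>P\<close> kills the odd Fourier coefficients of \<open>A\<close>, and since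
  \<open>P\<close> is not \<open>EQU\<close> all coefficients but those of the empty and the full set are at most
  \<open>\<rho> < 1\<close> in absolute value.

  Call an explored edge excess if it meets the previously explored ones in more than one vertex.
  With \<open>n powr (1/2 + \<delta>)\<close> queries there are only about \<open>n powr (2 * \<delta>)\<close> excess edges, and with high
  probability any two of them are more than \<open>2 * l\<close> apart and none lies on a short cycle, where
  \<open>l\<close> is of order \<open>ln n\<close>: a query near an excess edge is rare or does not collide again. The
  likelihood ratio of the two kinds of literals on the explored edges is a sum over families of even
  vertex sets covering each vertex an even number of times. A parity argument on balls shows that
  such a family contains at least \<open>l\<close> ordinary edges near each of its excess edges, so the ratio is
  \<open>1 - o(1)\<close> pointwise, whatever the adaptive strategy was.
\<close>

section \<open>Separated excess edges and even families\<close>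

text \<open>Both kinds of instances share the hypergraph, so only the literals can betray the
  planting, and a lower bound on the likelihood ratio is enough: planted literals are then rejected
  almost as often as uniform ones, against the demands on a tester. The obstacle is the full vertex
  set of an edge. For even \<open>k\<close> its coefficient may have absolute value one, as for a
  parity predicate, so an ordinary edge carrying its full set damps nothing, and long even families
  alone do not help. The remedy is \<open>even_family_pairs\<close>: at most \<open>k\<close>
  ordinary sets per excess edge have more than two vertices, and pairs are damped by
  \<open>\<rho>\<close> because \<open>3 \<le> k\<close>. For \<open>EQU\<close> even the pairs have
  coefficient one, hence its exclusion. The logarithm in \<open>\<delta>\<close> arises as follows.
  A Chernoff bound that survives the union over all assignments forces \<open>d\<close> to be of
  order \<open>k / \<epsilon>\<^sup>2\<close>; balls grow by a factor \<open>1 + d * k\<close> per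
  step and must stay below a small power of \<open>n\<close>, so \<open>l\<close> is of order
  \<open>ln n / ln (1 + d * k)\<close>; and \<open>\<rho> ^ l\<close> has to beat the number of
  excess edges, a power of \<open>n\<close> proportional to \<open>\<delta>\<close>.\<close>

definition adj :: "('e \<Rightarrow> 'v set) \<Rightarrow> 'e set \<Rightarrow> ('v \<times> 'v) set" where
  "adj V E = Id \<union> (\<Union>e\<in>E. V e \<times> V e)"

text \<open>Edges are inserted in an order of exploration, and \<open>X\<close> collects the excess
  ones. As \<open>adj\<close> contains \<open>Id\<close>, its powers mean distance at most the
  exponent; in particular \<open>u\<close> and \<open>w\<close> differ. The distance
  \<open>2 * l\<close> keeps balls of radius \<open>l\<close> around different excess edges
  disjoint. No rule admits a finite edge with three or more explored vertices.\<close>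

inductive good :: "nat \<Rightarrow> ('e \<Rightarrow> 'v set) \<Rightarrow> 'e set \<Rightarrow> 'e set \<Rightarrow> bool" for l V where
  empty: "good l V {} {}"
| tree: "good l V E X \<Longrightarrow> e \<notin> E \<Longrightarrow> card (V e \<inter> \<Union>(V ` E)) \<le> 1 \<Longrightarrow> good l V (insert e E) X"
| excess: "good l V E X \<Longrightarrow> e \<notin> E \<Longrightarrow> V e \<inter> \<Union>(V ` E) = {u, w} \<Longrightarrow>
    (u, w) \<notin> adj V E ^^ (2 * l) \<Longrightarrow>
    (\<And>z. z \<in> \<Union>(V ` X) \<Longrightarrow> (z, u) \<notin> adj V E ^^ (2 * l) \<and> (z, w) \<notin> adj V E ^^ (2 * l)) \<Longrightarrow>
    good l V (insert e E) (insert e X)"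

lemma good_finite: "good l V E X \<Longrightarrow> finite E \<and> X \<subseteq> E"
  by (induction rule: good.induct) auto

section \<open>Distances between vertices when edges are added\<close>

lemma sym_relpow: "sym r \<Longrightarrow> sym (r ^^ n)" for r :: "('a \<times> 'a) set"
proof (induction n)
  case 0
  then show ?case by (auto simp: sym_def)
next
  case (Suc n)
  show ?case
  proof (rule symI)
    fix x y assume "(x, y) \<in> r ^^ Suc n"
    then obtain z where "(x, z) \<in> r ^^ n" "(z, y) \<in> r" by auto
    then have "(z, x) \<in> r ^^ n" "(y, z) \<in> r" using Suc by (auto dest: symD)
    then show "(y, x) \<in> r ^^ Suc n" by (metis relpow_Suc_I2)
  qed
qed

lemma adj_sym: "(u, v) \<in> adj V E ^^ n \<longleftrightarrow> (v, u) \<in> adj V E ^^ n"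
proof -
  have "sym (adj V E)" by (auto simp: adj_def sym_def)
  then show ?thesis using sym_relpow by (metis symD)
qed

lemma adj_refl: "(u, u) \<in> adj V E ^^ n"
  by (induction n) (auto simp: adj_def)

lemma adj_trans: "(u, v) \<in> adj V E ^^ m \<Longrightarrow> (v, w) \<in> adj V E ^^ n \<Longrightarrow> (u, w) \<in> adj V E ^^ (m + n)"
  by (auto simp: relpow_add)

lemma adj_mono: "m \<le> n \<Longrightarrow> (u, v) \<in> adj V E ^^ m \<Longrightarrow> (u, v) \<in> adj V E ^^ n"
  using adj_trans[of u v m V E v "n - m"] adj_refl[of v "n - m" V E] by auto

lemma adj_mono_edges:
  assumes "E \<subseteq> E'" and "(u, v) \<in> adj V E ^^ n" shows "(u, v) \<in> adj V E' ^^ n"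
  using assms(2)
proof (induction n arbitrary: v)
  case (Suc n)
  then obtain z where "(u, z) \<in> adj V E ^^ n" "(z, v) \<in> adj V E" by auto
  then show ?case using Suc.IH assms(1) by (auto simp: adj_def intro!: relcompI[of u z])
qed auto

lemma adj_cases: "(u, v) \<in> adj V E ^^ n \<Longrightarrow> u = v \<or> v \<in> \<Union>(V ` E)"
  by (induction n arbitrary: v) (auto simp: adj_def)

text \<open>A walk that enters \<open>f\<close> can leave it only through \<open>w0\<close>, so a
  detour through \<open>f\<close> gains nothing. The \<open>insert y\<close> accounts for a start
  \<open>y\<close> that lies on no edge of \<open>E\<close>.\<close>

lemma adj_insert_tree:
  assumes w0: "V f \<inter> insert y (\<Union>(V ` E)) \<subseteq> {w0}"
  shows "(y, v) \<in> adj V (insert f E) ^^ n \<Longrightarrow>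
    (y, v) \<in> adj V E ^^ n \<or> (v \<in> V f \<and> (\<exists>w\<in>V f. (y, w) \<in> adj V E ^^ n))"
proof (induction n arbitrary: v)
  case (Suc n)
  then obtain z where z: "(y, z) \<in> adj V (insert f E) ^^ n" "(z, v) \<in> adj V (insert f E)" by auto
  have up: "(y, w) \<in> adj V E ^^ n \<Longrightarrow> (y, w) \<in> adj V E ^^ Suc n" for w
    by (rule adj_mono[rotated]) auto
  from Suc.IH[OF z(1)] show ?case
  proof (elim disjE conjE bexE)
    assume a: "(y, z) \<in> adj V E ^^ n"
    show ?thesis
    proof (cases "(z, v) \<in> adj V E")
      case True
      then show ?thesis using a by auto
    next
      case False
      then have "z \<in> V f" "v \<in> V f" using z(2) by (auto simp: adj_def)
      then show ?thesis using up[OF a] by auto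
    qed
  next
    fix w assume a: "z \<in> V f" "w \<in> V f" "(y, w) \<in> adj V E ^^ n"
    then have w: "w = w0" using adj_cases[OF a(3)] w0 by auto
    show ?thesis
    proof (cases "v \<in> V f")
      case True
      then show ?thesis using up[OF a(3)] a by auto
    next
      case False
      then have "(z, v) \<in> adj V E" using z(2) by (auto simp: adj_def)
      moreover have "z = v \<or> z \<in> \<Union>(V ` E)" using calculation by (auto simp: adj_def)
      ultimately have "z = w0" using False a w0 by auto
      then show ?thesis using a w \<open>(z, v) \<in> adj V E\<close> by auto
    qed
  qed
qed auto

lemma adj_insert_tree':
  assumes c: "card (V f \<inter> insert y (\<Union>(V ` E))) \<le> 1" and fin: "finite (V f)"
    and r: "(y, v) \<in> adj V (insert f E) ^^ n" and v: "v \<in> insert y (\<Union>(V ` E))"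
  shows "(y, v) \<in> adj V E ^^ n"
proof -
  have "\<exists>w0. V f \<inter> insert y (\<Union>(V ` E)) \<subseteq> {w0}"
    using c fin by (metis card_le_Suc0_iff_eq One_nat_def finite_Int insertCI subsetI)
  then obtain w0 where w0: "V f \<inter> insert y (\<Union>(V ` E)) \<subseteq> {w0}" by blast
  from adj_insert_tree[OF w0 r] show ?thesis
  proof (elim disjE conjE bexE)
    fix w assume a: "v \<in> V f" "w \<in> V f" "(y, w) \<in> adj V E ^^ n"
    then have "w = w0" using adj_cases[OF a(3)] w0 by auto
    moreover have "v = w0" using a v w0 by auto
    ultimately show ?thesis using a by simp
  qed
qed

text \<open>The first step along \<open>f\<close> would have to start from a vertex of
  \<open>f\<close> that is already within reach in \<open>E\<close>.\<close>

lemma adj_insert_far: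
  assumes far: "\<And>w. w \<in> V f \<Longrightarrow> (y, w) \<notin> adj V E ^^ n"
  shows "m \<le> n \<Longrightarrow> (y, v) \<in> adj V (insert f E) ^^ m \<Longrightarrow> (y, v) \<in> adj V E ^^ m"
proof (induction m arbitrary: v)
  case (Suc m)
  then obtain z where z: "(y, z) \<in> adj V (insert f E) ^^ m" "(z, v) \<in> adj V (insert f E)" by auto
  then have zm: "(y, z) \<in> adj V E ^^ m" using Suc by auto
  then have "(y, z) \<in> adj V E ^^ n" using adj_mono[of m n] Suc.prems(1) by auto
  then have "z \<notin> V f" using far by auto
  then have "(z, v) \<in> adj V E" using z by (auto simp: adj_def)
  then show ?case using zm by auto
qed auto

text \<open>The rule \<open>excess\<close> speaks of distances at the time of insertion; the point
  is that they survive. A later tree edge is a dead end, and a later excess edge is too far from the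
  older ones to serve as a shortcut. The first part removes \<open>e\<close> from the graph, so it
  says that \<open>e\<close> lies on no short cycle.\<close>

lemma good_separated:
  assumes fin: "\<And>e. finite (V e)" and "good l V E X"
  shows "(\<forall>e\<in>X. \<forall>y\<in>V e. \<forall>v\<in>V e. (y, v) \<in> adj V (E - {e}) ^^ (2 * l) \<longrightarrow> v = y) \<and>
    (\<forall>e\<in>X. \<forall>e'\<in>X. e \<noteq> e' \<longrightarrow> (\<forall>y\<in>V e. \<forall>v\<in>V e'. (y, v) \<notin> adj V E ^^ (2 * l)))"
  using assms(2)
proof (induction rule: good.induct)
  case (tree E X f)
  have XE: "X \<subseteq> E" and finE: "finite E" using good_finite[OF tree(1)] by auto
  show ?case
  proof (intro conjI ballI impI)
    fix e y v assume e: "e \<in> X" and y: "y \<in> V e" and v: "v \<in> V e"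
      and r: "(y, v) \<in> adj V (insert f E - {e}) ^^ (2 * l)"
    have eq: "insert f E - {e} = insert f (E - {e})" using e tree XE by auto
    have "V f \<inter> insert y (insert v (\<Union>(V ` (E - {e})))) \<subseteq> V f \<inter> \<Union>(V ` E)" using y v e XE by auto
    then have "card (V f \<inter> insert y (insert v (\<Union>(V ` (E - {e}))))) \<le> card (V f \<inter> \<Union>(V ` E))"
      using fin by (intro card_mono) auto
    then have c': "card (V f \<inter> insert y (insert v (\<Union>(V ` (E - {e}))))) \<le> 1"
      using tree(3) by linarith
    have sub: "V f \<inter> insert y (\<Union>(V ` (E - {e}))) \<subseteq> V f \<inter> insert y (insert v (\<Union>(V ` (E - {e}))))" by auto
    have "\<exists>w0. V f \<inter> insert y (insert v (\<Union>(V ` (E - {e})))) \<subseteq> {w0}"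
      using c' fin by (metis card_le_Suc0_iff_eq One_nat_def finite_Int insertCI subsetI)
    then obtain w0 where w0: "V f \<inter> insert y (insert v (\<Union>(V ` (E - {e})))) \<subseteq> {w0}" by blast
    have w0': "V f \<inter> insert y (\<Union>(V ` (E - {e}))) \<subseteq> {w0}" using w0 sub by auto
    have "(y, v) \<in> adj V (E - {e}) ^^ (2 * l)"
      using adj_insert_tree[OF w0' r[unfolded eq]]
    proof (elim disjE conjE bexE)
      fix w assume a: "v \<in> V f" "w \<in> V f" "(y, w) \<in> adj V (E - {e}) ^^ (2 * l)"
      then have "w = w0" using adj_cases[OF a(3)] w0 by auto
      moreover have "v = w0" using a v w0 by auto
      ultimately show ?thesis using a by simp
    qed
    then show "v = y" using tree.IH e y v by auto
  next
    fix e e' y v assume e: "e \<in> X" "e' \<in> X" "e \<noteq> e'" and y: "y \<in> V e" "v \<in> V e'"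
    have eq: "insert y (\<Union>(V ` E)) = \<Union>(V ` E)" using e y XE by auto
    have "v \<in> \<Union>(V ` E)" using e y XE by auto
    then have "(y, v) \<in> adj V (insert f E) ^^ (2 * l) \<Longrightarrow> (y, v) \<in> adj V E ^^ (2 * l)"
      using adj_insert_tree'[of V f y E v "2 * l"] tree(3) fin unfolding eq by auto
    moreover have "(y, v) \<notin> adj V E ^^ (2 * l)" using tree.IH e y by simp
    ultimately show "(y, v) \<notin> adj V (insert f E) ^^ (2 * l)" by blast
  qed
next
  case (excess E X f u w)
  have XE: "X \<subseteq> E" and finE: "finite E" using good_finite[OF excess(1)] by auto
  \<comment> \<open>The rule controls only \<open>u\<close> and \<open>w\<close>, but every other
    vertex of \<open>f\<close> is new and thus unreachable in \<open>E\<close>.\<close>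
  have far: "(z, x) \<notin> adj V E ^^ (2 * l)" if "z \<in> V e" "e \<in> X" "x \<in> V f" for z e x
  proof
    assume r: "(z, x) \<in> adj V E ^^ (2 * l)"
    have "x \<in> \<Union>(V ` E)" using adj_cases[OF r] that XE by auto
    then have "x = u \<or> x = w" using excess(3) that by auto
    then show False using excess(5)[of z] r that by auto
  qed
  have far': "(z, x) \<notin> adj V (E - {e}) ^^ (2 * l)" if "z \<in> V e" "e \<in> X" "x \<in> V f" for z e x
    using far[OF that] adj_mono_edges[of "E - {e}" E z x "2 * l" V] by auto
  have old: "v = y" if "e \<in> X" "y \<in> V e" "v \<in> V e" "(y, v) \<in> adj V (insert f E - {e}) ^^ (2 * l)" for e y v
  proof -
    have eq: "insert f E - {e} = insert f (E - {e})" using that excess(2) XE by auto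
    have "(y, v) \<in> adj V (E - {e}) ^^ (2 * l)"
      by (rule adj_insert_far[of V f y "2 * l" "E - {e}"]) (use far' that eq in auto)
    then show ?thesis using excess.IH that by auto
  qed
  have new: "v = y" if "y \<in> V f" "v \<in> V f" "(y, v) \<in> adj V E ^^ (2 * l)" for y v
  proof (rule ccontr)
    assume ne: "v \<noteq> y"
    have "v \<in> \<Union>(V ` E)" using adj_cases[OF that(3)] ne by auto
    moreover have "y \<in> \<Union>(V ` E)" using adj_cases[of v y] adj_sym[of y v] that(3) ne by blast
    ultimately have "y \<in> {u, w}" "v \<in> {u, w}" using excess(3) that by auto
    then show False using ne excess(4) that(3) adj_sym[of u w] by auto
  qed
  have sep: "(y, v) \<notin> adj V (insert f E) ^^ (2 * l)" if "e \<in> X" "y \<in> V e" "(y, v) \<notin> adj V E ^^ (2 * l)" for e y v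
    using adj_insert_far[of V f y "2 * l" E "2 * l" v] far that by auto
  show ?case
  proof (intro conjI ballI impI)
    fix e y v assume "e \<in> insert f X" "y \<in> V e" "v \<in> V e"
      "(y, v) \<in> adj V (insert f E - {e}) ^^ (2 * l)"
    then show "v = y" using old new excess(2) by (cases "e = f") auto
  next
    fix e e' y v assume e: "e \<in> insert f X" "e' \<in> insert f X" "e \<noteq> e'" and y: "y \<in> V e" "v \<in> V e'"
    show "(y, v) \<notin> adj V (insert f E) ^^ (2 * l)"
    proof (cases "e = f")
      case True
      then have "e' \<in> X" using e by auto
      then have "(v, y) \<notin> adj V (insert f E) ^^ (2 * l)" using sep far y True by auto
      then show ?thesis using adj_sym by metis
    next
      case False
      then have "e \<in> X" using e by auto
      show ?thesis
      proof (cases "e' = f")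
        case True
        then show ?thesis using sep far y \<open>e \<in> X\<close> by auto
      next
        case F: False
        then have "(y, v) \<notin> adj V E ^^ (2 * l)" using excess.IH e \<open>e \<in> X\<close> y by auto
        then show ?thesis using sep \<open>e \<in> X\<close> y by blast
      qed
    qed
  qed
qed auto

section \<open>Even families on separated hypergraphs\<close>

definition even_family :: "'e set \<Rightarrow> ('e \<Rightarrow> 'v set) \<Rightarrow> bool" where
  "even_family E F \<longleftrightarrow> (\<forall>e\<in>E. even (card (F e))) \<and> (\<forall>v. even (card {e\<in>E. v \<in> F e}))"

text \<open>Peel off the newest tree edge: a new vertex in \<open>F f\<close> would be covered
  exactly once, so \<open>F f\<close> has at most one vertex, and parity empties it.\<close>

lemma even_family_trivial:
  assumes fin: "\<And>e. finite (V e)" and "good l V E X"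
    and "\<And>e. e \<in> E \<Longrightarrow> F e \<subseteq> V e" and "even_family E F" and "\<And>e. e \<in> X \<Longrightarrow> F e = {}"
  shows "\<forall>e\<in>E. F e = {}"
  using assms(2-)
proof (induction rule: good.induct)
  case (tree E X f)
  have finE: "finite E" using good_finite[OF tree(1)] by auto
  have "v \<in> \<Union>(V ` E)" if "v \<in> F f" for v
  proof (rule ccontr)
    assume "v \<notin> \<Union>(V ` E)"
    then have "{e\<in>insert f E. v \<in> F e} = {f}" using that tree(5) by auto
    then show False using tree(6) unfolding even_family_def by (metis card.empty card_insert_disjoint
        empty_iff finite.emptyI odd_one One_nat_def)
  qed
  then have "F f \<subseteq> V f \<inter> \<Union>(V ` E)" using tree(5) by auto
  then have "card (F f) \<le> 1" using tree(3) fin card_mono[of "V f \<inter> \<Union>(V ` E)" "F f"] by auto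
  moreover have "even (card (F f))" using tree(6) by (auto simp: even_family_def)
  ultimately have "card (F f) = 0" by (metis One_nat_def le_Suc_eq le_zero_eq odd_one)
  then have Ff: "F f = {}" using fin tree(5) by (metis card_0_eq finite_subset insertI1)
  then have "{e\<in>insert f E. v \<in> F e} = {e\<in>E. v \<in> F e}" for v by auto
  then have "even_family E F" using tree(6) by (auto simp: even_family_def)
  then show ?case using tree Ff by auto
next
  case (excess E X f u w)
  have Ff: "F f = {}" using excess by auto
  then have "{e\<in>insert f E. v \<in> F e} = {e\<in>E. v \<in> F e}" for v by auto
  then have "even_family E F" using excess.prems(2) by (auto simp: even_family_def)
  then show ?case using excess Ff by auto
qed auto

text \<open>In the order of insertion, an ordinary edge contributes all but at most one vertex of
  \<open>F e\<close> for the first time; truncated subtraction lets empty sets count zero. Set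
  against the double covering of every vertex, this limits the large sets in
  \<open>even_family_pairs\<close>.\<close>

lemma good_card_vertices:
  assumes fin: "\<And>e. finite (V e)" and "good l V E X" and "\<And>e. e \<in> E \<Longrightarrow> F e \<subseteq> V e"
  shows "(\<Sum>e\<in>E - X. card (F e) - 1) \<le> card (\<Union>(F ` E))"
  using assms(2-)
proof (induction rule: good.induct)
  case (tree E X f)
  have finE: "finite E" and XE: "X \<subseteq> E" using good_finite[OF tree(1)] by auto
  have finF: "finite (F e)" if "e \<in> insert f E" for e
    using tree(5)[OF that] fin finite_subset by blast
  have "card (F f) \<le> card (F f - \<Union>(V ` E)) + card (F f \<inter> \<Union>(V ` E))"
    by (metis add.commute card_Int_Diff finF insertI1 order_refl)
  also have "card (F f \<inter> \<Union>(V ` E)) \<le> card (V f \<inter> \<Union>(V ` E))"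
    using tree(5) fin by (intro card_mono) auto
  finally have c: "card (F f) - 1 \<le> card (F f - \<Union>(V ` E))" using tree(3) by linarith
  have "insert f E - X = insert f (E - X)" using tree(2) XE by auto
  then have "(\<Sum>e\<in>insert f E - X. card (F e) - 1) = (card (F f) - 1) + (\<Sum>e\<in>E - X. card (F e) - 1)"
    using finE tree(2) by simp
  also have "\<dots> \<le> card (F f - \<Union>(V ` E)) + card (\<Union>(F ` E))" using c tree by (intro add_mono) auto
  also have "\<dots> = card ((F f - \<Union>(V ` E)) \<union> \<Union>(F ` E))"
    using tree(5) finE finF by (subst card_Un_disjoint) fastforce+
  also have "\<dots> \<le> card (\<Union>(F ` insert f E))" using finE finF by (intro card_mono) auto
  finally show ?case .
next
  case (excess E X f u w)
  have finE: "finite E" and XE: "X \<subseteq> E" using good_finite[OF excess(1)] by auto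
  have finF: "finite (F e)" if "e \<in> insert f E" for e
    using excess(7)[OF that] fin finite_subset by blast
  have "insert f E - insert f X = E - X" using excess(2) XE by auto
  moreover have "card (\<Union>(F ` E)) \<le> card (\<Union>(F ` insert f E))"
    using finE finF by (intro card_mono) auto
  ultimately show ?case using excess by fastforce
qed auto

lemma sum_card_Int:
  assumes "finite E" "finite B"
  shows "(\<Sum>e\<in>E. card (F e \<inter> B)) = (\<Sum>v\<in>B. card {e\<in>E. v \<in> F e})"
proof -
  have "(\<Sum>e\<in>E. card (F e \<inter> B)) = (\<Sum>e\<in>E. \<Sum>v\<in>B. if v \<in> F e then 1 else 0)"
    using assms by (intro sum.cong refl) (simp add: sum.If_cases Int_commute)
  also have "\<dots> = (\<Sum>v\<in>B. \<Sum>e\<in>E. if v \<in> F e then 1 else 0)" by (rule sum.swap)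
  also have "\<dots> = (\<Sum>v\<in>B. card {e\<in>E. v \<in> F e})"
    using assms by (intro sum.cong refl) (simp add: sum.If_cases Int_def)
  finally show ?thesis .
qed

text \<open>
  The ball of radius \<open>s\<close> around \<open>y\<close> in the graph without \<open>e\<close> meets \<open>F e\<close> only in \<open>y\<close>, so by
  parity some other member of \<open>F\<close> leaves it; the edges found for different radii differ.
\<close>

lemma even_family_local:
  assumes fin: "\<And>e. finite (V e)" and finE: "finite E" and F: "\<And>e. e \<in> E \<Longrightarrow> F e \<subseteq> V e"
    and ev: "even_family E F" and e: "e \<in> E" and y: "y \<in> F e"
    and sep: "\<And>v. v \<in> V e \<Longrightarrow> (y, v) \<in> adj V (E - {e}) ^^ l \<Longrightarrow> v = y"
  shows "l \<le> card {f\<in>E - {e}. F f \<noteq> {} \<and> V f \<subseteq> (adj V (E - {e}) ^^ l) `` {y}}"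
proof -
  define B where "B s = (adj V (E - {e}) ^^ s) `` {y}" for s
  have Bmono: "B s \<subseteq> B t" if "s \<le> t" for s t using that adj_mono by (auto simp: B_def)
  have finB: "finite (B s)" for s
  proof (rule finite_subset)
    show "B s \<subseteq> insert y (\<Union>(V ` E))" unfolding B_def using adj_cases[of y _ s V "E - {e}"] by blast
    show "finite (insert y (\<Union>(V ` E)))" using fin finE by auto
  qed
  have ex: "\<exists>f\<in>E - {e}. F f \<noteq> {} \<and> V f \<subseteq> B (Suc s) \<and> \<not> V f \<subseteq> B s" if s: "s < l" for s
  proof -
    have "F e \<inter> B s = {y}"
    proof -
      have "v = y" if "v \<in> F e" "v \<in> B s" for v
        using sep[of v] Bmono[of s l] s that F[OF e] by (auto simp: B_def)
      moreover have "y \<in> B s" using adj_refl by (auto simp: B_def)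
      ultimately show ?thesis using y by blast
    qed
    then have one: "card (F e \<inter> B s) = 1" by simp
    have "even (\<Sum>f\<in>E. card (F f \<inter> B s))"
      unfolding sum_card_Int[OF finE finB] using ev by (auto simp: even_family_def intro!: dvd_sum)
    then have "odd (\<Sum>f\<in>E - {e}. card (F f \<inter> B s))"
      using one by (simp add: sum.remove[OF finE e])
    then obtain f where f: "f \<in> E - {e}" "odd (card (F f \<inter> B s))"
      using dvd_sum[of "E - {e}" 2 "\<lambda>f. card (F f \<inter> B s)"] by blast
    have "even (card (F f))" using ev f by (auto simp: even_family_def)
    then have "F f \<inter> B s \<noteq> F f" using f by auto
    moreover have "F f \<inter> B s \<noteq> {}" using f by (metis card.empty even_zero)
    ultimately obtain a c where a: "a \<in> F f" "a \<in> B s" and c: "c \<in> F f" "c \<notin> B s" by auto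
    have "V f \<subseteq> B (Suc s)"
      using a f F[of f] unfolding B_def by (auto simp: adj_def)
    then show ?thesis using f a c F[of f] by blast
  qed
  then obtain g where g: "\<And>s. s < l \<Longrightarrow> g s \<in> E - {e} \<and> F (g s) \<noteq> {} \<and> V (g s) \<subseteq> B (Suc s) \<and> \<not> V (g s) \<subseteq> B s"
    by metis
  have "g s \<noteq> g t" if "s < t" "t < l" for s t
    using g[of s] g[of t] Bmono[of "Suc s" t] that by auto
  then have "inj_on g {..<l}" unfolding inj_on_def
    by (metis lessThan_iff linorder_neqE_nat)
  moreover have "g ` {..<l} \<subseteq> {f\<in>E - {e}. F f \<noteq> {} \<and> V f \<subseteq> B l}"
  proof (rule image_subsetI)
    fix s assume "s \<in> {..<l}"
    then have "s < l" "B (Suc s) \<subseteq> B l" using Bmono by auto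
    then show "g s \<in> {f\<in>E - {e}. F f \<noteq> {} \<and> V f \<subseteq> B l}" using g[of s] by blast
  qed
  ultimately have "card {..<l} \<le> card {f\<in>E - {e}. F f \<noteq> {} \<and> V f \<subseteq> B l}"
    using finE by (metis (no_types, lifting) card_inj_on_le finite_Diff finite_subset mem_Collect_eq subsetI)
  then show ?thesis by (simp add: B_def)
qed

text \<open>\<open>even_family_local\<close> yields \<open>l\<close> edges in a ball at each excess
  edge with nonempty \<open>F e\<close>. By the distance \<open>2 * l\<close> these balls are
  disjoint and contain no other excess edge, so the edges found are distinct and ordinary.\<close>

lemma good_even_family_length:
  assumes fin: "\<And>e. finite (V e)" and g: "good l V E X" and F: "\<And>e. e \<in> E \<Longrightarrow> F e \<subseteq> V e"
    and ev: "even_family E F"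
  shows "l * card {e\<in>X. F e \<noteq> {}} \<le> card {f\<in>E - X. F f \<noteq> {}}"
proof -
  have finE: "finite E" and XE: "X \<subseteq> E" using good_finite[OF g] by auto
  define XF where "XF = {e\<in>X. F e \<noteq> {}}"
  have finXF: "finite XF" using finite_subset[OF XE finE] by (simp add: XF_def)
  have "\<forall>e\<in>XF. \<exists>v. v \<in> F e" by (auto simp: XF_def)
  then obtain y where "\<forall>e\<in>XF. y e \<in> F e" by (rule bchoice[elim_format]) blast
  then have y: "\<And>e. e \<in> XF \<Longrightarrow> y e \<in> F e" by blast
  define S where "S e = {f\<in>E - {e}. F f \<noteq> {} \<and> V f \<subseteq> (adj V (E - {e}) ^^ l) `` {y e}}" for e
  have yV: "y e \<in> V e" "e \<in> X" "e \<in> E" if "e \<in> XF" for e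
    using y[OF that] F[of e] that XE by (auto simp: XF_def)
  note sep = good_separated[OF fin g]
  have sep1: "v = y" if "e \<in> X" "y \<in> V e" "v \<in> V e" "(y, v) \<in> adj V (E - {e}) ^^ (2 * l)" for e y v
    using conjunct1[OF sep] that by blast
  have sep2: "(y, v) \<notin> adj V E ^^ (2 * l)" if "e \<in> X" "e' \<in> X" "e \<noteq> e'" "y \<in> V e" "v \<in> V e'" for e e' y v
    using conjunct2[OF sep] that by blast
  have cS: "l \<le> card (S e)" if e: "e \<in> XF" for e
    unfolding S_def
  proof (rule even_family_local[OF fin finE F ev yV(3)[OF e] y[OF e]])
    fix v assume v: "v \<in> V e" "(y e, v) \<in> adj V (E - {e}) ^^ l"
    have "(y e, v) \<in> adj V (E - {e}) ^^ (2 * l)" by (rule adj_mono[OF _ v(2)]) simp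
    then show "v = y e" using sep1[OF yV(2)[OF e] yV(1)[OF e] v(1)] by simp
  qed
  have reach: "(y e, v) \<in> adj V E ^^ l" if "f \<in> S e" "v \<in> V f" for e f v
  proof (rule adj_mono_edges)
    have "V f \<subseteq> (adj V (E - {e}) ^^ l) `` {y e}" using that(1) by (simp add: S_def)
    then show "(y e, v) \<in> adj V (E - {e}) ^^ l" using that(2) by blast
  qed auto
  have ne: "\<exists>v. v \<in> V f" if "f \<in> S e" for e f
    using that F[of f] by (auto simp: S_def)
  have disj: "S e \<inter> S e' = {}" if "e \<in> XF" "e' \<in> XF" "e \<noteq> e'" for e e'
  proof (rule ccontr)
    assume "S e \<inter> S e' \<noteq> {}"
    then obtain f v where f: "f \<in> S e" "f \<in> S e'" "v \<in> V f" using ne by blast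
    then have "(y e, v) \<in> adj V E ^^ l" "(v, y e') \<in> adj V E ^^ l"
      using reach adj_sym by metis+
    then have "(y e, y e') \<in> adj V E ^^ (2 * l)" using adj_trans by (metis mult_2)
    then show False using sep2[of e e' "y e" "y e'"] yV that by auto
  qed
  have SX: "S e \<subseteq> {f\<in>E - X. F f \<noteq> {}}" if "e \<in> XF" for e
  proof
    fix f assume f: "f \<in> S e"
    obtain v where v: "v \<in> V f" using ne[OF f] by auto
    have "(y e, v) \<in> adj V E ^^ (2 * l)" by (rule adj_mono[OF _ reach[OF f v]]) simp
    then have "f \<notin> X" using sep2[of e f "y e" v] yV[OF that] v f by (auto simp: S_def)
    then show "f \<in> {f\<in>E - X. F f \<noteq> {}}" using f by (auto simp: S_def)
  qed
  have finS: "finite (S e)" for e using finE by (auto simp: S_def)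
  have "l * card XF = (\<Sum>e\<in>XF. l)" by simp
  also have "\<dots> \<le> (\<Sum>e\<in>XF. card (S e))" using cS by (rule sum_mono)
  also have "\<dots> = card (\<Union>(S ` XF))" using finXF finS disj by (subst card_UN_disjoint) auto
  also have "\<dots> \<le> card {f\<in>E - X. F f \<noteq> {}}" using SX finE by (intro card_mono) auto
  finally show ?thesis by (simp add: XF_def)
qed

text \<open>Every vertex in use is covered at least twice, whereas each nonempty ordinary set brings
  at least \<open>card (F e) - 1\<close> new vertices. Comparing the counts, the excess edges have
  to pay for each ordinary set of three or more vertices, so there are at most \<open>k\<close> of
  these per excess edge; the other nonempty ordinary sets are pairs.\<close>

lemma even_family_pairs:
  assumes fin: "\<And>e. finite (V e)" and ck: "\<And>e. card (V e) \<le> k"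
    and g: "good l V E X" and F: "\<And>e. e \<in> E \<Longrightarrow> F e \<subseteq> V e"
    and ev: "even_family E F"
  shows "l * card {e\<in>X. F e \<noteq> {}} \<le> card {f\<in>E - X. card (F f) = 2} + k * card {e\<in>X. F e \<noteq> {}}"
proof -
  have finE: "finite E" and XE: "X \<subseteq> E" using good_finite[OF g] by auto
  have finX: "finite X" using finE XE finite_subset by auto
  have finF: "finite (F e)" if "e \<in> E" for e
    using F[OF that] fin finite_subset by blast
  let ?U = "\<Union>(F ` E)"
  have finU: "finite ?U" using finE finF by auto
  have two: "2 \<le> card {e\<in>E. v \<in> F e}" if "v \<in> ?U" for v
  proof -
    have "card {e\<in>E. v \<in> F e} \<noteq> 0" using that finE by auto
    moreover have "even (card {e\<in>E. v \<in> F e})" using ev by (auto simp: even_family_def)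
    ultimately show ?thesis by (metis One_nat_def Suc_1 Suc_leI le_neq_implies_less less_one not_le odd_one)
  qed
  have "2 * card ?U = (\<Sum>v\<in>?U. 2)" by simp
  also have "\<dots> \<le> (\<Sum>v\<in>?U. card {e\<in>E. v \<in> F e})" using two by (intro sum_mono) auto
  also have "\<dots> = (\<Sum>e\<in>E. card (F e \<inter> ?U))" using sum_card_Int[OF finE finU] by metis
  also have "\<dots> = (\<Sum>e\<in>E. card (F e))" by (intro sum.cong refl arg_cong[of _ _ card]) auto
  also have "\<dots> = (\<Sum>e\<in>X. card (F e)) + (\<Sum>e\<in>E - X. card (F e))"
    using sum.subset_diff[OF XE finE] by (metis add.commute)
  finally have 1: "2 * (\<Sum>e\<in>E - X. card (F e) - 1) \<le> (\<Sum>e\<in>X. card (F e)) + (\<Sum>e\<in>E - X. card (F e))"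
    using good_card_vertices[OF fin g F] by linarith
  \<comment> \<open>Size one, where the inequality fails, is ruled out by parity; sizes zero and two
    give equality.\<close>
  have 2: "card (F e) + (if 3 \<le> card (F e) then 1 else 0) \<le> 2 * (card (F e) - 1)" if "e \<in> E - X" for e
  proof -
    have "even (card (F e))" using ev that by (auto simp: even_family_def)
    then have "card (F e) \<noteq> 1" by auto
    then show ?thesis by (cases "card (F e) = 0") auto
  qed
  have "(\<Sum>e\<in>E - X. card (F e)) + card {e\<in>E - X. 3 \<le> card (F e)}
      = (\<Sum>e\<in>E - X. card (F e) + (if 3 \<le> card (F e) then 1 else 0))"
    using finE by (simp add: sum.distrib sum.If_cases Int_def)
  also have "\<dots> \<le> 2 * (\<Sum>e\<in>E - X. card (F e) - 1)"
    unfolding sum_distrib_left by (rule sum_mono) (rule 2)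
  finally have 3: "card {e\<in>E - X. 3 \<le> card (F e)} \<le> (\<Sum>e\<in>X. card (F e))" using 1 by linarith
  have "(\<Sum>e\<in>X. card (F e)) = (\<Sum>e\<in>{e\<in>X. F e \<noteq> {}}. card (F e))"
    using finX by (intro sum.mono_neutral_right) auto
  also have "\<dots> \<le> (\<Sum>e\<in>{e\<in>X. F e \<noteq> {}}. k)"
  proof (rule sum_mono)
    fix e assume "e \<in> {e\<in>X. F e \<noteq> {}}"
    then have "F e \<subseteq> V e" using F XE by auto
    then show "card (F e) \<le> k" using card_mono[OF fin] ck le_trans by blast
  qed
  finally have 4: "card {e\<in>E - X. 3 \<le> card (F e)} \<le> k * card {e\<in>X. F e \<noteq> {}}"
    using 3 by (simp add: mult.commute)
  have "{f\<in>E - X. F f \<noteq> {}} \<subseteq> {f\<in>E - X. card (F f) = 2} \<union> {e\<in>E - X. 3 \<le> card (F e)}"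
  proof
    fix f assume f: "f \<in> {f\<in>E - X. F f \<noteq> {}}"
    then have "card (F f) \<noteq> 0" "even (card (F f))" using finF ev by (auto simp: even_family_def)
    then have "card (F f) \<noteq> 0" "card (F f) \<noteq> 1" by auto
    then have "card (F f) = 2 \<or> 3 \<le> card (F f)" by linarith
    then show "f \<in> {f\<in>E - X. card (F f) = 2} \<union> {e\<in>E - X. 3 \<le> card (F e)}" using f by auto
  qed
  then have "card {f\<in>E - X. F f \<noteq> {}} \<le> card ({f\<in>E - X. card (F f) = 2} \<union> {e\<in>E - X. 3 \<le> card (F e)})"
    using finE by (intro card_mono) auto
  also have "\<dots> \<le> card {f\<in>E - X. card (F f) = 2} + card {e\<in>E - X. 3 \<le> card (F e)}"
    by (rule card_Un_le)
  finally show ?thesis using good_even_family_length[OF fin g F ev] 4 by linarith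
qed

section \<open>The likelihood ratio of planted literals\<close>

definition sg :: "bool \<Rightarrow> real" where "sg b = (if b then -1 else 1)"

lemma sg_simps: "sg (p \<noteq> q) = sg p * sg q" "sg (\<not> p) = - sg p" "sg p * sg p = 1" "\<bar>sg p\<bar> = 1"
  by (auto simp: sg_def)

lemma prod_sum_PiE:
  fixes f :: "'a \<Rightarrow> 'b \<Rightarrow> 'c::comm_semiring_1"
  assumes "finite A" "\<And>x. x \<in> A \<Longrightarrow> finite (B x)"
  shows "(\<Prod>x\<in>A. \<Sum>y\<in>B x. f x y) = (\<Sum>g\<in>PiE A B. \<Prod>x\<in>A. f x (g x))"
  using assms
proof (induction A rule: finite_induct)
  case (insert a A)
  have inj: "inj_on (\<lambda>(y, g). g(a := y)) (B a \<times> PiE A B)"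
    using insert(2) by (rule inj_combinator)
  have "(\<Sum>g\<in>PiE (insert a A) B. \<Prod>x\<in>insert a A. f x (g x))
      = (\<Sum>(y, g)\<in>B a \<times> PiE A B. \<Prod>x\<in>insert a A. f x ((g(a := y)) x))"
    unfolding PiE_insert_eq by (subst sum.reindex[OF inj]) (simp add: case_prod_unfold)
  also have "\<dots> = (\<Sum>(y, g)\<in>B a \<times> PiE A B. f a y * (\<Prod>x\<in>A. f x (g x)))"
  proof (intro sum.cong refl, clarify)
    fix y g
    have "(\<Prod>x\<in>A. f x ((g(a := y)) x)) = (\<Prod>x\<in>A. f x (g x))"
      using insert(2) by (intro prod.cong) auto
    then show "(\<Prod>x\<in>insert a A. f x ((g(a := y)) x)) = f a y * (\<Prod>x\<in>A. f x (g x))"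
      using insert(1,2) by simp
  qed
  also have "\<dots> = (\<Sum>y\<in>B a. f a y) * (\<Sum>g\<in>PiE A B. \<Prod>x\<in>A. f x (g x))"
    by (simp add: sum_product sum.cartesian_product)
  finally show ?case using insert by simp
qed simp

lemma even_card_symdiff:
  assumes "finite A" "finite B" "even (card A)" "even (card B)"
  shows "even (card ((A - B) \<union> (B - A)))"
proof -
  have "card A = card (A \<inter> B) + card (A - B)" "card B = card (B \<inter> A) + card (B - A)"
    using assms card_Int_Diff by blast+
  moreover have "card ((A - B) \<union> (B - A)) = card (A - B) + card (B - A)"
    using assms by (intro card_Un_disjoint) auto
  ultimately show ?thesis using assms by (simp add: Int_commute)
qed

lemma even_family_symdiff:
  assumes "finite E" "\<And>e. e \<in> E \<Longrightarrow> finite (F e)" "\<And>e. e \<in> E \<Longrightarrow> finite (G e)"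
    and "even_family E F" "even_family E G"
  shows "even_family E (\<lambda>e. (F e - G e) \<union> (G e - F e))"
  unfolding even_family_def
proof (intro conjI allI ballI)
  fix e assume "e \<in> E"
  then show "even (card ((F e - G e) \<union> (G e - F e)))"
    using assms by (intro even_card_symdiff) (auto simp: even_family_def)
next
  fix v
  have "{e\<in>E. v \<in> (F e - G e) \<union> (G e - F e)}
      = ({e\<in>E. v \<in> F e} - {e\<in>E. v \<in> G e}) \<union> ({e\<in>E. v \<in> G e} - {e\<in>E. v \<in> F e})" by auto
  also have "even (card \<dots>)"
    using assms by (intro even_card_symdiff) (auto simp: even_family_def)
  finally show "even (card {e\<in>E. v \<in> (F e - G e) \<union> (G e - F e)})" .
qed

text \<open>By \<open>even_family_trivial\<close>, an even family is determined by its restriction to the excess edges.\<close>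

lemma sum_even_families:
  fixes vt :: "'e \<Rightarrow> nat \<Rightarrow> 'v" and x :: real
  assumes inj: "\<And>e. e \<in> E \<Longrightarrow> inj_on (vt e) {..<k}"
    and g: "good l (\<lambda>e. vt e ` {..<k}) E X" and x: "0 \<le> x"
  shows "(\<Sum>F\<in>{F \<in> PiE E (\<lambda>_. Pow {..<k}). even_family E (\<lambda>e. vt e ` F e)}. x ^ card {e\<in>X. F e \<noteq> {}})
    \<le> (1 + 2 ^ k * x) ^ card X"
proof -
  let ?V = "\<lambda>e. vt e ` {..<k}"
  let ?P = "\<lambda>E. PiE E (\<lambda>_. Pow {..<k})"
  let ?EF = "{F \<in> ?P E. even_family E (\<lambda>e. vt e ` F e)}"
  have fin: "finite (?V e)" for e by simp
  have finE: "finite E" and XE: "X \<subseteq> E" using good_finite[OF g] by auto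
  have finX: "finite X" using finite_subset[OF XE finE] .
  have inj_res: "inj_on (\<lambda>F. restrict F X) ?EF"
  proof (rule inj_onI)
    fix F G assume F: "F \<in> ?EF" and G: "G \<in> ?EF" and eq: "restrict F X = restrict G X"
    define D where "D e = (vt e ` F e - vt e ` G e) \<union> (vt e ` G e - vt e ` F e)" for e
    have sub: "F e \<subseteq> {..<k}" "G e \<subseteq> {..<k}" if "e \<in> E" for e using F G that by (auto simp: PiE_iff)
    have fins: "finite (F e)" "finite (G e)" if "e \<in> E" for e using sub[OF that] finite_subset by blast+
    have "\<forall>e\<in>E. D e = {}"
    proof (rule even_family_trivial[OF fin g])
      show "D e \<subseteq> ?V e" if "e \<in> E" for e using sub[OF that] by (auto simp: D_def)
      show "even_family E D" unfolding D_def using F G fins finE by (intro even_family_symdiff) auto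
      show "D e = {}" if "e \<in> X" for e using fun_cong[OF eq, of e] that by (auto simp: D_def)
    qed
    then have "vt e ` F e = vt e ` G e" if "e \<in> E" for e using that by (auto simp: D_def)
    then have "F e = G e" if "e \<in> E" for e
      using that sub[OF that] inj[OF that] inj_on_image_eq_iff by metis
    then show "F = G" using F G by (intro PiE_ext[of F E _ G]) auto
  qed
  have "(\<Sum>F\<in>?EF. x ^ card {e\<in>X. F e \<noteq> {}}) = (\<Sum>F\<in>?EF. x ^ card {e\<in>X. restrict F X e \<noteq> {}})"
    by (intro sum.cong refl arg_cong[of _ _ "\<lambda>A. x ^ card A"]) auto
  also have "\<dots> = (\<Sum>F\<in>(\<lambda>F. restrict F X) ` ?EF. x ^ card {e\<in>X. F e \<noteq> {}})"
    by (simp add: sum.reindex[OF inj_res] o_def)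
  also have "\<dots> \<le> (\<Sum>F\<in>?P X. x ^ card {e\<in>X. F e \<noteq> {}})"
  proof (intro sum_mono2 finite_PiE finX)
    show "(\<lambda>F. restrict F X) ` ?EF \<subseteq> ?P X" using XE by (fastforce simp: PiE_iff)
  qed (use x in auto)
  also have "\<dots> = (\<Sum>F\<in>?P X. \<Prod>e\<in>X. if F e \<noteq> {} then x else 1)"
    using finX by (intro sum.cong refl) (simp add: prod.If_cases Int_def)
  also have "\<dots> = (\<Prod>e\<in>X. \<Sum>S\<in>Pow {..<k}. if S \<noteq> {} then x else 1)"
    using finX by (intro prod_sum_PiE[symmetric]) auto
  also have "\<dots> \<le> (\<Prod>e\<in>X. 1 + 2 ^ k * x)"
  proof (intro prod_mono conjI)
    have "(\<Sum>S\<in>Pow {..<k}. if S \<noteq> {} then x else 1)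
        = 1 + (\<Sum>S\<in>Pow {..<k} - {{}}. if S \<noteq> {} then x else 1)"
      by (subst sum.remove[of _ "{}"]) auto
    also have "(\<Sum>S\<in>Pow {..<k} - {{}}. if S \<noteq> {} then x else 1) = (\<Sum>S\<in>Pow {..<k} - {{}}. x)"
      by (intro sum.cong) auto
    also have "\<dots> \<le> (\<Sum>S\<in>Pow {..<k}. x)" using x by (intro sum_mono2) auto
    also have "\<dots> = 2 ^ k * x" by (simp add: card_Pow)
    finally show "(\<Sum>S\<in>Pow {..<k}. if S \<noteq> {} then x else 1) \<le> 1 + 2 ^ k * x" by simp
    show "0 \<le> (\<Sum>S\<in>Pow {..<k}. if S \<noteq> {} then x else 1)" using x by (intro sum_nonneg) auto
  qed
  finally show ?thesis by simp
qed

section \<open>Fourier expansion of planted literals\<close>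

definition mask :: "nat \<Rightarrow> (nat \<Rightarrow> nat) \<Rightarrow> (nat \<Rightarrow> bool) \<Rightarrow> bool list \<Rightarrow> bool list" where
  "mask k w a b = map (\<lambda>j. a (w j) \<noteq> b ! j) [0..<k]"

lemma mask_cube: "mask k w a b \<in> cube k"
  by (simp add: mask_def cube_def)

text \<open>The Fourier coefficient of \<open>dens k A\<close> at \<open>S\<close>, written as the
  mean over \<open>A\<close> of the character of \<open>S\<close>.\<close>

definition coef :: "bool list set \<Rightarrow> nat set \<Rightarrow> real" where
  "coef A S = (\<Sum>y\<in>A. \<Prod>j\<in>S. sg (y ! j)) / card A"

text \<open>Density of the uniform distribution on \<open>A\<close> with respect to the uniform distribution on the cube.\<close>

definition dens :: "nat \<Rightarrow> bool list set \<Rightarrow> bool list \<Rightarrow> real" where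
  "dens k A y = (if y \<in> A then 2 ^ k / card A else 0)"

lemma finite_cube: "finite (cube k)" and card_cube: "card (cube k) = 2 ^ k"
proof -
  have "cube k = {xs. set xs \<subseteq> (UNIV :: bool set) \<and> length xs = k}" by (auto simp: cube_def)
  then show "finite (cube k)" "card (cube k) = 2 ^ k"
    using finite_lists_length_eq[of "UNIV :: bool set" k] card_lists_length_eq[of "UNIV :: bool set" k] by auto
qed

text \<open>Complementation permutes \<open>A\<close> and negates a character of odd degree.\<close>

lemma coef_odd:
  assumes A: "A \<subseteq> cube k" "\<And>y. y \<in> A \<Longrightarrow> map Not y \<in> A" and S: "S \<subseteq> {..<k}" "odd (card S)"
  shows "coef A S = 0"
proof -
  have finS: "finite S" using S finite_subset by blast
  have inj: "inj_on (map Not) A" by (rule inj_on_subset[of _ UNIV]) (auto simp: inj_def)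
  have "map Not ` A = A"
  proof
    show "A \<subseteq> map Not ` A"
    proof
      fix y assume "y \<in> A"
      then have "map Not y \<in> A" "y = map Not (map Not y)" using A by (auto simp: o_def)
      then show "y \<in> map Not ` A" by blast
    qed
  qed (use A in auto)
  then have "(\<Sum>y\<in>A. \<Prod>j\<in>S. sg (y ! j)) = (\<Sum>y\<in>A. \<Prod>j\<in>S. sg (map Not y ! j))"
    using sum.reindex[OF inj, of "\<lambda>y. \<Prod>j\<in>S. sg (y ! j)"] by (simp add: o_def)
  also have "\<dots> = (\<Sum>y\<in>A. - (\<Prod>j\<in>S. sg (y ! j)))"
  proof (intro sum.cong refl)
    fix y assume "y \<in> A"
    then have "(\<Prod>j\<in>S. sg (map Not y ! j)) = (\<Prod>j\<in>S. (-1) * sg (y ! j))"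
      using A(1) S(1) by (intro prod.cong refl) (auto simp: cube_def sg_simps subset_iff)
    also have "\<dots> = - (\<Prod>j\<in>S. sg (y ! j))" using S(2) by (simp only: prod.distrib prod_constant) simp
    finally show "(\<Prod>j\<in>S. sg (map Not y ! j)) = - (\<Prod>j\<in>S. sg (y ! j))" .
  qed
  finally show ?thesis by (simp add: coef_def sum_negf)
qed

lemma abs_prod_sg: "\<bar>\<Prod>j\<in>S. sg (f j)\<bar> = 1"
  by (simp add: abs_prod sg_simps)

lemma abs_coef_le: "\<bar>coef A S\<bar> \<le> 1"
proof (cases "card A = 0")
  case False
  have "\<bar>\<Sum>y\<in>A. \<Prod>j\<in>S. sg (y ! j)\<bar> \<le> (\<Sum>y\<in>A. \<bar>\<Prod>j\<in>S. sg (y ! j)\<bar>)" by (rule sum_abs)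
  then show ?thesis using False by (simp add: coef_def abs_prod_sg abs_divide)
qed (simp add: coef_def)

lemma coef_empty: "finite A \<Longrightarrow> A \<noteq> {} \<Longrightarrow> coef A {} = 1"
  by (simp add: coef_def)

text \<open>Fourier inversion: summed over all \<open>S\<close>, the products of the characters at
  \<open>z\<close> and \<open>y\<close> factor into the terms
  \<open>sg (z ! j) * sg (y ! j) + 1\<close>, one of which vanishes unless
  \<open>z = y\<close>.\<close>

lemma dens_expand:
  assumes A: "A \<subseteq> cube k" and y: "y \<in> cube k"
  shows "dens k A y = (\<Sum>S\<in>Pow {..<k}. coef A S * (\<Prod>j\<in>S. sg (y ! j)))"
proof -
  have finA: "finite A" using A finite_cube finite_subset by blast
  have pw: "(\<Sum>S\<in>Pow {..<k}. (\<Prod>j\<in>S. sg (z ! j)) * (\<Prod>j\<in>S. sg (y ! j))) = (if z = y then 2 ^ k else 0)"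
    if "z \<in> A" for z
  proof -
    have len: "length z = k" "length y = k" using that A y by (auto simp: cube_def)
    have "(\<Sum>S\<in>Pow {..<k}. (\<Prod>j\<in>S. sg (z ! j)) * (\<Prod>j\<in>S. sg (y ! j)))
        = (\<Sum>S\<in>Pow {..<k}. (\<Prod>j\<in>S. sg (z ! j) * sg (y ! j)) * (\<Prod>j\<in>{..<k} - S. 1))"
      by (simp add: prod.distrib)
    also have "\<dots> = (\<Prod>j<k. sg (z ! j) * sg (y ! j) + 1)"
      by (rule prod_add[symmetric]) simp
    also have "\<dots> = (if z = y then 2 ^ k else 0)"
    proof (cases "z = y")
      case True
      then show ?thesis by (simp add: sg_simps)
    next
      case False
      then obtain j where "j < k" "z ! j \<noteq> y ! j" using len by (auto simp: list_eq_iff_nth_eq)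
      then have "sg (z ! j) * sg (y ! j) + 1 = 0" by (auto simp: sg_def)
      then show ?thesis using \<open>j < k\<close> False by (auto intro!: prod_zero)
    qed
    finally show ?thesis .
  qed
  have "(\<Sum>S\<in>Pow {..<k}. coef A S * (\<Prod>j\<in>S. sg (y ! j)))
      = (\<Sum>S\<in>Pow {..<k}. \<Sum>z\<in>A. (\<Prod>j\<in>S. sg (z ! j)) * (\<Prod>j\<in>S. sg (y ! j)) / card A)"
    by (simp add: coef_def sum_distrib_right sum_divide_distrib)
  also have "\<dots> = (\<Sum>z\<in>A. \<Sum>S\<in>Pow {..<k}. (\<Prod>j\<in>S. sg (z ! j)) * (\<Prod>j\<in>S. sg (y ! j)) / card A)"
    by (rule sum.swap)
  also have "\<dots> = (\<Sum>z\<in>A. (if z = y then 2 ^ k else 0) / card A)"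
    using pw by (intro sum.cong refl) (simp add: sum_divide_distrib[symmetric])
  also have "\<dots> = dens k A y"
    using finA by (simp add: dens_def sum_divide_distrib[symmetric] sum.delta)
  finally show ?thesis by simp
qed

text \<open>Negating the assignment at \<open>v\<close> changes the sign of the whole product: by
  injectivity an edge has \<open>v\<close> in at most one position, and an odd number of the sets
  \<open>F e\<close> contain it.\<close>

lemma sum_prod_sg_even_family:
  fixes vt :: "'e \<Rightarrow> nat \<Rightarrow> nat"
  assumes finE: "finite E" and inj: "\<And>e. e \<in> E \<Longrightarrow> inj_on (vt e) {..<k}"
    and U: "finite U" "\<And>e j. e \<in> E \<Longrightarrow> j < k \<Longrightarrow> vt e j \<in> U"
    and F: "\<And>e. e \<in> E \<Longrightarrow> F e \<subseteq> {..<k}" and v: "odd (card {e\<in>E. v \<in> vt e ` F e})"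
  shows "(\<Sum>a\<in>PiE U (\<lambda>_. UNIV :: bool set). \<Prod>e\<in>E. \<Prod>j\<in>F e. sg (a (vt e j))) = 0"
proof -
  let ?f = "\<lambda>a. \<Prod>e\<in>E. \<Prod>j\<in>F e. sg (a (vt e j))"
  let ?A = "PiE U (\<lambda>_. UNIV :: bool set)"
  let ?h = "\<lambda>a. a(v := \<not> a v)"
  have finF: "finite (F e)" if "e \<in> E" for e using F[OF that] finite_subset by blast
  have "{e\<in>E. v \<in> vt e ` F e} \<noteq> {}" using v by (metis card.empty even_zero)
  then obtain e j where "e \<in> E" "j \<in> F e" "v = vt e j" by auto
  then have vU: "v \<in> U" using U F by auto
  have "?f (?h a) = - ?f a" for a
  proof -
    have one: "(\<Prod>j\<in>F e. sg (?h a (vt e j))) = (if v \<in> vt e ` F e then -1 else 1) * (\<Prod>j\<in>F e. sg (a (vt e j)))"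
      if e: "e \<in> E" for e
    proof (cases "v \<in> vt e ` F e")
      case True
      then obtain i where i: "i \<in> F e" "v = vt e i" by auto
      have ne: "vt e j \<noteq> v" if "j \<in> F e - {i}" for j
        using that i F[OF e] inj[OF e] by (auto simp: inj_on_def subset_iff)
      have "(\<Prod>j\<in>F e. sg (?h a (vt e j))) = sg (?h a (vt e i)) * (\<Prod>j\<in>F e - {i}. sg (?h a (vt e j)))"
        using finF[OF e] i by (intro prod.remove) auto
      also have "(\<Prod>j\<in>F e - {i}. sg (?h a (vt e j))) = (\<Prod>j\<in>F e - {i}. sg (a (vt e j)))"
        using ne by (intro prod.cong) auto
      also have "sg (?h a (vt e i)) = - sg (a (vt e i))" using i by (simp add: sg_simps)
      finally show ?thesis using prod.remove[OF finF[OF e] i(1), of "\<lambda>j. sg (a (vt e j))"] True by simp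
    next
      case False
      then show ?thesis by (simp, intro prod.cong) auto
    qed
    have "?f (?h a) = (\<Prod>e\<in>E. (if v \<in> vt e ` F e then -1 else 1) * (\<Prod>j\<in>F e. sg (a (vt e j))))"
      by (rule prod.cong[OF refl one])
    also have "\<dots> = (\<Prod>e\<in>E. if v \<in> vt e ` F e then -1 else 1) * ?f a" by (rule prod.distrib)
    also have "(\<Prod>e\<in>E. if v \<in> vt e ` F e then -1 else (1::real)) = -1"
      using finE v by (simp add: prod.If_cases Int_def)
    finally show ?thesis by simp
  qed
  then have "(\<Sum>a\<in>?A. ?f a) = (\<Sum>a\<in>?A. - ?f (?h a))" by simp
  also have "\<dots> = (\<Sum>a\<in>?A. - ?f a)"
    by (rule sum.reindex_bij_witness[of _ ?h ?h]) (use vU in \<open>auto simp: PiE_iff extensional_def\<close>)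
  finally show ?thesis by (simp add: sum_negf)
qed

text \<open>Likelihood ratio, planted against uniform, of the literals \<open>b\<close> on the edges in \<open>E\<close>.\<close>

definition lr :: "nat \<Rightarrow> bool list set \<Rightarrow> nat set \<Rightarrow> ('e \<Rightarrow> nat \<Rightarrow> nat) \<Rightarrow> 'e set \<Rightarrow> ('e \<Rightarrow> bool list) \<Rightarrow> real" where
  "lr k A U vt E b = (\<Sum>a\<in>PiE U (\<lambda>_. UNIV). \<Prod>e\<in>E. dens k A (mask k (vt e) a (b e))) / 2 ^ card U"

text \<open>Expand every density into characters. Averaging over \<open>a\<close>, together with
  \<open>coef_odd\<close>, leaves only even families. The empty one contributes one; any other is
  damped by \<open>\<rho>\<close> for each ordinary pair, hence by \<open>\<rho> ^ (l - k)\<close>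
  for each excess edge in use. \<open>sum_even_families\<close> adds up these bounds including the
  empty family, hence the constant 2. The estimate holds for every \<open>b\<close>, so an adaptive
  choice of \<open>E\<close> does no harm.\<close>

lemma lr_near_one:
  fixes vt :: "'e \<Rightarrow> nat \<Rightarrow> nat"
  assumes k: "3 \<le> k" and A: "A \<subseteq> cube k" "A \<noteq> {}" "\<And>y. y \<in> A \<Longrightarrow> map Not y \<in> A"
    and rho: "0 \<le> \<rho>" "\<rho> \<le> 1" "\<And>S. S \<subseteq> {..<k} \<Longrightarrow> S \<noteq> {} \<Longrightarrow> S \<noteq> {..<k} \<Longrightarrow> \<bar>coef A S\<bar> \<le> \<rho>"
    and inj: "\<And>e. e \<in> E \<Longrightarrow> inj_on (vt e) {..<k}"
    and U: "finite U" "\<And>e j. e \<in> E \<Longrightarrow> j < k \<Longrightarrow> vt e j \<in> U"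
    and g: "good l (\<lambda>e. vt e ` {..<k}) E X" and lk: "k \<le> l"
  shows "lr k A U vt E b \<ge> 2 - (1 + 2 ^ k * \<rho> ^ (l - k)) ^ card X"
proof -
  let ?P = "PiE E (\<lambda>_. Pow {..<k})"
  let ?A = "PiE U (\<lambda>_. UNIV :: bool set)"
  let ?E = "\<lambda>F. even_family E (\<lambda>e. vt e ` F e)"
  let ?EF = "{F \<in> ?P. ?E F}"
  define x where "x = \<rho> ^ (l - k)"
  define c where "c F = (\<Prod>e\<in>E. coef A (F e) * (\<Prod>j\<in>F e. sg (b e ! j)))" for F
  define m where "m F = (\<Sum>a\<in>?A. \<Prod>e\<in>E. \<Prod>j\<in>F e. sg (a (vt e j))) / 2 ^ card U" for F
  have finE: "finite E" and XE: "X \<subseteq> E" using good_finite[OF g] by auto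
  have finX: "finite X" using finite_subset[OF XE finE] .
  have finA: "finite A" using A finite_cube finite_subset by blast
  have finP: "finite ?P" using finE by (intro finite_PiE) auto
  have cardA: "card ?A = 2 ^ card U" using U by (simp add: card_PiE)
  have "lr k A U vt E b = (\<Sum>a\<in>?A. \<Prod>e\<in>E. \<Sum>S\<in>Pow {..<k}.
      coef A S * (\<Prod>j\<in>S. sg (b e ! j)) * (\<Prod>j\<in>S. sg (a (vt e j)))) / 2 ^ card U"
    unfolding lr_def
  proof (intro arg_cong[of _ _ "\<lambda>t. t / _"] sum.cong prod.cong refl)
    fix a e
    have "dens k A (mask k (vt e) a (b e)) = (\<Sum>S\<in>Pow {..<k}. coef A S * (\<Prod>j\<in>S. sg (mask k (vt e) a (b e) ! j)))"
      by (rule dens_expand[OF A(1) mask_cube])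
    also have "\<dots> = (\<Sum>S\<in>Pow {..<k}. coef A S * (\<Prod>j\<in>S. sg (b e ! j)) * (\<Prod>j\<in>S. sg (a (vt e j))))"
    proof (intro sum.cong refl)
      fix S assume "S \<in> Pow {..<k}"
      then have "(\<Prod>j\<in>S. sg (mask k (vt e) a (b e) ! j)) = (\<Prod>j\<in>S. sg (b e ! j) * sg (a (vt e j)))"
        by (intro prod.cong refl) (auto simp: mask_def subset_iff sg_def)
      then show "coef A S * (\<Prod>j\<in>S. sg (mask k (vt e) a (b e) ! j))
          = coef A S * (\<Prod>j\<in>S. sg (b e ! j)) * (\<Prod>j\<in>S. sg (a (vt e j)))"
        by (simp add: prod.distrib)
    qed
    finally show "dens k A (mask k (vt e) a (b e)) = \<dots>" .
  qed
  also have "\<dots> = (\<Sum>a\<in>?A. \<Sum>F\<in>?P. c F * (\<Prod>e\<in>E. \<Prod>j\<in>F e. sg (a (vt e j)))) / 2 ^ card U"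
    using finE by (simp add: prod_sum_PiE prod.distrib c_def)
  also have "\<dots> = (\<Sum>F\<in>?P. \<Sum>a\<in>?A. c F * (\<Prod>e\<in>E. \<Prod>j\<in>F e. sg (a (vt e j)))) / 2 ^ card U"
    by (subst sum.swap) (rule refl)
  also have "\<dots> = (\<Sum>F\<in>?P. c F * m F)"
    by (simp add: m_def sum_distrib_left sum_divide_distrib)
  finally have lr: "lr k A U vt E b = (\<Sum>F\<in>?P. c F * m F)" .
  have m_le: "\<bar>m F\<bar> \<le> 1" for F
  proof -
    have "\<bar>\<Sum>a\<in>?A. \<Prod>e\<in>E. \<Prod>j\<in>F e. sg (a (vt e j))\<bar> \<le> (\<Sum>a\<in>?A. \<bar>\<Prod>e\<in>E. \<Prod>j\<in>F e. sg (a (vt e j))\<bar>)"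
      by (rule sum_abs)
    also have "\<dots> = 2 ^ card U" using cardA by (simp add: abs_prod sg_simps)
    finally show ?thesis by (simp add: m_def)
  qed
  have zero: "c F * m F = 0" if F: "F \<in> ?P" and ne: "\<not> ?E F" for F
  proof -
    have sub: "F e \<subseteq> {..<k}" if "e \<in> E" for e using F that by auto
    have cd: "card (vt e ` F e) = card (F e)" if "e \<in> E" for e
      using inj_on_subset[OF inj[OF that] sub[OF that]] by (rule card_image)
    show ?thesis
    proof (cases "\<forall>e\<in>E. even (card (vt e ` F e))")
      case True
      then obtain v where "odd (card {e\<in>E. v \<in> vt e ` F e})" using ne by (auto simp: even_family_def)
      then have "(\<Sum>a\<in>?A. \<Prod>e\<in>E. \<Prod>j\<in>F e. sg (a (vt e j))) = 0"
        by (intro sum_prod_sg_even_family[where k = k]) (use finE inj U sub in auto)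
      then show ?thesis by (simp add: m_def)
    next
      case False
      then obtain e where e: "e \<in> E" "odd (card (F e))" using cd by auto
      then have "coef A (F e) = 0" using coef_odd[OF A(1) A(3) sub] by auto
      then have "c F = 0" unfolding c_def using e finE by (intro prod_zero) auto
      then show ?thesis by simp
    qed
  qed
  have bound: "\<bar>c F\<bar> \<le> x ^ card {e\<in>X. F e \<noteq> {}}" if F: "F \<in> ?EF" for F
  proof -
    have sub: "F e \<subseteq> {..<k}" if "e \<in> E" for e using F that by auto
    have cd: "card (vt e ` F e) = card (F e)" if "e \<in> E" for e
      using inj_on_subset[OF inj[OF that] sub[OF that]] by (rule card_image)
    define T where "T = {f\<in>E - X. card (F f) = 2}"
    have "l * card {e\<in>X. vt e ` F e \<noteq> {}} \<le> card {f\<in>E - X. card (vt f ` F f) = 2} + k * card {e\<in>X. vt e ` F e \<noteq> {}}"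
      using F sub card_image_le[of "{..<k}"] by (intro even_family_pairs[OF _ _ g]) auto
    also have "{f\<in>E - X. card (vt f ` F f) = 2} = T" using cd by (auto simp: T_def)
    finally have "(l - k) * card {e\<in>X. F e \<noteq> {}} \<le> card T" by (simp add: diff_mult_distrib)
    then have "\<rho> ^ card T \<le> x ^ card {e\<in>X. F e \<noteq> {}}"
      unfolding x_def power_mult[symmetric] using rho by (intro power_decreasing) auto
    moreover have "\<bar>c F\<bar> \<le> \<rho> ^ card T"
    proof -
      have "\<bar>c F\<bar> = (\<Prod>e\<in>E. \<bar>coef A (F e)\<bar>)"
        by (simp add: c_def abs_prod abs_mult sg_simps)
      also have "\<dots> \<le> (\<Prod>e\<in>E. if e \<in> T then \<rho> else 1)"
      proof (intro prod_mono conjI)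
        fix e assume e: "e \<in> E"
        show "\<bar>coef A (F e)\<bar> \<le> (if e \<in> T then \<rho> else 1)"
        \<comment> \<open>A pair is not the full set because \<open>3 \<le> k\<close>; this matters,
          as the coefficient of the full set may have absolute value one.\<close>
        proof (cases "e \<in> T")
          case True
          then have c2: "card (F e) = 2" by (simp add: T_def)
          have ne: "F e \<noteq> {}"
          proof
            assume "F e = {}"
            from c2[unfolded this] show False by simp
          qed
          moreover have "F e \<noteq> {..<k}"
          proof
            assume "F e = {..<k}"
            from c2[unfolded this] show False using k by simp
          qed
          ultimately have "F e \<noteq> {}" "F e \<noteq> {..<k}" by blast+
          then show ?thesis using rho(3)[OF sub[OF e]] True by simp
        qed (use abs_coef_le in auto)
      qed auto
      also have "\<dots> = \<rho> ^ card T"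
      proof -
        have "E \<inter> {e. e \<in> T} = T" by (auto simp: T_def)
        then show ?thesis using finE by (simp add: prod.If_cases)
      qed
      finally show ?thesis .
    qed
    ultimately show ?thesis by linarith
  qed
  define F0 where "F0 = (\<lambda>e\<in>E. {} :: nat set)"
  have F0: "F0 \<in> ?EF" by (auto simp: F0_def even_family_def cong: conj_cong)
  have cm0: "c F0 * m F0 = 1"
  proof -
    have "c F0 = 1" using coef_empty[OF finA A(2)] by (simp add: c_def F0_def)
    moreover have "m F0 = 1" using cardA by (simp add: m_def F0_def)
    ultimately show ?thesis by simp
  qed
  have X0: "{e\<in>X. F0 e \<noteq> {}} = {}" using XE by (auto simp: F0_def)
  have x0: "0 \<le> x" using rho by (simp add: x_def)
  have "(\<Sum>F\<in>?P. c F * m F) = (\<Sum>F\<in>?EF. c F * m F)"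
    using finP zero by (intro sum.mono_neutral_right) auto
  also have "\<dots> = 1 + (\<Sum>F\<in>?EF - {F0}. c F * m F)"
    using sum.remove[of ?EF F0 "\<lambda>F. c F * m F"] F0 finP cm0 by simp
  also have "\<dots> \<ge> 1 + (\<Sum>F\<in>?EF - {F0}. - (x ^ card {e\<in>X. F e \<noteq> {}}))"
  proof (intro add_left_mono sum_mono)
    fix F assume "F \<in> ?EF - {F0}"
    then have "\<bar>c F * m F\<bar> \<le> x ^ card {e\<in>X. F e \<noteq> {}} * 1"
      unfolding abs_mult using bound m_le x0 by (intro mult_mono) auto
    then show "- (x ^ card {e\<in>X. F e \<noteq> {}}) \<le> c F * m F" by linarith
  qed
  also have "1 + (\<Sum>F\<in>?EF - {F0}. - (x ^ card {e\<in>X. F e \<noteq> {}})) = 2 - (\<Sum>F\<in>?EF. x ^ card {e\<in>X. F e \<noteq> {}})"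
    using sum.remove[of ?EF F0 "\<lambda>F. x ^ card {e\<in>X. F e \<noteq> {}}"] F0 finP X0 by (simp add: sum_negf)
  finally show ?thesis using sum_even_families[OF inj g x0] lr unfolding x_def by linarith
qed

text \<open>A character taking both signs on \<open>A\<close> has a mean strictly between -1 and 1,
  and there are only finitely many \<open>S\<close>.\<close>

lemma coef_bound_exists:
  assumes A: "A \<subseteq> cube k" "A \<noteq> {}"
    and mix: "\<And>S. S \<subseteq> {..<k} \<Longrightarrow> S \<noteq> {} \<Longrightarrow> S \<noteq> {..<k} \<Longrightarrow>
      \<exists>y\<in>A. \<exists>z\<in>A. (\<Prod>j\<in>S. sg (y ! j)) \<noteq> (\<Prod>j\<in>S. sg (z ! j))"
  shows "\<exists>\<rho>. 0 < \<rho> \<and> \<rho> < 1 \<and> (\<forall>S\<subseteq>{..<k}. S \<noteq> {} \<longrightarrow> S \<noteq> {..<k} \<longrightarrow> \<bar>coef A S\<bar> \<le> \<rho>)"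
proof -
  have finA: "finite A" using A finite_cube finite_subset by blast
  have less: "\<bar>coef A S\<bar> < 1" if S: "S \<subseteq> {..<k}" "S \<noteq> {}" "S \<noteq> {..<k}" for S
  proof -
    let ?s = "\<lambda>y. \<Prod>j\<in>S. sg (y ! j)"
    obtain y z where yz: "y \<in> A" "z \<in> A" "?s y \<noteq> ?s z" using mix[OF S] by blast
    have pm: "?s y = 1 \<or> ?s y = -1" for y using abs_prod_sg[of "\<lambda>j. y ! j" S] by linarith
    have "(\<Sum>y\<in>A. ?s y) < (\<Sum>y\<in>A. 1)"
    proof (rule sum_strict_mono_ex1[OF finA])
      show "\<forall>y\<in>A. ?s y \<le> 1" using pm by (metis dual_order.refl neg_le_iff_le le_minus_one_simps(1) order_trans zero_le_one)
      show "\<exists>y\<in>A. ?s y < 1" using pm[of y] pm[of z] yz by (metis less_minus_one_simps(3) minus_less_iff neg_less_iff_less zero_less_one less_trans neg_less_0_iff_less)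
    qed
    moreover have "(\<Sum>y\<in>A. -1) < (\<Sum>y\<in>A. ?s y)"
    proof (rule sum_strict_mono_ex1[OF finA])
      show "\<forall>y\<in>A. -1 \<le> ?s y" using abs_prod_sg by (metis abs_le_iff minus_le_iff order_refl)
      show "\<exists>y\<in>A. -1 < ?s y" using pm[of y] pm[of z] yz by (metis less_minus_one_simps(1) less_minus_one_simps(3) minus_less_iff neg_less_iff_less zero_less_one less_trans neg_less_0_iff_less)
    qed
    ultimately have "\<bar>\<Sum>y\<in>A. ?s y\<bar> < card A" by (simp add: abs_less_iff)
    then show ?thesis using finA A by (simp add: coef_def abs_divide divide_less_eq)
  qed
  \<comment> \<open>The additional element 1/2 keeps the maximum positive, since the logarithm of
    \<open>\<rho>\<close> is taken later.\<close>
  define T where "T = insert (1/2) ((\<lambda>S. \<bar>coef A S\<bar>) ` {S. S \<subseteq> {..<k} \<and> S \<noteq> {} \<and> S \<noteq> {..<k}})"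
  have finT: "finite T" unfolding T_def by auto
  have "Max T < 1" using finT less by (subst Max_less_iff) (auto simp: T_def)
  moreover have "1/2 \<le> Max T" using finT by (intro Max_ge) (auto simp: T_def)
  moreover have "\<bar>coef A S\<bar> \<le> Max T" if "S \<subseteq> {..<k}" "S \<noteq> {}" "S \<noteq> {..<k}" for S
    using finT that by (intro Max_ge) (auto simp: T_def)
  ultimately show ?thesis by (intro exI[of _ "Max T"]) auto
qed

section \<open>Random and planted instances\<close>

type_synonym edge = "nat \<times> nat"
type_synonym hyper = "nat \<times> nat \<Rightarrow> nat \<Rightarrow> nat"

text \<open>An edge is the pair of its layer and its index there; \<open>H (i, j)\<close> sends the
  index of an edge of layer \<open>i\<close> to its position in block \<open>j\<close>. All blocks,
  the first one included, get a permutation, which keeps them on an equal footing.\<close>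

definition hypers :: "nat \<Rightarrow> nat \<Rightarrow> nat \<Rightarrow> hyper set" where
  "hypers k d N = PiE ({..<d} \<times> {..<k}) (\<lambda>_. {p. p permutes {..<N}})"

definition lits :: "nat \<Rightarrow> nat \<Rightarrow> nat \<Rightarrow> (edge \<Rightarrow> bool list) set" where
  "lits k d N = PiE ({..<d} \<times> {..<N}) (\<lambda>_. cube k)"

definition vtx :: "nat \<Rightarrow> hyper \<Rightarrow> edge \<Rightarrow> nat \<Rightarrow> nat" where
  "vtx N H e j = j * N + H (fst e, j) (snd e)"

definition con :: "nat \<Rightarrow> nat \<Rightarrow> hyper \<Rightarrow> (edge \<Rightarrow> bool list) \<Rightarrow> edge \<Rightarrow> constraint" where
  "con k N H b e = map (\<lambda>j. (vtx N H e j, b e ! j)) [0..<k]"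

definition edge_at :: "nat \<Rightarrow> hyper \<Rightarrow> nat \<Rightarrow> nat \<Rightarrow> edge" where
  "edge_at N H x i = (i, inv (H (i, x div N)) (x mod N))"

text \<open>The edge \<open>(i, t)\<close> is stored at position \<open>i * N + t\<close>. Each of
  the first \<open>k * N\<close> variables lies on exactly one edge per layer and lists them by
  layer; the remaining ones, fewer than \<open>k\<close> when \<open>N = n div k\<close>, occur in
  no constraint.\<close>

definition inst :: "nat \<Rightarrow> nat \<Rightarrow> nat \<Rightarrow> hyper \<Rightarrow> (edge \<Rightarrow> bool list) \<Rightarrow> csp_instance" where
  "inst k d N H b =
    \<lparr>constraints = map (\<lambda>p. con k N H b (p div N, p mod N)) [0..<d * N],
     incidence = (\<lambda>x. if x < k * N then map (\<lambda>i. i * N + snd (edge_at N H x i)) [0..<d] else [])\<rparr>"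

lemma hypers_permutes: "H \<in> hypers k d N \<Longrightarrow> i < d \<Longrightarrow> j < k \<Longrightarrow> H (i, j) permutes {..<N}"
  by (auto simp: hypers_def)

lemma vtx_bounds:
  assumes "H \<in> hypers k d N" "e \<in> {..<d} \<times> {..<N}" "j < k"
  shows "vtx N H e j div N = j" "vtx N H e j mod N = H (fst e, j) (snd e)" "vtx N H e j < k * N"
    "H (fst e, j) (snd e) < N"
proof -
  have p: "H (fst e, j) permutes {..<N}" using assms by (auto intro: hypers_permutes)
  then show lt: "H (fst e, j) (snd e) < N" using permutes_in_image[OF p, of "snd e"] assms by auto
  then show "vtx N H e j div N = j" "vtx N H e j mod N = H (fst e, j) (snd e)"
    by (auto simp: vtx_def)
  have "j * N + H (fst e, j) (snd e) < j * N + N" using lt by simp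
  also have "\<dots> \<le> k * N" using assms(3) by (metis Suc_leI add.commute mult_Suc mult_le_mono1)
  finally show "vtx N H e j < k * N" by (simp add: vtx_def)
qed

lemma inj_on_vtx: "H \<in> hypers k d N \<Longrightarrow> e \<in> {..<d} \<times> {..<N} \<Longrightarrow> inj_on (vtx N H e) {..<k}"
  by (intro inj_onI) (metis vtx_bounds(1) lessThan_iff)

lemma edge_at_mem:
  assumes "H \<in> hypers k d N" "x < k * N" "i < d"
  shows "edge_at N H x i \<in> {..<d} \<times> {..<N}" "x div N < k" "x mod N < N"
    "H (i, x div N) (snd (edge_at N H x i)) = x mod N"
proof -
  have N: "0 < N" using assms(2) by (metis mult_0_right not_gr0 not_less0)
  show j: "x div N < k" using assms(2) by (simp add: less_mult_imp_div_less)
  show "x mod N < N" using N by simp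
  have p: "H (i, x div N) permutes {..<N}" using hypers_permutes assms j by auto
  show "H (i, x div N) (snd (edge_at N H x i)) = x mod N"
    using permutes_inverses(1)[OF p] by (simp add: edge_at_def)
  then have "snd (edge_at N H x i) < N"
    using permutes_in_image[OF p, of "snd (edge_at N H x i)"] N by simp
  then show "edge_at N H x i \<in> {..<d} \<times> {..<N}" using assms(3) by (simp add: edge_at_def)
qed

lemma vtx_edge_at:
  assumes "H \<in> hypers k d N" "x < k * N" "i < d"
  shows "vtx N H (edge_at N H x i) (x div N) = x"
  using edge_at_mem(4)[OF assms] by (simp add: vtx_def edge_at_def)

lemma edge_at_unique:
  assumes H: "H \<in> hypers k d N" and e: "e \<in> {..<d} \<times> {..<N}" and j: "j < k" and x: "vtx N H e j = x"
  shows "e = edge_at N H x (fst e)"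
proof -
  have p: "H (fst e, j) permutes {..<N}" using H e j by (auto intro: hypers_permutes)
  have "x div N = j" "x mod N = H (fst e, j) (snd e)" using vtx_bounds[OF H e j] x by auto
  then show ?thesis using permutes_inverses(2)[OF p] by (simp add: edge_at_def prod_eq_iff)
qed

lemma mem_vars_con:
  assumes H: "H \<in> hypers k d N" and e: "e \<in> {..<d} \<times> {..<N}"
  shows "x \<in> vars (con k N H b e) \<longleftrightarrow> x < k * N \<and> e = edge_at N H x (fst e)"
proof
  assume "x \<in> vars (con k N H b e)"
  then obtain j where j: "j < k" "x = vtx N H e j" by (auto simp: vars_def con_def)
  then show "x < k * N \<and> e = edge_at N H x (fst e)"
    using vtx_bounds[OF H e j(1)] edge_at_unique[OF H e j(1)] by simp
next
  assume x: "x < k * N \<and> e = edge_at N H x (fst e)"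
  have i: "fst e < d" using e by auto
  have "vtx N H e (x div N) = x" using vtx_edge_at[OF H _ i, of x] x by metis
  moreover have "x div N < k" using edge_at_mem(2)[OF H _ i] x by metis
  ultimately show "x \<in> vars (con k N H b e)" by (force simp: vars_def con_def)
qed

lemma pos_less: "i < d \<Longrightarrow> t < N \<Longrightarrow> i * N + t < d * (N::nat)"
proof -
  assume "i < d" "t < N"
  then have "i * N + t < Suc i * N" by simp
  also have "\<dots> \<le> d * N" using \<open>i < d\<close> by (intro mult_le_mono1) simp
  finally show ?thesis .
qed

lemma pos_edge: "p < d * N \<Longrightarrow> (p div N, p mod N) \<in> {..<d} \<times> {..<(N::nat)}"
  by (cases "N = 0") (auto simp: less_mult_imp_div_less)

lemma inst_in_csp_instances:
  assumes H: "H \<in> hypers k d N" and n: "k * N \<le> n"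
  shows "inst k d N H b \<in> csp_instances k d n"
  unfolding csp_instances_def
proof (intro CollectI conjI ballI allI impI)
  fix c assume "c \<in> set (constraints (inst k d N H b))"
  then obtain p where p: "p < d * N" "c = con k N H b (p div N, p mod N)" by (auto simp: inst_def)
  show "length c = k" using p by (simp add: con_def)
  show "vars c \<subseteq> {..<n}" using p n mem_vars_con[OF H pos_edge[OF p(1)]] by fastforce
next
  fix x
  show "distinct (incidence (inst k d N H b) x)"
  proof (cases "x < k * N")
    case True
    have "i = i'" if "i < d" "i' < d"
      "i * N + snd (edge_at N H x i) = i' * N + snd (edge_at N H x i')" for i i'
    proof -
      have "(i * N + snd (edge_at N H x i)) div N = i" "(i' * N + snd (edge_at N H x i')) div N = i'"
        using edge_at_mem(1)[OF H True that(1)] edge_at_mem(1)[OF H True that(2)] by (auto simp: mem_Times_iff)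
      then show ?thesis using that(3) by metis
    qed
    then show ?thesis using True by (auto simp: inst_def distinct_map inj_on_def)
  qed (simp add: inst_def)
  show "length (incidence (inst k d N H b) x) \<le> d" by (simp add: inst_def)
  show "set (incidence (inst k d N H b) x) =
    {j. j < length (constraints (inst k d N H b)) \<and> x \<in> vars (constraints (inst k d N H b) ! j)}" (is "?L = ?R")
  proof (cases "x < k * N")
    case True
    show ?thesis
    proof
      show "?L \<subseteq> ?R"
      proof
        fix p assume "p \<in> ?L"
        then obtain i where i: "i < d" "p = i * N + snd (edge_at N H x i)" using True by (auto simp: inst_def)
        let ?e = "edge_at N H x i"
        have e: "?e \<in> {..<d} \<times> {..<N}" by (rule edge_at_mem(1)[OF H True i(1)])
        then have t: "snd ?e < N" by auto
        have fi: "fst ?e = i" by (simp add: edge_at_def)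
        have pe: "(p div N, p mod N) = ?e" using i(2) t fi by (simp add: prod_eq_iff)
        have pl: "p < d * N" using pos_less[OF i(1) t] i(2) by simp
        have "x \<in> vars (con k N H b ?e)" using mem_vars_con[OF H e] True fi by simp
        then show "p \<in> ?R" using pl pe by (simp add: inst_def)
      qed
      show "?R \<subseteq> ?L"
      proof
        fix p assume "p \<in> ?R"
        then have p: "p < d * N" "x \<in> vars (con k N H b (p div N, p mod N))" by (auto simp: inst_def)
        then have e: "(p div N, p mod N) = edge_at N H x (p div N)"
          using mem_vars_con[OF H pos_edge[OF p(1)]] by simp
        have "p = p div N * N + p mod N" by simp
        also have "p mod N = snd (edge_at N H x (p div N))" using e by (metis snd_conv)
        finally show "p \<in> ?L" using True pos_edge[OF p(1)] by (auto simp: inst_def)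
      qed
    qed
  next
    case False
    then show ?thesis using mem_vars_con[OF H pos_edge] by (auto simp: inst_def)
  qed
qed

section \<open>The oracle of a random instance and the edges that a decision tree reveals\<close>

definition orc :: "nat \<Rightarrow> nat \<Rightarrow> nat \<Rightarrow> hyper \<Rightarrow> (edge \<Rightarrow> bool list) \<Rightarrow> nat \<Rightarrow> nat \<Rightarrow> constraint option" where
  "orc k d N H b x i =
    (if x < k * N \<and> 1 \<le> i \<and> i \<le> d then Some (con k N H b (edge_at N H x (i - 1))) else None)"

lemma csp_oracle_inst:
  assumes H: "H \<in> hypers k d N" and n: "k * N \<le> n"
  shows "csp_oracle n (inst k d N H b) = orc k d N H b"
proof (intro ext)
  fix x i
  show "csp_oracle n (inst k d N H b) x i = orc k d N H b x i"
  proof (cases "x < k * N \<and> 1 \<le> i \<and> i \<le> d")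
    case True
    then have x: "x < k * N" and i: "i - 1 < d" by auto
    let ?e = "edge_at N H x (i - 1)"
    have e: "?e \<in> {..<d} \<times> {..<N}" by (rule edge_at_mem(1)[OF H x i])
    then have t: "snd ?e < N" by auto
    have fi: "fst ?e = i - 1" by (simp add: edge_at_def)
    have "((i - 1) * N + snd ?e) div N = i - 1" "((i - 1) * N + snd ?e) mod N = snd ?e"
      using t by simp_all
    then have pe: "(((i - 1) * N + snd ?e) div N, ((i - 1) * N + snd ?e) mod N) = ?e"
      using fi by (simp add: prod_eq_iff)
    show ?thesis using True n i pos_less[OF i t] pe
      by (simp add: csp_oracle_def orc_def inst_def)
  qed (auto simp: csp_oracle_def orc_def inst_def)
qed

primrec expl :: "nat \<Rightarrow> nat \<Rightarrow> nat \<Rightarrow> hyper \<Rightarrow> (edge \<Rightarrow> bool list) \<Rightarrow> dtree \<Rightarrow> edge set" where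
  "expl k d N H b (Output r) = {}"
| "expl k d N H b (Query x i f) =
    (if x < k * N \<and> 1 \<le> i \<and> i \<le> d then {edge_at N H x (i - 1)} else {}) \<union>
    expl k d N H b (f (orc k d N H b x i))"

lemma expl_subset: "H \<in> hypers k d N \<Longrightarrow> expl k d N H b T \<subseteq> {..<d} \<times> {..<N}"
proof (induction T)
  case (Query x i f)
  then show ?case using edge_at_mem(1)[OF Query.prems, of x "i - 1"]
    by (cases "x < k * N \<and> 1 \<le> i \<and> i \<le> d") auto
qed simp

text \<open>The run reads \<open>b\<close> only on the edges that it reveals. This is the stopping
  property required by \<open>sum_stopped_prod\<close>, and the point where adaptive queries are
  dealt with.\<close>

lemma expl_agree:
  "(\<And>e. e \<in> expl k d N H b T \<Longrightarrow> b' e = b e) \<Longrightarrow>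
    expl k d N H b' T = expl k d N H b T \<and> run (orc k d N H b') T = run (orc k d N H b) T"
proof (induction T)
  case (Query x i f)
  have "orc k d N H b' x i = orc k d N H b x i"
    using Query.prems[of "edge_at N H x (i - 1)"] by (auto simp: orc_def con_def)
  then show ?case using Query by auto
qed simp

text \<open>
  Exchanging the parts of \<open>b\<close> and of an independent copy outside \<open>D b\<close> is an involution, because
  \<open>D b\<close> only depends on the values of \<open>b\<close> on \<open>D b\<close>.
\<close>

lemma sum_stopped_prod:
  fixes D :: "('e \<Rightarrow> 'y) \<Rightarrow> 'e set" and g :: "'e \<Rightarrow> 'y \<Rightarrow> real" and acc :: "('e \<Rightarrow> 'y) \<Rightarrow> real"
  assumes fin: "finite A" "finite B"
    and D: "\<And>b. b \<in> PiE A (\<lambda>_. B) \<Longrightarrow> D b \<subseteq> A"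
    and stop: "\<And>b b'. b \<in> PiE A (\<lambda>_. B) \<Longrightarrow> b' \<in> PiE A (\<lambda>_. B) \<Longrightarrow>
      (\<And>e. e \<in> D b \<Longrightarrow> b' e = b e) \<Longrightarrow> D b' = D b \<and> acc b' = acc b"
    and g: "\<And>e. e \<in> A \<Longrightarrow> (\<Sum>y\<in>B. g e y) = card B" and B: "B \<noteq> {}"
  shows "(\<Sum>b\<in>PiE A (\<lambda>_. B). acc b * (\<Prod>e\<in>A. g e (b e)))
    = (\<Sum>b\<in>PiE A (\<lambda>_. B). acc b * (\<Prod>e\<in>D b. g e (b e)))"
proof -
  let ?O = "PiE A (\<lambda>_. B)"
  have finO: "finite ?O" using fin by (intro finite_PiE) auto
  have cardO: "card ?O = card B ^ card A" using fin by (simp add: card_PiE)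
  have pos: "real (card ?O) \<noteq> 0" using B fin cardO by simp
  define sw where "sw = (\<lambda>(b, c). ((\<lambda>e. if e \<in> D b then b e else c e), (\<lambda>e. if e \<in> D b then (c e :: 'y) else b e)))"
  have fst_sw: "(\<lambda>e. if e \<in> D b then b e else c e) \<in> ?O" if "b \<in> ?O" "c \<in> ?O" for b c
    using that by (auto simp: PiE_iff extensional_def)
  have snd_sw: "(\<lambda>e. if e \<in> D b then c e else b e) \<in> ?O" if "b \<in> ?O" "c \<in> ?O" for b c
    using that by (auto simp: PiE_iff extensional_def)
  have st: "D (\<lambda>e. if e \<in> D b then b e else c e) = D b" "acc (\<lambda>e. if e \<in> D b then b e else c e) = acc b"
    if "b \<in> ?O" "c \<in> ?O" for b c
    using stop[OF that(1) fst_sw[OF that]] by auto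
  have swsw: "sw (sw bc) = bc" "sw bc \<in> ?O \<times> ?O" if bc: "bc \<in> ?O \<times> ?O" for bc
  proof -
    obtain b c where bc': "bc = (b, c)" "b \<in> ?O" "c \<in> ?O" using bc by auto
    show "sw (sw bc) = bc" using st(1)[OF bc'(2,3)] bc'(1) by (auto simp: sw_def)
    show "sw bc \<in> ?O \<times> ?O" using fst_sw[OF bc'(2,3)] snd_sw[OF bc'(2,3)] bc'(1) by (auto simp: sw_def)
  qed
  \<comment> \<open>The factors outside \<open>D b\<close>, evaluated at the independent copy
    \<open>c\<close>, have mean one and can therefore be inserted at no cost.\<close>
  have inner: "(\<Sum>c\<in>?O. \<Prod>e\<in>A - D b. g e (c e)) = card ?O" if b: "b \<in> ?O" for b
  proof -
    have "(\<Sum>c\<in>?O. \<Prod>e\<in>A - D b. g e (c e)) = (\<Sum>c\<in>?O. \<Prod>e\<in>A. if e \<in> D b then 1 else g e (c e))"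
      using fin by (intro sum.cong refl prod.mono_neutral_cong_left) auto
    also have "\<dots> = (\<Prod>e\<in>A. \<Sum>y\<in>B. if e \<in> D b then 1 else g e y)"
      using fin by (intro prod_sum_PiE[symmetric]) auto
    also have "\<dots> = (\<Prod>e\<in>A. real (card B))"
    proof (rule prod.cong[OF refl])
      fix e assume "e \<in> A"
      then show "(\<Sum>y\<in>B. if e \<in> D b then 1 else g e y) = real (card B)"
        using g[of e] by (cases "e \<in> D b") simp_all
    qed
    finally show ?thesis using cardO by simp
  qed
  have "card ?O * (\<Sum>b\<in>?O. acc b * (\<Prod>e\<in>D b. g e (b e)))
      = (\<Sum>b\<in>?O. acc b * (\<Prod>e\<in>D b. g e (b e)) * (\<Sum>c\<in>?O. \<Prod>e\<in>A - D b. g e (c e)))"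
    by (simp add: inner sum_distrib_left mult.commute)
  also have "\<dots> = (\<Sum>(b, c)\<in>?O \<times> ?O. acc b * (\<Prod>e\<in>D b. g e (b e)) * (\<Prod>e\<in>A - D b. g e (c e)))"
    by (simp add: sum_distrib_left sum.cartesian_product)
  also have "\<dots> = (\<Sum>(b, c)\<in>?O \<times> ?O. acc b * (\<Prod>e\<in>A. g e (b e)))"
  proof (rule sum.reindex_bij_witness[of _ sw sw])
    fix bc assume bc: "bc \<in> ?O \<times> ?O"
    obtain b c where bc': "bc = (b, c)" "b \<in> ?O" "c \<in> ?O" using bc by auto
    have "(\<Prod>e\<in>A. g e (if e \<in> D b then b e else c e))
        = (\<Prod>e\<in>A - D b. g e (if e \<in> D b then b e else c e)) * (\<Prod>e\<in>D b. g e (if e \<in> D b then b e else c e))"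
      using D[OF bc'(2)] fin by (intro prod.subset_diff) auto
    also have "\<dots> = (\<Prod>e\<in>A - D b. g e (c e)) * (\<Prod>e\<in>D b. g e (b e))"
      by (intro arg_cong2[of _ _ _ _ "(*)"] prod.cong) auto
    finally show "(case sw bc of (b, c) \<Rightarrow> acc b * (\<Prod>e\<in>A. g e (b e)))
        = (case bc of (b, c) \<Rightarrow> acc b * (\<Prod>e\<in>D b. g e (b e)) * (\<Prod>e\<in>A - D b. g e (c e)))"
      using st(2)[OF bc'(2,3)] bc'(1) by (simp add: sw_def)
  qed (use swsw in auto)
  also have "\<dots> = card ?O * (\<Sum>b\<in>?O. acc b * (\<Prod>e\<in>A. g e (b e)))"
    by (simp add: sum.cartesian_product[symmetric] sum_distrib_left)
  finally show ?thesis using pos by simp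
qed

definition ok :: "nat \<Rightarrow> nat \<Rightarrow> nat \<Rightarrow> nat \<Rightarrow> hyper \<Rightarrow> edge set \<Rightarrow> bool" where
  "ok l r k N H E \<longleftrightarrow> (\<exists>X. good l (\<lambda>e. vtx N H e ` {..<k}) E X \<and> card X \<le> r)"

text \<open>For fixed \<open>w\<close> and \<open>a\<close>, \<open>mask\<close> is an involution of
  the cube, so it preserves the mean one of \<open>dens\<close>. This lets the factors of unexplored
  edges drop out of the planted weight.\<close>

lemma sum_dens_mask:
  assumes A: "A \<subseteq> cube k" "A \<noteq> {}"
  shows "(\<Sum>y\<in>cube k. dens k A (mask k w a y)) = card (cube k)"
proof -
  have finA: "finite A" using A finite_cube finite_subset by blast
  have "(\<Sum>y\<in>cube k. dens k A (mask k w a y)) = (\<Sum>y\<in>cube k. dens k A y)"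
    by (rule sum.reindex_bij_witness[of _ "mask k w a" "mask k w a"])
      (auto simp: mask_def cube_def intro!: nth_equalityI)
  also have "\<dots> = (\<Sum>y\<in>A. 2 ^ k / card A)"
    unfolding dens_def using A finite_cube by (simp add: sum.If_cases Int_absorb1)
  also have "\<dots> = 2 ^ k" using finA A by simp
  finally show ?thesis by (simp add: card_cube)
qed

text \<open>For each assignment the unexplored factors sum out; what remains, averaged over the
  assignments, is the likelihood ratio on the explored edges. It is at least \<open>1 - s\<close> if
  the exploration is \<open>ok\<close>, and nonnegative in any case.\<close>

lemma planted_rejection_ge:
  assumes k: "3 \<le> k" and A: "A \<subseteq> cube k" "A \<noteq> {}" "\<And>y. y \<in> A \<Longrightarrow> map Not y \<in> A"
    and rho: "0 \<le> \<rho>" "\<rho> \<le> 1" "\<And>S. S \<subseteq> {..<k} \<Longrightarrow> S \<noteq> {} \<Longrightarrow> S \<noteq> {..<k} \<Longrightarrow> \<bar>coef A S\<bar> \<le> \<rho>"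
    and H: "H \<in> hypers k d N" and lk: "k \<le> l" and s: "(1 + 2 ^ k * \<rho> ^ (l - k)) ^ r \<le> 1 + s" "s \<le> 1"
  shows "(\<Sum>b\<in>lits k d N. \<Sum>a\<in>PiE {..<k * N} (\<lambda>_. UNIV).
      of_bool (\<not> run (orc k d N H b) T) * (\<Prod>e\<in>{..<d} \<times> {..<N}. dens k A (mask k (vtx N H e) a (b e))))
    \<ge> 2 ^ (k * N) * (1 - s) * (\<Sum>b\<in>lits k d N. of_bool (\<not> run (orc k d N H b) T \<and> ok l r k N H (expl k d N H b T)))"
proof -
  let ?A = "PiE {..<k * N} (\<lambda>_. UNIV :: bool set)"
  let ?All = "{..<d} \<times> {..<N}"
  let ?D = "\<lambda>b. expl k d N H b T"
  let ?rej = "\<lambda>b. of_bool (\<not> run (orc k d N H b) T) :: real"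
  let ?g = "\<lambda>a e y. dens k A (mask k (vtx N H e) a y)"
  have "(\<Sum>b\<in>lits k d N. \<Sum>a\<in>?A. ?rej b * (\<Prod>e\<in>?All. ?g a e (b e)))
      = (\<Sum>a\<in>?A. \<Sum>b\<in>lits k d N. ?rej b * (\<Prod>e\<in>?All. ?g a e (b e)))"
    by (rule sum.swap)
  also have "\<dots> = (\<Sum>a\<in>?A. \<Sum>b\<in>lits k d N. ?rej b * (\<Prod>e\<in>?D b. ?g a e (b e)))"
  proof (rule sum.cong[OF refl])
    fix a
    show "(\<Sum>b\<in>lits k d N. ?rej b * (\<Prod>e\<in>?All. ?g a e (b e)))
        = (\<Sum>b\<in>lits k d N. ?rej b * (\<Prod>e\<in>?D b. ?g a e (b e)))"
      unfolding lits_def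
    proof (rule sum_stopped_prod)
      show "?D b \<subseteq> ?All" for b using expl_subset[OF H] .
      show "?D b' = ?D b \<and> ?rej b' = ?rej b" if "\<And>e. e \<in> ?D b \<Longrightarrow> b' e = b e" for b b'
        using expl_agree[OF that] by simp
      show "(\<Sum>y\<in>cube k. ?g a e y) = card (cube k)" for e by (rule sum_dens_mask[OF A(1,2)])
      show "cube k \<noteq> {}" using A by auto
    qed (auto simp: finite_cube)
  qed
  also have "\<dots> = (\<Sum>b\<in>lits k d N. \<Sum>a\<in>?A. ?rej b * (\<Prod>e\<in>?D b. ?g a e (b e)))"
    by (rule sum.swap)
  also have "\<dots> = (\<Sum>b\<in>lits k d N. ?rej b * (2 ^ (k * N) * lr k A {..<k * N} (vtx N H) (?D b) b))"
    by (intro sum.cong refl) (simp add: lr_def sum_distrib_left[symmetric])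
  also have "\<dots> \<ge> (\<Sum>b\<in>lits k d N. 2 ^ (k * N) * (1 - s) * of_bool (\<not> run (orc k d N H b) T \<and> ok l r k N H (?D b)))"
  proof (rule sum_mono)
    fix b
    have nn: "0 \<le> lr k A {..<k * N} (vtx N H) (?D b) b"
      unfolding lr_def by (intro divide_nonneg_nonneg sum_nonneg prod_nonneg) (auto simp: dens_def)
    have "1 - s \<le> lr k A {..<k * N} (vtx N H) (?D b) b" if o: "ok l r k N H (?D b)"
    proof -
      obtain X where X: "good l (\<lambda>e. vtx N H e ` {..<k}) (?D b) X" "card X \<le> r" using o by (auto simp: ok_def)
      have "2 - (1 + 2 ^ k * \<rho> ^ (l - k)) ^ card X \<le> lr k A {..<k * N} (vtx N H) (?D b) b"
      proof (rule lr_near_one[OF k A rho _ _ _ X(1) lk])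
        show "inj_on (vtx N H e) {..<k}" if "e \<in> ?D b" for e
          using inj_on_vtx[OF H] expl_subset[OF H] that by blast
        show "vtx N H e j \<in> {..<k * N}" if "e \<in> ?D b" "j < k" for e j
          using vtx_bounds(3)[OF H _ that(2)] expl_subset[OF H] that by blast
      qed auto
      moreover have "(1 + 2 ^ k * \<rho> ^ (l - k)) ^ card X \<le> (1 + 2 ^ k * \<rho> ^ (l - k)) ^ r"
        using X(2) rho by (intro power_increasing) auto
      ultimately show ?thesis using s by linarith
    qed
    then show "2 ^ (k * N) * (1 - s) * of_bool (\<not> run (orc k d N H b) T \<and> ok l r k N H (?D b))
        \<le> ?rej b * (2 ^ (k * N) * lr k A {..<k * N} (vtx N H) (?D b) b)"
      using nn by auto
  qed
  finally show ?thesis by (simp add: sum_distrib_left)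
qed

section \<open>Exploring a random hypergraph\<close>

lemma adj_cong: "(\<And>e. e \<in> E \<Longrightarrow> V e = V' e) \<Longrightarrow> adj V E = adj V' E"
  by (auto simp: adj_def)

lemma good_cong: "good l V E X \<Longrightarrow> (\<And>e. e \<in> E \<Longrightarrow> V e = V' e) \<Longrightarrow> good l V' E X"
proof (induction rule: good.induct)
  case (tree E X e)
  have "\<Union>(V ` E) = \<Union>(V' ` E)" using tree.prems by auto
  then show ?case using tree by (intro good.tree) auto
next
  case (excess E X e u w)
  have *: "\<Union>(V ` E) = \<Union>(V' ` E)" "adj V E = adj V' E" using excess.prems adj_cong[of E V V'] by auto
  have "X \<subseteq> E" using good_finite[OF excess.hyps(1)] by auto
  then have "\<Union>(V ` X) = \<Union>(V' ` X)" using excess.prems by (intro SUP_cong) auto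
  then show ?case using excess * by (intro good.excess[of _ _ E X e u w]) auto
qed (rule good.empty)

lemma card_ball_le:
  assumes finE: "finite E" and fin: "\<And>e. e \<in> E \<Longrightarrow> finite (V e)" and ck: "\<And>e. e \<in> E \<Longrightarrow> card (V e) \<le> k"
    and deg: "\<And>v. card {e\<in>E. v \<in> V e} \<le> d" and U: "finite U"
  shows "finite ((adj V E ^^ n) `` U) \<and> card ((adj V E ^^ n) `` U) \<le> card U * (1 + d * k) ^ n"
proof (induction n)
  case (Suc n)
  let ?B = "(adj V E ^^ n) `` U"
  let ?N = "\<lambda>v. insert v (\<Union>e\<in>{e\<in>E. v \<in> V e}. V e)"
  have N: "finite (?N v) \<and> card (?N v) \<le> 1 + d * k" for v
  proof
    show "finite (?N v)" using finE fin by auto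
    have "card (?N v) \<le> Suc (card (\<Union>e\<in>{e\<in>E. v \<in> V e}. V e))" by (rule card_insert_le_m1) auto
    also have "card (\<Union>e\<in>{e\<in>E. v \<in> V e}. V e) \<le> (\<Sum>e\<in>{e\<in>E. v \<in> V e}. card (V e))"
      using finE by (intro card_UN_le) auto
    also have "\<dots> \<le> (\<Sum>e\<in>{e\<in>E. v \<in> V e}. k)" using ck by (intro sum_mono) auto
    also have "\<dots> \<le> d * k" using deg by simp
    finally show "card (?N v) \<le> 1 + d * k" by simp
  qed
  have eq: "(adj V E ^^ Suc n) `` U = (\<Union>v\<in>?B. ?N v)"
    by (auto simp: adj_def relcomp_Image)
  have "card (\<Union>v\<in>?B. ?N v) \<le> (\<Sum>v\<in>?B. card (?N v))" using Suc by (intro card_UN_le) auto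
  also have "\<dots> \<le> (\<Sum>v\<in>?B. 1 + d * k)" using N by (intro sum_mono) auto
  also have "\<dots> = card ?B * (1 + d * k)" by simp
  also have "\<dots> \<le> card U * (1 + d * k) ^ n * (1 + d * k)" using Suc by (intro mult_right_mono) auto
  also have "\<dots> = card U * (1 + d * k) ^ Suc n" by (simp only: power_Suc mult_ac)
  finally have "card ((adj V E ^^ Suc n) `` U) \<le> card U * (1 + d * k) ^ Suc n"
    unfolding eq .
  moreover have "finite (\<Union>v\<in>?B. ?N v)" using Suc N by auto
  ultimately show ?case unfolding eq by blast
qed (use U in auto)

lemma card_touching_le:
  assumes finE: "finite E" and deg: "\<And>v. card {e\<in>E. v \<in> V e} \<le> d" and W: "finite W"
  shows "card {e\<in>E. V e \<inter> W \<noteq> {}} \<le> d * card W"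
proof -
  have "{e\<in>E. V e \<inter> W \<noteq> {}} = (\<Union>v\<in>W. {e\<in>E. v \<in> V e})" by auto
  then have "card {e\<in>E. V e \<inter> W \<noteq> {}} \<le> (\<Sum>v\<in>W. card {e\<in>E. v \<in> V e})"
    using card_UN_le[OF W, of "\<lambda>v. {e\<in>E. v \<in> V e}"] by simp
  also have "\<dots> \<le> (\<Sum>v\<in>W. d)" using deg by (intro sum_mono) auto
  finally show ?thesis by (simp add: mult.commute)
qed

text \<open>Law of total probability: the classes are the states of knowledge after one more query,
  and \<open>\<phi>\<close> bounds the conditional probability of failure in each of them.\<close>

lemma card_le_sum_classes:
  fixes \<phi> :: "'a \<Rightarrow> real"
  assumes fin: "finite C" and cl: "\<And>h. h \<in> C \<Longrightarrow> h \<in> cl h" "\<And>h. h \<in> C \<Longrightarrow> cl h \<subseteq> C"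
      "\<And>h h'. h \<in> C \<Longrightarrow> h' \<in> cl h \<Longrightarrow> cl h' = cl h"
    and phi: "\<And>h h'. h \<in> C \<Longrightarrow> h' \<in> cl h \<Longrightarrow> \<phi> h' = \<phi> h"
    and bnd: "\<And>h. h \<in> C \<Longrightarrow> card (Bad \<inter> cl h) \<le> \<phi> h * card (cl h)"
  shows "card (Bad \<inter> C) \<le> (\<Sum>h\<in>C. \<phi> h)"
proof -
  have cls: "{x\<in>C. cl x = c} = c" if c: "c \<in> cl ` C" for c
  proof -
    obtain h where "h \<in> C" "c = cl h" using c by auto
    then show ?thesis using cl by blast
  qed
  have "real (card (Bad \<inter> C)) = (\<Sum>h\<in>C. of_bool (h \<in> Bad))"
    using fin by (simp add: Int_commute)
  also have "\<dots> = (\<Sum>c\<in>cl ` C. \<Sum>h\<in>{x\<in>C. cl x = c}. of_bool (h \<in> Bad))"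
    by (rule sum.image_gen[OF fin])
  also have "\<dots> \<le> (\<Sum>c\<in>cl ` C. \<Sum>h\<in>{x\<in>C. cl x = c}. \<phi> h)"
  proof (rule sum_mono)
    fix c assume c: "c \<in> cl ` C"
    then obtain h where h: "h \<in> C" "c = cl h" by auto
    have finc: "finite c" using finite_subset[OF cl(2)[OF h(1)] fin] h(2) by simp
    have "(\<Sum>h\<in>{x\<in>C. cl x = c}. of_bool (h \<in> Bad)) = real (card (Bad \<inter> c))"
      unfolding cls[OF c] using finc by (simp add: Int_commute)
    also have "\<dots> \<le> \<phi> h * card c" using bnd[OF h(1)] h(2) by simp
    also have "\<dots> = (\<Sum>h'\<in>c. \<phi> h)" by simp
    also have "\<dots> = (\<Sum>h'\<in>c. \<phi> h')"
    proof (rule sum.cong[OF refl])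
      fix h' assume "h' \<in> c"
      then show "\<phi> h = \<phi> h'" using phi[OF h(1), of h'] h(2) by simp
    qed
    finally show "(\<Sum>h\<in>{x\<in>C. cl x = c}. of_bool (h \<in> Bad)) \<le> (\<Sum>h\<in>{x\<in>C. cl x = c}. \<phi> h)"
      unfolding cls[OF c] .
  qed
  also have "\<dots> = (\<Sum>h\<in>C. \<phi> h)" by (rule sum.image_gen[OF fin, symmetric])
  finally show ?thesis .
qed

text \<open>The hypergraphs compatible with what the exploration of \<open>E\<close> has shown, with
  \<open>H0\<close> as a representative. Conditioning the random hypergraph on this knowledge gives
  the uniform distribution on this set.\<close>

definition agreeing :: "nat \<Rightarrow> nat \<Rightarrow> nat \<Rightarrow> edge set \<Rightarrow> hyper \<Rightarrow> hyper set" where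
  "agreeing k d N E H0 = {H \<in> hypers k d N. \<forall>e\<in>E. \<forall>j<k. H (fst e, j) (snd e) = H0 (fst e, j) (snd e)}"

lemma finite_hypers: "finite (hypers k d N)"
  unfolding hypers_def by (intro finite_PiE) (auto intro: finite_permutations)

lemma finite_agreeing: "finite (agreeing k d N E H0)"
  unfolding agreeing_def using finite_hypers by simp

lemma agreeing_vtx: "H \<in> agreeing k d N E H0 \<Longrightarrow> e \<in> E \<Longrightarrow> j < k \<Longrightarrow> vtx N H e j = vtx N H0 e j"
  by (auto simp: agreeing_def vtx_def)

lemma agreeing_vset: "H \<in> agreeing k d N E H0 \<Longrightarrow> e \<in> E \<Longrightarrow> vtx N H e ` {..<k} = vtx N H0 e ` {..<k}"
  by (intro image_cong refl) (auto simp: agreeing_vtx)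

lemma agreeing_con: "H \<in> agreeing k d N E H0 \<Longrightarrow> e \<in> E \<Longrightarrow> con k N H b e = con k N H0 b e"
  by (auto simp: con_def agreeing_vtx)

definition shuffle :: "nat \<times> nat \<Rightarrow> nat \<Rightarrow> nat \<Rightarrow> hyper \<Rightarrow> hyper" where
  "shuffle p w w' H = H(p := Transposition.transpose w w' \<circ> H p)"

text \<open>The image of a fresh edge in another block is uniform on the vertices not yet used there.\<close>

lemma card_hit_le:
  assumes E: "E \<subseteq> {..<d} \<times> {..<N}" "finite E" and i: "i < d" and x: "x < k * N"
    and j': "j' < k" "j' \<noteq> x div N" and B: "B \<subseteq> agreeing k d N E H0"
    and fresh: "\<And>H. H \<in> B \<Longrightarrow> edge_at N H x i \<notin> E"
    and closed: "\<And>H w w'. H \<in> B \<Longrightarrow> shuffle (i, j') w w' H \<in> hypers k d N \<Longrightarrow>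
        shuffle (i, j') w w' H \<in> agreeing k d N E H0 \<Longrightarrow> shuffle (i, j') w w' H \<in> B"
    and W: "finite W"
  shows "card {H\<in>B. vtx N H (edge_at N H x i) j' \<in> W} * (N - card E) \<le> card W * card B"
proof -
  define f where "f H = H (i, j') (snd (edge_at N H x i))" for H :: hyper
  define used where "used = {w. \<exists>t. (i, t) \<in> E \<and> w = H0 (i, j') t}"
  define free where "free = {..<N} - used"
  have BH: "H \<in> hypers k d N" if "H \<in> B" for H using that B by (auto simp: agreeing_def)
  have finB: "finite B" using B finite_agreeing finite_subset by blast
  have perm: "H (i, j') permutes {..<N}" if "H \<in> B" for H
    using hypers_permutes[OF BH[OF that] i j'(1)] .
  have agree: "H (i, j') t = H0 (i, j') t" if "H \<in> B" "(i, t) \<in> E" for H t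
    using that B j' by (force simp: agreeing_def)
  have f_free: "f H \<in> free" if H: "H \<in> B" for H
  proof -
    have e: "edge_at N H x i \<in> {..<d} \<times> {..<N}" by (rule edge_at_mem(1)[OF BH[OF H] x i])
    then have "f H < N" unfolding f_def using permutes_in_image[OF perm[OF H], of "snd (edge_at N H x i)"] by auto
    moreover have "f H \<notin> used"
    proof
      assume "f H \<in> used"
      then obtain t where t: "(i, t) \<in> E" "f H = H0 (i, j') t" by (auto simp: used_def)
      then have "H (i, j') (snd (edge_at N H x i)) = H (i, j') t" using agree[OF H t(1)] by (simp add: f_def)
      then have "snd (edge_at N H x i) = t" using permutes_inj[OF perm[OF H]] by (auto dest: injD)
      then have "edge_at N H x i = (i, t)" by (auto simp: edge_at_def)
      then show False using fresh[OF H] t by simp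
    qed
    ultimately show ?thesis by (simp add: free_def)
  qed
  have sh_mem: "shuffle (i, j') w w' H \<in> B" if H: "H \<in> B" and w: "w \<in> free" "w' \<in> free" for H w w'
  proof -
    have "Transposition.transpose w w' permutes {..<N}" using w by (intro permutes_swap_id) (auto simp: free_def)
    then have p: "(Transposition.transpose w w' \<circ> H (i, j')) permutes {..<N}" by (rule permutes_compose[OF perm[OF H]])
    have hy: "shuffle (i, j') w w' H \<in> hypers k d N"
      unfolding hypers_def shuffle_def
    proof (rule PiE_I)
      fix p' assume "p' \<in> {..<d} \<times> {..<k}"
      then show "(H((i, j') := Transposition.transpose w w' \<circ> H (i, j'))) p' \<in> {p. p permutes {..<N}}"
        using p BH[OF H] by (auto simp: hypers_def PiE_iff)
    next
      fix p' assume "p' \<notin> {..<d} \<times> {..<k}"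
      then show "(H((i, j') := Transposition.transpose w w' \<circ> H (i, j'))) p' = undefined"
        using BH[OF H] i j' unfolding hypers_def by (cases p') (auto simp: PiE_iff extensional_def)
    qed
    have "shuffle (i, j') w w' H \<in> agreeing k d N E H0"
      unfolding agreeing_def
    proof (intro CollectI conjI ballI allI impI hy)
      fix e j assume e: "e \<in> E" "j < k"
      have base: "H (fst e, j) (snd e) = H0 (fst e, j) (snd e)" using H B e by (auto simp: agreeing_def)
      show "shuffle (i, j') w w' H (fst e, j) (snd e) = H0 (fst e, j) (snd e)"
      proof (cases "(fst e, j) = (i, j')")
        case True
        then have "(i, snd e) \<in> E" using e by (cases e) auto
          then have "H0 (i, j') (snd e) \<in> used" unfolding used_def by blast
        then have "H0 (i, j') (snd e) \<noteq> w" "H0 (i, j') (snd e) \<noteq> w'" using w by (auto simp: free_def)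
        then show ?thesis using True base by (simp add: shuffle_def Transposition.transpose_apply_other)
      next
        case False
        then show ?thesis using base by (auto simp: shuffle_def)
      qed
    qed
    then show ?thesis using closed[OF H hy] by blast
  qed
  \<comment> \<open>The edge of layer \<open>i\<close> at \<open>x\<close> is decided by the
    permutation for the block of \<open>x\<close>, and \<open>j'\<close> is another block.\<close>
  have edge_sh: "edge_at N (shuffle (i, j') w w' H) x i = edge_at N H x i" for w w' H
    using j' by (simp add: edge_at_def shuffle_def)
  have f_sh: "f (shuffle (i, j') w w' H) = Transposition.transpose w w' (f H)" for w w' H
    unfolding f_def edge_sh by (simp add: shuffle_def)
  have sh_sh: "shuffle (i, j') w w' (shuffle (i, j') w w' H) = H" for w w' H
    by (auto simp: shuffle_def fun_eq_iff)
  have eqc: "card {H\<in>B. f H = w} = card {H\<in>B. f H = w'}" if w: "w \<in> free" "w' \<in> free" for w w'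
    by (rule bij_betw_same_card[of "shuffle (i, j') w w'"],
        rule bij_betw_byWitness[where f' = "shuffle (i, j') w w'"])
      (use w sh_mem in \<open>auto simp: sh_sh f_sh\<close>)
  have finfree: "finite free" by (simp add: free_def)
  have "used \<subseteq> (\<lambda>e. H0 (i, j') (snd e)) ` E" by (force simp: used_def)
  then have "card used \<le> card E" using E by (meson card_image_le card_mono finite_imageI le_trans)
  moreover have "N \<le> card free + card used"
    unfolding free_def using diff_card_le_card_Diff[of used "{..<N}"] \<open>used \<subseteq> _\<close> E(2) finite_subset
    by (metis card_lessThan finite_imageI le_diff_conv)
  ultimately have cf: "N - card E \<le> card free" by linarith
  show ?thesis
  proof (cases "free = {}")
    case True
    then have "B = {}" using f_free by auto
    then show ?thesis by simp
  next
    case False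
    then obtain w0 where w0: "w0 \<in> free" by auto
    define c where "c = card {H\<in>B. f H = w0}"
    have cc: "card {H\<in>B. f H = w} = c" if "w \<in> free" for w using eqc[OF that w0] by (simp add: c_def)
    have cardB: "card B = card free * c"
    proof -
      have "B = (\<Union>w\<in>free. {H\<in>B. f H = w})" using f_free by auto
      also have "card \<dots> = (\<Sum>w\<in>free. card {H\<in>B. f H = w})"
        using finfree finB by (intro card_UN_disjoint) auto
      finally show ?thesis using cc by simp
    qed
    have vf: "vtx N H (edge_at N H x i) j' = j' * N + f H" for H
      by (simp add: vtx_def f_def edge_at_def)
    have "{H\<in>B. vtx N H (edge_at N H x i) j' \<in> W} = (\<Union>w\<in>{w\<in>free. j' * N + w \<in> W}. {H\<in>B. f H = w})"
      using f_free by (auto simp: vf)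
    also have "card \<dots> = (\<Sum>w\<in>{w\<in>free. j' * N + w \<in> W}. card {H\<in>B. f H = w})"
      using finfree finB by (intro card_UN_disjoint) auto
    also have "\<dots> = card {w\<in>free. j' * N + w \<in> W} * c" using cc by simp
    also have "card {w\<in>free. j' * N + w \<in> W} \<le> card W"
      by (rule card_inj_on_le[of "\<lambda>w. j' * N + w"]) (use W in \<open>auto simp: inj_on_def\<close>)
    finally have "card {H\<in>B. vtx N H (edge_at N H x i) j' \<in> W} \<le> card W * c" by simp
    then have "card {H\<in>B. vtx N H (edge_at N H x i) j' \<in> W} * (N - card E) \<le> card W * c * card free"
      using cf by (rule mult_le_mono)
    then show ?thesis by (simp add: cardB mult.commute mult.left_commute)
  qed
qed

lemma card_vset_le: "card (vtx N H e ` {..<k}) \<le> k"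
  using card_image_le[of "{..<k}" "vtx N H e"] by simp

lemma card_UN_vset_le:
  assumes "finite X" "card X \<le> r"
  shows "card (\<Union>e\<in>X. vtx N H e ` {..<k}) \<le> k * r"
proof -
  have "card (\<Union>e\<in>X. vtx N H e ` {..<k}) \<le> (\<Sum>e\<in>X. card (vtx N H e ` {..<k}))"
    by (rule card_UN_le[OF assms(1)])
  also have "\<dots> \<le> (\<Sum>e\<in>X. k)" by (rule sum_mono[OF card_vset_le])
  also have "\<dots> \<le> k * r" using assms(2) by simp
  finally show ?thesis .
qed

lemma degree_le:
  assumes H: "H \<in> hypers k d N" and E: "E \<subseteq> {..<d} \<times> {..<N}"
  shows "card {e\<in>E. v \<in> vtx N H e ` {..<k}} \<le> d"
proof -
  have "{e\<in>E. v \<in> vtx N H e ` {..<k}} \<subseteq> edge_at N H v ` {..<d}"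
  proof
    fix e assume "e \<in> {e\<in>E. v \<in> vtx N H e ` {..<k}}"
    then obtain j where e: "e \<in> E" and j: "j < k" "v = vtx N H e j" by auto
    have e': "e \<in> {..<d} \<times> {..<N}" using e E by auto
    show "e \<in> edge_at N H v ` {..<d}"
    proof (rule image_eqI)
      show "e = edge_at N H v (fst e)" using edge_at_unique[OF H e' j(1) j(2)[symmetric]] .
      show "fst e \<in> {..<d}" using e' by auto
    qed
  qed
  then have "card {e\<in>E. v \<in> vtx N H e ` {..<k}} \<le> card (edge_at N H v ` {..<d})"
    by (intro card_mono) auto
  also have "\<dots> \<le> d" using card_image_le[of "{..<d}"] by simp
  finally show ?thesis .
qed

section \<open>Neighbourhoods of excess edges and the outcome of one query\<close>

definition near :: "nat \<Rightarrow> ('e \<Rightarrow> 'v set) \<Rightarrow> 'e set \<Rightarrow> 'v set \<Rightarrow> 'v set" where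
  "near l V E U = (adj V E ^^ (2 * l)) `` U"

definition touching :: "nat \<Rightarrow> ('e \<Rightarrow> 'v set) \<Rightarrow> 'e set \<Rightarrow> 'e set \<Rightarrow> nat" where
  "touching l V E X = card {e\<in>E. V e \<inter> near l V E (\<Union>(V ` X)) \<noteq> {}}"

lemma near_mono: "E \<subseteq> E' \<Longrightarrow> U \<subseteq> U' \<Longrightarrow> near l V E U \<subseteq> near l V E' U'"
  unfolding near_def using adj_mono_edges by fast

lemma near_bounds:
  assumes H: "H \<in> hypers k d N" and E: "E \<subseteq> {..<d} \<times> {..<N}" and X: "X \<subseteq> E" "card X \<le> r"
  defines "V \<equiv> \<lambda>e. vtx N H e ` {..<k}"
  shows "finite U \<Longrightarrow> finite (near l V E U)"
    "finite U \<Longrightarrow> card (near l V E U) \<le> card U * (1 + d * k) ^ (2 * l)"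
    "touching l V E X \<le> d * (k * r * (1 + d * k) ^ (2 * l))"
proof -
  have finE: "finite E" using E finite_subset by blast
  have ball: "finite (near l V E U) \<and> card (near l V E U) \<le> card U * (1 + d * k) ^ (2 * l)" if "finite U" for U
    unfolding near_def
    by (rule card_ball_le[OF finE]) (use that degree_le[OF H E] card_vset_le in \<open>auto simp: V_def\<close>)
  then show "finite U \<Longrightarrow> finite (near l V E U)"
    "finite U \<Longrightarrow> card (near l V E U) \<le> card U * (1 + d * k) ^ (2 * l)" by blast+
  let ?Z = "\<Union>(V ` X)"
  have finX: "finite X" using finite_subset[OF X(1) finE] .
  have Z: "card ?Z \<le> k * r" unfolding V_def by (rule card_UN_vset_le[OF finX X(2)])
  have finZ: "finite ?Z" using finX by (auto simp: V_def)
  have "touching l V E X \<le> d * card (near l V E ?Z)"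
    unfolding touching_def using ball[OF finZ] degree_le[OF H E]
    by (intro card_touching_le[OF finE]) (auto simp: V_def)
  also have "card (near l V E ?Z) \<le> card ?Z * (1 + d * k) ^ (2 * l)" using ball[OF finZ] by simp
  also have "\<dots> \<le> k * r * (1 + d * k) ^ (2 * l)" using Z by (intro mult_right_mono) auto
  finally show "touching l V E X \<le> d * (k * r * (1 + d * k) ^ (2 * l))" by simp
qed

lemma near_cong:
  assumes "\<And>e. e \<in> E \<Longrightarrow> V e = V' e"
  shows "near l V E U = near l V' E U"
  using adj_cong[of E V V'] assms by (simp add: near_def)

text \<open>
  Below, \<open>W\<close> is the set of explored vertices, \<open>Z\<close> consists of the vertices near an excess edge, and
  \<open>R\<close> of those near an excess edge or near the queried variable \<open>x\<close>.
\<close>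

definition hit :: "nat \<Rightarrow> nat \<Rightarrow> nat \<Rightarrow> nat \<Rightarrow> nat set \<Rightarrow> hyper \<Rightarrow> bool" where
  "hit N i x j' W H \<longleftrightarrow> j' \<noteq> x div N \<and> vtx N H (edge_at N H x i) j' \<in> W"

text \<open>The clauses correspond to the ways in which a collision can violate the rule
  \<open>excess\<close>: too many explored vertices on the edge, a collision vertex too close to
  \<open>x\<close> or to an older excess edge, and an \<open>x\<close> that is itself too close to
  one.\<close>

definition mishap :: "nat \<Rightarrow> nat \<Rightarrow> nat \<Rightarrow> nat \<Rightarrow> nat set \<Rightarrow> nat set \<Rightarrow> nat set \<Rightarrow> hyper \<Rightarrow> bool" where
  "mishap k N i x W R Z H \<longleftrightarrow>
    (\<exists>j<k. \<exists>j'<k. j \<noteq> j' \<and> hit N i x j W H \<and> hit N i x j' W H) \<or>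
    (\<exists>j<k. hit N i x j R H) \<or> (x \<in> Z \<and> (\<exists>j<k. hit N i x j W H))"

text \<open>Without two collisions, an edge that meets the explored vertices more than once meets
  them in \<open>x\<close> and one further vertex, and the other clauses of \<open>mishap\<close>
  give the distances. The hit recorded in the second alternative later pays for the growth of
  \<open>X\<close>.\<close>

lemma good_extend:
  assumes H: "H \<in> hypers k d N" and x: "x < k * N" and i: "i < d" and E: "E \<subseteq> {..<d} \<times> {..<N}"
  defines "V \<equiv> \<lambda>e. vtx N H e ` {..<k}" and "e \<equiv> edge_at N H x i"
  assumes g: "good l V E X" and fresh: "e \<notin> E"
    and W: "W = \<Union>(V ` E)" and Z: "Z = near l V E (\<Union>(V ` X))" and R: "R = Z \<union> near l V E {x}"
    and nb: "\<not> mishap k N i x W R Z H"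
  shows "good l V (insert e E) X \<or> ((\<exists>j<k. hit N i x j W H) \<and> good l V (insert e E) (insert e X))"
proof (cases "card (V e \<inter> \<Union>(V ` E)) \<le> 1")
  case True
  then show ?thesis using good.tree[OF g fresh] by blast
next
  case False
  have j: "x div N < k" "vtx N H e (x div N) = x"
    using edge_at_mem(2)[OF H x i] vtx_edge_at[OF H x i] by (auto simp: e_def)
  have Ve: "V e \<subseteq> insert x {vtx N H e j' |j'. j' < k \<and> j' \<noteq> x div N}"
    using j by (auto simp: V_def)
  let ?I = "V e \<inter> W"
  have finI: "finite ?I" by (simp add: V_def)
  have c: "\<not> card ?I \<le> 1" using False by (simp add: W)
  have "\<not> ?I \<subseteq> {x}"
  proof
    assume "?I \<subseteq> {x}"
    then have "card ?I \<le> card {x}" by (intro card_mono) auto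
    then show False using c by simp
  qed
  then obtain j' where j': "j' < k" "j' \<noteq> x div N" "vtx N H e j' \<in> W" using Ve by blast
  have hj: "hit N i x j' W H" using j' by (simp add: hit_def e_def)
  have uniq: "j'' = j'" if "j'' < k" "j'' \<noteq> x div N" "vtx N H e j'' \<in> W" for j''
  proof (rule ccontr)
    assume "j'' \<noteq> j'"
    moreover have "hit N i x j'' W H" using that by (simp add: hit_def e_def)
    ultimately show False using nb hj that(1) j'(1) by (auto simp: mishap_def)
  qed
  let ?v = "vtx N H e j'"
  have sub: "?I \<subseteq> {x, ?v}" using Ve uniq by blast
  have "x \<in> W"
  proof (rule ccontr)
    assume "x \<notin> W"
    then have "?I \<subseteq> {?v}" using sub by blast
    then have "card ?I \<le> card {?v}" by (intro card_mono) auto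
    then show False using c by simp
  qed
  moreover have "x \<in> V e" using j by (force simp: V_def)
  moreover have "?v \<in> V e" using j' by (auto simp: V_def)
  ultimately have I: "V e \<inter> \<Union>(V ` E) = {x, ?v}" using sub j'(3) W by blast
  have vR: "?v \<notin> R" using nb j' by (auto simp: mishap_def hit_def e_def)
  have xZ: "x \<notin> Z" using nb hj j'(1) by (auto simp: mishap_def)
  have far1: "(x, ?v) \<notin> adj V E ^^ (2 * l)" using vR by (auto simp: R near_def)
  have far2: "(z, x) \<notin> adj V E ^^ (2 * l) \<and> (z, ?v) \<notin> adj V E ^^ (2 * l)" if "z \<in> \<Union>(V ` X)" for z
    using that xZ vR unfolding R Z near_def by blast
  have "good l V (insert e E) (insert e X)"
    by (rule good.excess[OF g fresh I far1 far2])
  then show ?thesis using hj j'(1) by blast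
qed

text \<open>Here \<open>p\<close> is a union bound over the blocks for a collision, and
  \<open>\<beta>\<close> bounds the forbidden region. Collisions in two blocks are governed by
  different permutations, whence the summand \<open>p * p\<close>.\<close>

lemma card_mishap_le:
  fixes q N :: nat and p :: real
  assumes H0: "H0 \<in> hypers k d N" and x: "x < k * N" and i: "i < d" and E: "E \<subseteq> {..<d} \<times> {..<N}"
    and fresh: "\<And>H. H \<in> agreeing k d N E H0 \<Longrightarrow> edge_at N H x i \<notin> E"
    and q: "card E \<le> q" "q < N"
    and W: "finite W" "card W \<le> k * q" and R: "finite R" "card R \<le> \<beta>"
  defines "C \<equiv> agreeing k d N E H0"
  defines "p \<equiv> real k * (real k * real q) / (real N - real q)"
  shows "card {H\<in>C. \<exists>j<k. hit N i x j W H} \<le> p * card C"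
    and "card {H\<in>C. mishap k N i x W R Z H}
      \<le> (p * p + real k * real \<beta> / (real N - real q) + of_bool (x \<in> Z) * p) * card C"
proof -
  have finE: "finite E" using E finite_subset by blast
  have finC: "finite C" unfolding C_def by (rule finite_agreeing)
  define M where "M = real N - real q"
  have M: "0 < M" using q by (simp add: M_def)
  have single: "card {H\<in>B. hit N i x j W' H} \<le> real (card W') / M * card B"
    if W': "finite W'" and j: "j < k" and B: "B \<subseteq> C"
      and cl: "\<And>H w w'. j \<noteq> x div N \<Longrightarrow> H \<in> B \<Longrightarrow> shuffle (i, j) w w' H \<in> hypers k d N \<Longrightarrow> shuffle (i, j) w w' H \<in> C \<Longrightarrow>
        shuffle (i, j) w w' H \<in> B" for B j W'
  proof (cases "j = x div N")
    case True
    then have "{H\<in>B. hit N i x j W' H} = {}" by (simp add: hit_def)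
    then have "card {H\<in>B. hit N i x j W' H} = 0" by (simp only: card.empty)
    then show ?thesis using M by simp
  next
    case False
    have "{H\<in>B. hit N i x j W' H} = {H\<in>B. vtx N H (edge_at N H x i) j \<in> W'}"
      using False by (simp add: hit_def)
    moreover have "card {H\<in>B. vtx N H (edge_at N H x i) j \<in> W'} * (N - card E) \<le> card W' * card B"
      using B cl[OF False] fresh
      by (intro card_hit_le[OF E finE i x j False _ _ _ W', where ?H0.0 = H0]) (auto simp: C_def)
    ultimately have "card {H\<in>B. hit N i x j W' H} * (N - card E) \<le> card W' * card B" by simp
    moreover have "card {H\<in>B. hit N i x j W' H} * (N - q) \<le> card {H\<in>B. hit N i x j W' H} * (N - card E)"
      using q by (intro mult_left_mono) auto
    ultimately have "card {H\<in>B. hit N i x j W' H} * (N - q) \<le> card W' * card B" by linarith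
    then have "real (card {H\<in>B. hit N i x j W' H} * (N - q)) \<le> real (card W' * card B)" by (rule of_nat_mono)
    then have "real (card {H\<in>B. hit N i x j W' H}) * M \<le> real (card W') * real (card B)"
      using q by (simp add: M_def of_nat_diff)
    then show ?thesis using M by (simp add: field_simps)
  qed
  have any: "card {H\<in>C. \<exists>j<k. hit N i x j W' H} \<le> real k * (real c / M) * card C"
    if W': "finite W'" "card W' \<le> c" for W' c
  proof -
    have "{H\<in>C. \<exists>j<k. hit N i x j W' H} = (\<Union>j<k. {H\<in>C. hit N i x j W' H})" by auto
    then have "card {H\<in>C. \<exists>j<k. hit N i x j W' H} \<le> (\<Sum>j<k. card {H\<in>C. hit N i x j W' H})"
      using card_UN_le[of "{..<k}" "\<lambda>j. {H\<in>C. hit N i x j W' H}"] by simp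
    then have "real (card {H\<in>C. \<exists>j<k. hit N i x j W' H}) \<le> (\<Sum>j<k. real (card {H\<in>C. hit N i x j W' H}))"
      using of_nat_mono by fastforce
    also have "\<dots> \<le> (\<Sum>j<k. real c / M * card C)"
    proof (rule sum_mono)
      fix j assume j: "j \<in> {..<k}"
      have "card {H\<in>C. hit N i x j W' H} \<le> real (card W') / M * card C"
        using j by (intro single[OF W'(1)]) auto
      also have "\<dots> \<le> real c / M * card C" using W' M by (intro mult_right_mono divide_right_mono) auto
      finally show "real (card {H\<in>C. hit N i x j W' H}) \<le> real c / M * card C" .
    qed
    finally show ?thesis by simp
  qed
  have anyW: "card {H\<in>C. \<exists>j<k. hit N i x j W H} \<le> p * card C"
    using any[OF W] by (simp add: p_def M_def)
  then show "card {H\<in>C. \<exists>j<k. hit N i x j W H} \<le> p * card C" .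
  have anyR: "card {H\<in>C. \<exists>j<k. hit N i x j R H} \<le> real k * real \<beta> / M * card C"
    using any[OF R] by simp
  define wM where "wM = real (k * q) / M"
  have wM: "0 \<le> wM" using M by (simp add: wM_def)
  have single': "card {H\<in>B. hit N i x j W H} \<le> wM * card B"
    if j: "j < k" and B: "B \<subseteq> C"
      and cl: "\<And>H w w'. j \<noteq> x div N \<Longrightarrow> H \<in> B \<Longrightarrow> shuffle (i, j) w w' H \<in> hypers k d N \<Longrightarrow> shuffle (i, j) w w' H \<in> C \<Longrightarrow>
        shuffle (i, j) w w' H \<in> B" for B j
  proof -
    have "card {H\<in>B. hit N i x j W H} \<le> real (card W) / M * card B" by (rule single[OF W(1) j B cl])
    also have "\<dots> \<le> wM * card B"
      unfolding wM_def using M by (intro mult_right_mono divide_right_mono of_nat_mono[OF W(2)]) auto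
    finally show ?thesis .
  qed
  have two: "card {H\<in>C. \<exists>j<k. \<exists>j'<k. j \<noteq> j' \<and> hit N i x j W H \<and> hit N i x j' W H} \<le> p * p * card C"
  proof -
    let ?S = "\<lambda>(j, j'). {H\<in>C. j \<noteq> j' \<and> hit N i x j W H \<and> hit N i x j' W H}"
    have pair: "real (card (?S jj)) \<le> wM * (wM * card C)" if jj: "jj \<in> {..<k} \<times> {..<k}" for jj
    proof -
      obtain j j' where jj': "jj = (j, j')" "j < k" "j' < k" using jj by auto
      let ?B = "{H\<in>C. hit N i x j W H}"
      show ?thesis
      proof (cases "j = j'")
        case True
        then show ?thesis using wM jj' by simp
      next
        case False
        \<comment> \<open>The hypergraphs with a hit in block \<open>j\<close> are closed under
          shuffling block \<open>j'\<close>, so the estimate for a single block applies once more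
          inside this set.\<close>
        have cl: "shuffle (i, j') w w' H \<in> ?B"
          if "j' \<noteq> x div N" "H \<in> ?B" "shuffle (i, j') w w' H \<in> C" for H w w'
        proof -
          have e: "edge_at N (shuffle (i, j') w w' H) x i = edge_at N H x i"
            using that(1) by (simp add: edge_at_def shuffle_def)
          have "vtx N (shuffle (i, j') w w' H) (edge_at N H x i) j = vtx N H (edge_at N H x i) j"
            using False by (simp add: vtx_def shuffle_def)
          then show ?thesis using that e by (simp add: hit_def)
        qed
        have "card {H\<in>?B. hit N i x j' W H} \<le> wM * card ?B"
          by (rule single'[OF jj'(3)]) (use cl in auto)
        also have "\<dots> \<le> wM * (wM * card C)"
          using single'[OF jj'(2), of C] wM by (intro mult_left_mono) auto
        also have "{H\<in>?B. hit N i x j' W H} = ?S jj" using False jj' by auto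
        finally show ?thesis .
      qed
    qed
    have "{H\<in>C. \<exists>j<k. \<exists>j'<k. j \<noteq> j' \<and> hit N i x j W H \<and> hit N i x j' W H} = (\<Union>jj\<in>{..<k} \<times> {..<k}. ?S jj)"
      by auto
    then have "card {H\<in>C. \<exists>j<k. \<exists>j'<k. j \<noteq> j' \<and> hit N i x j W H \<and> hit N i x j' W H} \<le> (\<Sum>jj\<in>{..<k} \<times> {..<k}. card (?S jj))"
      using card_UN_le[of "{..<k} \<times> {..<k}" ?S] by simp
    then have "real (card {H\<in>C. \<exists>j<k. \<exists>j'<k. j \<noteq> j' \<and> hit N i x j W H \<and> hit N i x j' W H})
        \<le> (\<Sum>jj\<in>{..<k} \<times> {..<k}. real (card (?S jj)))"
      using of_nat_mono by fastforce
    also have "\<dots> \<le> (\<Sum>jj\<in>{..<k} \<times> {..<k}. wM * (wM * card C))" by (rule sum_mono[OF pair])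
    also have "\<dots> = p * p * card C" by (simp add: p_def wM_def M_def)
    finally show ?thesis .
  qed
  have three: "card {H\<in>C. x \<in> Z \<and> (\<exists>j<k. hit N i x j W H)} \<le> of_bool (x \<in> Z) * p * card C"
    using anyW by (cases "x \<in> Z") auto
  define S1 where "S1 = {H\<in>C. \<exists>j<k. \<exists>j'<k. j \<noteq> j' \<and> hit N i x j W H \<and> hit N i x j' W H}"
  define S2 where "S2 = {H\<in>C. \<exists>j<k. hit N i x j R H}"
  define S3 where "S3 = {H\<in>C. x \<in> Z \<and> (\<exists>j<k. hit N i x j W H)}"
  have "{H\<in>C. mishap k N i x W R Z H} = S1 \<union> (S2 \<union> S3)"
    unfolding mishap_def S1_def S2_def S3_def by blast
  then have "card {H\<in>C. mishap k N i x W R Z H} \<le> card S1 + card (S2 \<union> S3)"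
    using card_Un_le[of S1 "S2 \<union> S3"] by simp
  then have "card {H\<in>C. mishap k N i x W R Z H} \<le> card S1 + (card S2 + card S3)"
    using card_Un_le[of S2 S3] by linarith
  then have "real (card {H\<in>C. mishap k N i x W R Z H}) \<le> real (card S1) + (real (card S2) + real (card S3))"
    by linarith
  also have "\<dots> \<le> p * p * card C + (real k * real \<beta> / M * card C + of_bool (x \<in> Z) * p * card C)"
    unfolding S1_def S2_def S3_def using two anyR three by linarith
  finally show "card {H\<in>C. mishap k N i x W R Z H}
      \<le> (p * p + real k * real \<beta> / (real N - real q) + of_bool (x \<in> Z) * p) * card C"
    by (simp add: M_def algebra_simps)
qed

lemma not_ok_Int_cong:
  "(\<And>H. H \<in> C \<Longrightarrow> g H = g' H) \<Longrightarrow>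
    {H. \<not> ok l r k N H (g H)} \<inter> C = {H. \<not> ok l r k N H (g' H)} \<inter> C"
  by auto

text \<open>
  The factor is a potential: a query far from the excess edges fails with probability at most \<open>p1\<close>,
  a query near them with probability at most \<open>p1 + p\<close>, but the latter increases \<open>touching\<close>, which
  never exceeds \<open>M\<close>; the last summand bounds the probability of more than \<open>r\<close> excess edges by
  Markov's inequality.
\<close>

lemma exploration_bound:
  fixes q N r l d k :: nat and p p1 M :: real and b :: "edge \<Rightarrow> bool list"
  assumes q: "q < N" and r: "1 \<le> r"
  defines "V \<equiv> \<lambda>H e. vtx N H e ` {..<k}"
  defines "p \<equiv> real k * (real k * real q) / (real N - real q)"
  defines "p1 \<equiv> p * p + real k * real ((k * r + 1) * (1 + d * k) ^ (2 * l)) / (real N - real q)"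
  defines "M \<equiv> real (d * (k * r * (1 + d * k) ^ (2 * l)))"
  assumes "H0 \<in> hypers k d N" "E \<subseteq> {..<d} \<times> {..<N}" "good l (V H0) E X" "card X \<le> r" "card E + m \<le> q"
    "\<And>H. H \<in> agreeing k d N E H0 \<Longrightarrow> queries (orc k d N H b) T \<le> m"
  shows "card ({H. \<not> ok l r k N H (E \<union> expl k d N H b T)} \<inter> agreeing k d N E H0)
    \<le> (real m * p1 + (M - real (touching l (V H0) E X)) * p + (real (card X) + real m * p) / real r)
      * card (agreeing k d N E H0)"
  using assms(7-)
proof (induction T arbitrary: H0 E X m)
  case (Output out)
  have p0: "0 \<le> p" "0 \<le> p1" using q unfolding p_def p1_def by auto
  have XE: "X \<subseteq> E" using good_finite[OF Output(3)] by auto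
  have t: "real (touching l (V H0) E X) \<le> M"
    unfolding M_def V_def by (rule of_nat_mono[OF near_bounds(3)[OF Output(1,2) XE Output(4)]])
  have "ok l r k N H (E \<union> expl k d N H b (Output out))" if "H \<in> agreeing k d N E H0" for H
    using good_cong[OF Output(3), of "V H"] agreeing_vset[OF that] Output(4) unfolding ok_def V_def by auto
  then have "{H. \<not> ok l r k N H (E \<union> expl k d N H b (Output out))} \<inter> agreeing k d N E H0 = {}" by blast
  then show ?case using p0 t by (simp only: card.empty of_nat_0) (intro mult_nonneg_nonneg add_nonneg_nonneg divide_nonneg_nonneg, auto)
next
  case (Query x i f)
  note H0 = Query.prems(1) and E = Query.prems(2) and g = Query.prems(3) and cX = Query.prems(4)
    and cE = Query.prems(5) and qs = Query.prems(6)
  let ?C = "agreeing k d N E H0"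
  have p0: "0 \<le> p" "0 \<le> p1" using q unfolding p_def p1_def by auto
  have XE: "X \<subseteq> E" and finE: "finite E" using good_finite[OF g] by auto
  have H0C: "H0 \<in> ?C" using H0 by (simp add: agreeing_def)
  have CH: "H \<in> hypers k d N" if "H \<in> ?C" for H using that by (simp add: agreeing_def)
  obtain m' where m: "m = Suc m'" using qs[OF H0C] by (cases m) auto
  have qs': "queries (orc k d N H b) (f (orc k d N H b x i)) \<le> m'" if "H \<in> ?C" for H
    using qs[OF that] m by simp
  \<comment> \<open>The claimed bound as a function of the remaining queries \<open>n\<close>, the
    potential \<open>\<nu>\<close> and the number \<open>c\<close> of excess edges.\<close>
  define Phi where "Phi n \<nu> c = real n * p1 + (M - real \<nu>) * p + (real c + real n * p) / real r" for n \<nu> c :: nat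
  have Phi_Suc: "Phi m \<nu> c = Phi m' \<nu> c + p1 + p / r" for \<nu> c
    by (simp add: Phi_def m algebra_simps add_divide_distrib)
  then have Phi_mono: "Phi m' \<nu> c \<le> Phi m \<nu> c" for \<nu> c using p0 r by simp
  let ?t = "touching l (V H0) E X"
  \<comment> \<open>If all compatible hypergraphs give the same answer, nothing is learnt, and the
    induction hypothesis applies with the same \<open>E\<close>.\<close>
  have known: ?case if ans: "\<And>H. H \<in> ?C \<Longrightarrow> orc k d N H b x i = ans"
    and un: "\<And>H. H \<in> ?C \<Longrightarrow> E \<union> expl k d N H b (Query x i f) = E \<union> expl k d N H b (f ans)" for ans
  proof -
    have "card ({H. \<not> ok l r k N H (E \<union> expl k d N H b (f ans))} \<inter> ?C) \<le> Phi m' ?t (card X) * card ?C"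
      unfolding Phi_def
    proof (rule Query.IH[OF rangeI H0 E g cX])
      show "card E + m' \<le> q" using cE m by simp
      show "queries (orc k d N H b) (f ans) \<le> m'" if "H \<in> ?C" for H using qs'[OF that] ans[OF that] by simp
    qed
    also have "\<dots> \<le> Phi m ?t (card X) * card ?C" using Phi_mono by (intro mult_right_mono) auto
    also have "{H. \<not> ok l r k N H (E \<union> expl k d N H b (f ans))} \<inter> ?C
        = {H. \<not> ok l r k N H (E \<union> expl k d N H b (Query x i f))} \<inter> ?C"
      by (rule not_ok_Int_cong) (rule un[symmetric])
    finally show ?thesis unfolding Phi_def .
  qed
  show ?case
  proof (cases "x < k * N \<and> 1 \<le> i \<and> i \<le> d")
    case False
    then show ?thesis by (intro known[of None]) (auto simp: orc_def)
  next
    case True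
    then have x: "x < k * N" and i: "i - 1 < d" by auto
    let ?i = "i - 1"
    show ?thesis
    \<comment> \<open>If one compatible hypergraph has an explored edge of this layer at
      \<open>x\<close>, all of them have that same edge there. So the answer is either known or a
      fresh edge in all of them.\<close>
    proof (cases "\<exists>H1\<in>?C. edge_at N H1 x ?i \<in> E")
      case True
      then obtain H1 where H1: "H1 \<in> ?C" "edge_at N H1 x ?i \<in> E" by auto
      define e where "e = edge_at N H1 x ?i"
      have e: "e \<in> E" "e \<in> {..<d} \<times> {..<N}" "fst e = ?i" using H1 E by (auto simp: e_def edge_at_def)
      have j: "x div N < k" by (rule edge_at_mem(2)[OF CH[OF H1(1)] x i])
      have x1: "vtx N H1 e (x div N) = x" unfolding e_def by (rule vtx_edge_at[OF CH[OF H1(1)] x i])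
      have eq: "edge_at N H x ?i = e" if H: "H \<in> ?C" for H
      proof -
        have "vtx N H e (x div N) = x"
          using agreeing_vtx[OF H e(1) j] agreeing_vtx[OF H1(1) e(1) j] x1 by simp
        then show ?thesis using edge_at_unique[OF CH[OF H] e(2) j] e(3) by metis
      qed
      show ?thesis
      proof (rule known[of "Some (con k N H0 b e)"])
        fix H assume H: "H \<in> ?C"
        show oe: "orc k d N H b x i = Some (con k N H0 b e)"
          using \<open>x < k * N \<and> 1 \<le> i \<and> i \<le> d\<close> eq[OF H] agreeing_con[OF H e(1)] by (simp add: orc_def)
        show "E \<union> expl k d N H b (Query x i f) = E \<union> expl k d N H b (f (Some (con k N H0 b e)))"
          using oe eq[OF H] e(1) by auto
      qed
    next
      case False
      then have fresh: "edge_at N H x ?i \<notin> E" if "H \<in> ?C" for H using that by blast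
      define ed where "ed H = edge_at N H x ?i" for H
      define W where "W = \<Union>(V H0 ` E)"
      define Z where "Z = near l (V H0) E (\<Union>(V H0 ` X))"
      define R where "R = Z \<union> near l (V H0) E {x}"
      define ex where "ex H \<longleftrightarrow> (\<exists>j<k. hit N ?i x j W H)" for H
      define mis where "mis H \<longleftrightarrow> mishap k N ?i x W R Z H" for H
      \<comment> \<open>The refined state of knowledge once the edge answered by \<open>H\<close> is
        revealed as well.\<close>
      define cl where "cl H = agreeing k d N (insert (ed H) E) H" for H
      \<comment> \<open>A bound on the failure probability within \<open>cl H\<close>: one for a
        mishap, plus the induction hypothesis with the potential raised if \<open>x\<close> is near
        an excess edge and with \<open>X\<close> enlarged only after a hit.\<close>
      define \<phi> where "\<phi> H = of_bool (mis H) + real m' * p1 + (M - real ?t - of_bool (x \<in> Z)) * p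
          + (real (card X) + of_bool (ex H) + real m' * p) / real r" for H
      let ?Bad = "{H. \<not> ok l r k N H (E \<union> expl k d N H b (Query x i f))}"
      have ed_mem: "ed H \<in> {..<d} \<times> {..<N}" if "H \<in> ?C" for H
        unfolding ed_def by (rule edge_at_mem(1)[OF CH[OF that] x i])
      have VE: "V H e = V H0 e" if "H \<in> ?C" "e \<in> E" for H e
        unfolding V_def by (rule agreeing_vset[OF that])
      have clC: "cl H \<subseteq> ?C" if "H \<in> ?C" for H
        using that by (auto simp: cl_def agreeing_def)
      have clH: "H \<in> cl H" if "H \<in> ?C" for H using that by (auto simp: cl_def agreeing_def)
      have j: "x div N < k" by (rule edge_at_mem(2)[OF H0 x i])
      have ed_eq: "ed H' = ed H" if H: "H \<in> ?C" and H': "H' \<in> cl H" for H H'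
      proof -
        have "vtx N H' (ed H) (x div N) = vtx N H (ed H) (x div N)"
          using H' j unfolding cl_def by (intro agreeing_vtx) auto
        also have "\<dots> = x" unfolding ed_def by (rule vtx_edge_at[OF CH[OF H] x i])
        finally have "ed H = edge_at N H' x (fst (ed H))"
          using H' by (intro edge_at_unique[OF _ ed_mem[OF H] j]) (auto simp: cl_def agreeing_def)
        then show ?thesis by (simp add: ed_def edge_at_def)
      qed
      have hit_eq: "hit N ?i x j' W' H' \<longleftrightarrow> hit N ?i x j' W' H"
        if H: "H \<in> ?C" and H': "H' \<in> cl H" and j': "j' < k" for H H' j' W'
      proof -
        have "vtx N H' (ed H) j' = vtx N H (ed H) j'"
          using H' j' unfolding cl_def by (intro agreeing_vtx) auto
        then show ?thesis using ed_eq[OF H H'] unfolding hit_def ed_def by simp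
      qed
      have phi_eq: "\<phi> H' = \<phi> H" if H: "H \<in> ?C" and H': "H' \<in> cl H" for H H'
      proof -
        have "ex H' = ex H" "mis H' = mis H"
          unfolding ex_def mis_def mishap_def using hit_eq[OF H H'] by blast+
        then show ?thesis by (simp add: \<phi>_def)
      qed
      have cl_eq: "cl H' = cl H" if H: "H \<in> ?C" and H': "H' \<in> cl H" for H H'
        using H' ed_eq[OF H H'] unfolding cl_def by (auto simp: agreeing_def)
      have t_le: "touching l (V H) (insert (ed H) E) X' \<ge> ?t + of_bool (x \<in> Z)"
        if H: "H \<in> ?C" and X': "X \<subseteq> X'" for H X'
      proof -
        have finE': "finite (insert (ed H) E)" using finE by simp
        have ZZ: "Z \<subseteq> near l (V H) (insert (ed H) E) (\<Union>(V H ` X'))" (is "_ \<subseteq> ?Z'")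
        proof -
          have "Z = near l (V H) E (\<Union>(V H0 ` X))"
            unfolding Z_def by (rule near_cong) (simp add: VE[OF H])
          also have "\<Union>(V H0 ` X) = \<Union>(V H ` X)" using VE[OF H] XE by (intro SUP_cong) auto
          finally show ?thesis using near_mono[of E "insert (ed H) E" "\<Union>(V H ` X)" "\<Union>(V H ` X')" l "V H"] X' by auto
        qed
        have sub: "{e\<in>E. V H0 e \<inter> Z \<noteq> {}} \<subseteq> {e\<in>E. V H e \<inter> ?Z' \<noteq> {}}"
          using ZZ VE[OF H] by auto
        have xe: "x \<in> V H (ed H)" using vtx_edge_at[OF CH[OF H] x i] j unfolding V_def ed_def by force
        have "?t + of_bool (x \<in> Z) = card {e\<in>E. V H0 e \<inter> Z \<noteq> {}} + card (if x \<in> Z then {ed H} else {})"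
          by (simp add: touching_def Z_def)
        also have "\<dots> = card ({e\<in>E. V H0 e \<inter> Z \<noteq> {}} \<union> (if x \<in> Z then {ed H} else {}))"
          using finE fresh[OF H] by (intro card_Un_disjoint[symmetric]) (auto simp: ed_def)
        also have "\<dots> \<le> card {e\<in>insert (ed H) E. V H e \<inter> ?Z' \<noteq> {}}"
          using finE' sub xe ZZ by (intro card_mono) auto
        finally show ?thesis by (simp add: touching_def)
      qed
      have E': "insert (ed H) E \<subseteq> {..<d} \<times> {..<N}" if "H \<in> ?C" for H using E ed_mem[OF that] by simp
      \<comment> \<open>The potential stays within \<open>M\<close> even after this query, so the
        summand for near queries never turns negative.\<close>
      have tM: "real ?t + of_bool (x \<in> Z) \<le> M"
      proof -
        have "touching l (V H0) (insert (ed H0) E) X \<le> d * (k * r * (1 + d * k) ^ (2 * l))"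
          unfolding V_def by (rule near_bounds(3)[OF H0 E'[OF H0C] _ cX]) (use XE in auto)
        then have "?t + of_bool (x \<in> Z) \<le> d * (k * r * (1 + d * k) ^ (2 * l))"
          using t_le[OF H0C order_refl] by linarith
        then have "real (?t + of_bool (x \<in> Z)) \<le> M" unfolding M_def by (rule of_nat_mono)
        then show ?thesis by simp
      qed
      have bnd: "card (?Bad \<inter> cl H) \<le> \<phi> H * card (cl H)" if H: "H \<in> ?C" for H
      proof -
        have fincl: "finite (cl H)" unfolding cl_def by (rule finite_agreeing)
        have triv: "real (card (?Bad \<inter> cl H)) \<le> 1 * card (cl H)"
          using fincl by (simp add: card_mono)
        have nn: "0 \<le> real m' * p1" "0 \<le> (M - real ?t - of_bool (x \<in> Z)) * p" "0 \<le> real m' * p / r"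
          using p0 tM by auto
        show ?thesis
        proof (cases "mis H")
          case True
          have "1 \<le> \<phi> H" unfolding \<phi>_def using True nn by (simp add: add_divide_distrib)
          then have "1 * real (card (cl H)) \<le> \<phi> H * card (cl H)" by (intro mult_right_mono) auto
          then show ?thesis using triv by linarith
        next
          case False
          have gH: "good l (V H) E X" using good_cong[OF g] VE[OF H] by metis
          have WH: "W = \<Union>(V H ` E)" unfolding W_def using VE[OF H] by (intro SUP_cong) auto
          have "\<Union>(V H0 ` X) = \<Union>(V H ` X)" using VE[OF H] XE by (intro SUP_cong) auto
          then have ZH: "Z = near l (V H) E (\<Union>(V H ` X))"
            unfolding Z_def using near_cong[of E "V H0" "V H" l] VE[OF H] by simp
          have RH: "R = Z \<union> near l (V H) E {x}"
            unfolding R_def using near_cong[of E "V H0" "V H" l] VE[OF H] by simp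
          have "good l (V H) (insert (ed H) E) X \<or> (ex H \<and> good l (V H) (insert (ed H) E) (insert (ed H) X))"
            unfolding ed_def ex_def V_def
            by (rule good_extend[OF CH[OF H] x i E gH[unfolded V_def] fresh[OF H] WH[unfolded V_def] ZH[unfolded V_def] RH[unfolded V_def]])
              (use False in \<open>simp add: mis_def\<close>)
          then obtain X' where X': "good l (V H) (insert (ed H) E) X'" "X \<subseteq> X'" "card X' \<le> card X + of_bool (ex H)"
          proof (elim disjE conjE)
            assume a: "good l (V H) (insert (ed H) E) X"
            show thesis by (rule that[OF a]) auto
          next
            assume a: "ex H" "good l (V H) (insert (ed H) E) (insert (ed H) X)"
            show thesis by (rule that[OF a(2)]) (use a(1) card_insert_le_m1[of "Suc (card X)" X "ed H"] in auto)
          qed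
          show ?thesis
          proof (cases "card X' \<le> r")
            case True
            have sm: "card (insert (ed H) E) + m' \<le> q" using cE m finE fresh[OF H] by (simp add: ed_def)
            let ?ans = "Some (con k N H b (ed H))"
            have ans: "orc k d N H' b x i = ?ans" if "H' \<in> cl H" for H'
              using \<open>x < k * N \<and> 1 \<le> i \<and> i \<le> d\<close> ed_eq[OF H that] agreeing_con[of H' k d N "insert (ed H) E" H "ed H" b] that
              by (simp add: orc_def ed_def cl_def)
            have "card ({H'. \<not> ok l r k N H' (insert (ed H) E \<union> expl k d N H' b (f ?ans))} \<inter> cl H)
                \<le> Phi m' (touching l (V H) (insert (ed H) E) X') (card X') * card (cl H)"
              unfolding Phi_def cl_def
            proof (rule Query.IH[OF rangeI CH[OF H] E'[OF H] X'(1) True sm])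
              fix H' assume H': "H' \<in> agreeing k d N (insert (ed H) E) H"
              then have "H' \<in> cl H" by (simp add: cl_def)
              then show "queries (orc k d N H' b) (f ?ans) \<le> m'" using qs'[of H'] ans[of H'] clC[OF H] by auto
            qed
            also have "{H'. \<not> ok l r k N H' (insert (ed H) E \<union> expl k d N H' b (f ?ans))} \<inter> cl H = ?Bad \<inter> cl H"
            proof -
              have "insert (ed H) E \<union> expl k d N H' b (f ?ans) = E \<union> expl k d N H' b (Query x i f)" if "H' \<in> cl H" for H'
                using ans[OF that] ed_eq[OF H that] \<open>x < k * N \<and> 1 \<le> i \<and> i \<le> d\<close> by (auto simp: ed_def)
              then show ?thesis by (rule not_ok_Int_cong)
            qed
            also have "Phi m' (touching l (V H) (insert (ed H) E) X') (card X') * card (cl H) \<le> \<phi> H * card (cl H)"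
            proof (rule mult_right_mono)
              have "real (?t + of_bool (x \<in> Z)) \<le> real (touching l (V H) (insert (ed H) E) X')"
                by (rule of_nat_mono[OF t_le[OF H X'(2)]])
              then have "(M - real (touching l (V H) (insert (ed H) E) X')) * p \<le> (M - real ?t - of_bool (x \<in> Z)) * p"
                using p0 by (intro mult_right_mono) auto
              moreover have "real (card X') \<le> real (card X + of_bool (ex H))" by (rule of_nat_mono[OF X'(3)])
              then have "(real (card X') + real m' * p) / r \<le> (real (card X) + of_bool (ex H) + real m' * p) / r"
                by (intro divide_right_mono) auto
              ultimately show "Phi m' (touching l (V H) (insert (ed H) E) X') (card X') \<le> \<phi> H"
                using False unfolding Phi_def \<phi>_def by simp
            qed simp
            finally show ?thesis .
          next
            \<comment> \<open>The budget of \<open>r\<close> excess edges is exhausted, so the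
              Markov summand alone is at least one.\<close>
            case big: False
            then have "ex H" "card X = r" using X'(3) cX by (cases "ex H"; auto)+
            then have "1 \<le> \<phi> H" unfolding \<phi>_def using nn r by (simp add: add_divide_distrib)
            then have "1 * real (card (cl H)) \<le> \<phi> H * card (cl H)" by (intro mult_right_mono) auto
            then show ?thesis using triv by linarith
          qed
        qed
      qed
      have "card (?Bad \<inter> ?C) \<le> (\<Sum>H\<in>?C. \<phi> H)"
        by (rule card_le_sum_classes[OF finite_agreeing clH clC cl_eq phi_eq bnd])
      also have "\<dots> = card {H\<in>?C. mis H} + card {H\<in>?C. ex H} / r +
          (real m' * p1 + (M - real ?t - of_bool (x \<in> Z)) * p + (real (card X) + real m' * p) / r) * card ?C"
      proof -
        have s: "(\<Sum>H\<in>?C. of_bool (P H)) = real (card {H\<in>?C. P H})" for P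
          using finite_agreeing by (simp add: Int_def)
        define K where "K = real m' * p1 + (M - real ?t - of_bool (x \<in> Z)) * p + (real (card X) + real m' * p) / real r"
        have "\<phi> H = of_bool (mis H) + of_bool (ex H) / r + K" for H
          by (simp add: \<phi>_def K_def add_divide_distrib)
        then have "(\<Sum>H\<in>?C. \<phi> H) = (\<Sum>H\<in>?C. of_bool (mis H)) + (\<Sum>H\<in>?C. of_bool (ex H)) / r + (\<Sum>H\<in>?C. K)"
          by (simp only: sum.distrib sum_divide_distrib)
        then show ?thesis unfolding s K_def[symmetric] by simp
      qed
      \<comment> \<open>A query near an excess edge costs an extra \<open>p\<close>, exactly what
        the raised potential releases. The expected growth of \<open>X\<close> costs
        \<open>p / r\<close>, as accounted for in \<open>Phi_Suc\<close>.\<close>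
      also have "\<dots> \<le> (p1 + of_bool (x \<in> Z) * p) * card ?C + p * card ?C / r +
          (real m' * p1 + (M - real ?t - of_bool (x \<in> Z)) * p + (real (card X) + real m' * p) / r) * card ?C"
      proof -
        have cEq: "card E \<le> q" using cE by simp
        have finW: "finite W" unfolding W_def V_def using finE by auto
        have cW: "card W \<le> k * q" unfolding W_def V_def by (rule card_UN_vset_le[OF finE cEq])
        let ?\<beta> = "(k * r + 1) * (1 + d * k) ^ (2 * l)"
        have finX: "finite X" using finite_subset[OF XE finE] .
        have cZ: "card (\<Union>(V H0 ` X)) \<le> k * r" unfolding V_def by (rule card_UN_vset_le[OF finX cX])
        let ?U = "insert x (\<Union>(V H0 ` X))"
        have finU: "finite ?U" using finX by (auto simp: V_def)
        have cU: "card ?U \<le> k * r + 1" using cZ card_insert_le_m1[of "k * r + 1"] by simp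
        have RU: "R = near l (V H0) E ?U" by (auto simp: R_def Z_def near_def)
        have finR: "finite R" unfolding RU V_def by (rule near_bounds(1)[OF H0 E XE cX finU[unfolded V_def]])
        have "card R \<le> card ?U * (1 + d * k) ^ (2 * l)"
          unfolding RU V_def by (rule near_bounds(2)[OF H0 E XE cX finU[unfolded V_def]])
        also have "\<dots> \<le> ?\<beta>" using cU by (intro mult_right_mono) auto
        finally have cR: "card R \<le> ?\<beta>" .
        note mb = card_mishap_le[OF H0 x i E fresh cEq q finW cW finR cR, folded p_def]
        have "card {H\<in>?C. ex H} \<le> p * card ?C" unfolding ex_def by (rule mb(1))
        then have "card {H\<in>?C. ex H} / r \<le> p * card ?C / r" by (intro divide_right_mono) auto
        moreover have "card {H\<in>?C. mis H} \<le> (p1 + of_bool (x \<in> Z) * p) * card ?C"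
          unfolding mis_def p1_def by (rule mb(2))
        ultimately show ?thesis by linarith
      qed
      also have "\<dots> = Phi m ?t (card X) * card ?C"
        unfolding Phi_Suc by (simp add: Phi_def algebra_simps add_divide_distrib)
      finally show ?thesis unfolding Phi_def .
    qed
  qed
qed

section \<open>Random literals are far from satisfiable\<close>

text \<open>The value of \<open>exploration_bound\<close> for an empty start and \<open>q\<close>
  queries: the base risk of every query, the extra risk of those near excess edges, and the risk of
  too many excess edges.\<close>

definition failure_bound :: "nat \<Rightarrow> nat \<Rightarrow> nat \<Rightarrow> nat \<Rightarrow> nat \<Rightarrow> nat \<Rightarrow> real" where
  "failure_bound k d N l r q = (let p = real k * (real k * real q) / (real N - real q) in
    real q * (p * p + real k * real ((k * r + 1) * (1 + d * k) ^ (2 * l)) / (real N - real q)) +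
    real (d * (k * r * (1 + d * k) ^ (2 * l))) * p + real q * p / real r)"

lemma exploration_bound_initial:
  assumes q: "q < N" and r: "1 \<le> r"
    and T: "\<And>H. H \<in> hypers k d N \<Longrightarrow> queries (orc k d N H b) T \<le> q"
  shows "card {H\<in>hypers k d N. \<not> ok l r k N H (expl k d N H b T)} \<le> failure_bound k d N l r q * card (hypers k d N)"
proof (cases "hypers k d N = {}")
  case False
  then obtain H0 where H0: "H0 \<in> hypers k d N" by auto
  define p where "p = real k * (real k * real q) / (real N - real q)"
  have agr: "agreeing k d N {} H0 = hypers k d N" by (auto simp: agreeing_def)
  have "card ({H. \<not> ok l r k N H ({} \<union> expl k d N H b T)} \<inter> agreeing k d N {} H0) \<le>
    (real q * (p * p + real k * real ((k * r + 1) * (1 + d * k) ^ (2 * l)) / (real N - real q)) +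
     (real (d * (k * r * (1 + d * k) ^ (2 * l))) - real (touching l (\<lambda>e. vtx N H0 e ` {..<k}) {} {})) * p +
     (real (card ({} :: edge set)) + real q * p) / real r) * card (agreeing k d N {} H0)"
    unfolding p_def by (rule exploration_bound[OF q r H0 _ good.empty]) (use T agr in auto)
  moreover have "{H. \<not> ok l r k N H ({} \<union> expl k d N H b T)} \<inter> agreeing k d N {} H0
      = {H\<in>hypers k d N. \<not> ok l r k N H (expl k d N H b T)}" using agr by auto
  ultimately show ?thesis
    unfolding agr failure_bound_def Let_def p_def[symmetric] by (simp add: touching_def)
qed simp

section \<open>Chernoff bound and union over the assignments\<close>

lemma one_minus_exp_ge:
  fixes x :: real
  assumes "0 \<le> x"
  shows "x - x\<^sup>2 \<le> 1 - exp (- x)"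
proof -
  have e: "1 + x \<le> exp x" by (rule exp_ge_add_one_self)
  have "exp (- x) = 1 / exp x" by (simp add: exp_minus divide_inverse)
  also have "\<dots> \<le> 1 / (1 + x)" using e assms by (intro divide_left_mono) auto
  also have "\<dots> \<le> 1 - x + x\<^sup>2"
  proof -
    have "1 \<le> (1 - x + x\<^sup>2) * (1 + x)" using assms by (simp add: algebra_simps power2_eq_square)
    then show ?thesis using assms by (simp add: divide_le_eq)
  qed
  finally show ?thesis by simp
qed

definition violated :: "nat \<Rightarrow> nat \<Rightarrow> nat \<Rightarrow> predicate \<Rightarrow> hyper \<Rightarrow> (nat \<Rightarrow> bool) \<Rightarrow> (edge \<Rightarrow> bool list) \<Rightarrow> edge set" where
  "violated k d N Q H a b = {e\<in>{..<d} \<times> {..<N}. mask k (vtx N H e) a (b e) \<notin> ones k Q}"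

lemma card_lits: "card (lits k d N) = (2 ^ k) ^ (d * N)"
  by (simp add: lits_def card_PiE card_cube)

lemma finite_lits: "finite (lits k d N)"
  unfolding lits_def by (intro finite_PiE) (auto simp: finite_cube)

lemma zeros_density_le: "real (card (zeros k Q)) / 2 ^ k \<le> 1"
proof -
  have "card (zeros k Q) \<le> card (cube k)" by (intro card_mono finite_cube) (auto simp: zeros_def)
  then have "real (card (zeros k Q)) \<le> real (2 ^ k)" unfolding card_cube by (rule of_nat_mono)
  then show ?thesis by (simp add: divide_le_eq)
qed

text \<open>For a fixed assignment the masked literals are independent and uniform, so each edge is
  violated with probability \<open>z\<close>. The bound is Markov's inequality for the exponential
  of \<open>- t\<close> times the number of violated edges.\<close>

lemma card_few_violated:
  fixes k :: nat and Q :: predicate and \<epsilon> :: real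
  defines "z \<equiv> real (card (zeros k Q)) / 2 ^ k"
  assumes eps: "0 < \<epsilon>" "\<epsilon> < z"
  shows "card {b\<in>lits k d N. real (card (violated k d N Q H a b)) < (z - \<epsilon> / 2) * (d * N)}
    \<le> exp (- (\<epsilon>\<^sup>2 * (d * N) / 16)) * card (lits k d N)"
proof -
  let ?A = "{..<d} \<times> {..<N}"
  \<comment> \<open>This value minimises \<open>t\<^sup>2 - t * \<epsilon> / 2\<close>, the exponent
    per edge that is left after \<open>z \<le> 1\<close>; the minimum is
    \<open>- \<epsilon>\<^sup>2 / 16\<close>.\<close>
  define t where "t = \<epsilon> / 4"
  define \<tau> where "\<tau> = (z - \<epsilon> / 2) * (d * N)"
  have z1: "z \<le> 1" unfolding z_def by (rule zeros_density_le)
  have t: "0 < t" using eps by (simp add: t_def)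
  let ?u = "\<lambda>y. if y \<in> ones k Q then 1 else exp (- t)"
  have one: "(\<Sum>y\<in>cube k. ?u (mask k w a y)) = 2 ^ k * (1 - z * (1 - exp (- t)))" for w
  proof -
    have "(\<Sum>y\<in>cube k. ?u (mask k w a y)) = (\<Sum>y\<in>cube k. ?u y)"
      by (rule sum.reindex_bij_witness[of _ "mask k w a" "mask k w a"])
        (auto simp: mask_def cube_def intro!: nth_equalityI)
    also have "\<dots> = (\<Sum>y\<in>cube k. 1 - of_bool (y \<in> zeros k Q) * (1 - exp (- t)))"
      by (intro sum.cong) (auto simp: ones_def zeros_def)
    also have "\<dots> = 2 ^ k - card (zeros k Q) * (1 - exp (- t))"
    proof -
      have "cube k \<inter> zeros k Q = zeros k Q" by (auto simp: zeros_def)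
      then show ?thesis using finite_cube[of k]
        by (simp add: sum_subtractf card_cube sum_distrib_right[symmetric] Int_def[symmetric])
    qed
    also have "real (card (zeros k Q)) = z * 2 ^ k" by (simp add: z_def)
    finally show ?thesis by (simp add: algebra_simps)
  qed
  have vio: "exp (- t * card (violated k d N Q H a b)) = (\<Prod>e\<in>?A. ?u (mask k (vtx N H e) a (b e)))" for b
  proof -
    have "(\<Prod>e\<in>?A. ?u (mask k (vtx N H e) a (b e))) = exp (- t) ^ card (?A \<inter> - {e. mask k (vtx N H e) a (b e) \<in> ones k Q})"
      by (simp add: prod.If_cases)
    also have "?A \<inter> - {e. mask k (vtx N H e) a (b e) \<in> ones k Q} = violated k d N Q H a b"
      by (auto simp: violated_def)
    finally show ?thesis by (simp add: exp_of_nat_mult[symmetric] mult.commute)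
  qed
  have "real (card {b\<in>lits k d N. real (card (violated k d N Q H a b)) < \<tau>})
      = (\<Sum>b\<in>lits k d N. of_bool (real (card (violated k d N Q H a b)) < \<tau>))"
    using finite_lits by (simp add: Int_def)
  also have "\<dots> \<le> (\<Sum>b\<in>lits k d N. exp (t * \<tau>) * exp (- t * card (violated k d N Q H a b)))"
    using t by (intro sum_mono) (auto simp: exp_add[symmetric] algebra_simps)
  also have "\<dots> = exp (t * \<tau>) * (\<Sum>b\<in>lits k d N. \<Prod>e\<in>?A. ?u (mask k (vtx N H e) a (b e)))"
    by (simp only: vio sum_distrib_left)
  also have "(\<Sum>b\<in>lits k d N. \<Prod>e\<in>?A. ?u (mask k (vtx N H e) a (b e)))
      = (\<Prod>e\<in>?A. \<Sum>y\<in>cube k. ?u (mask k (vtx N H e) a y))"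
    unfolding lits_def by (rule prod_sum_PiE[symmetric]) (auto simp: finite_cube)
  also have "\<dots> = card (lits k d N) * (1 - z * (1 - exp (- t))) ^ (d * N)"
    by (simp add: one card_lits power_mult_distrib)
  also have "exp (t * \<tau>) * (card (lits k d N) * (1 - z * (1 - exp (- t))) ^ (d * N))
      \<le> exp (t * \<tau>) * (card (lits k d N) * exp (- z * (t - t\<^sup>2)) ^ (d * N))"
  proof (intro mult_left_mono power_mono)
    have "z * (t - t\<^sup>2) \<le> z * (1 - exp (- t))"
      using one_minus_exp_ge[of t] t eps by (intro mult_left_mono) auto
    moreover have "1 + - (z * (1 - exp (- t))) \<le> exp (- (z * (1 - exp (- t))))" by (rule exp_ge_add_one_self)
    moreover have "exp (- (z * (1 - exp (- t)))) \<le> exp (- z * (t - t\<^sup>2))" using calculation(1) by simp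
    ultimately show "1 - z * (1 - exp (- t)) \<le> exp (- z * (t - t\<^sup>2))" by linarith
    have "z * (1 - exp (- t)) \<le> 1 * 1" using z1 eps t by (intro mult_mono) auto
    then show "0 \<le> 1 - z * (1 - exp (- t))" by simp
  qed auto
  also have "\<dots> = exp (t * \<tau> + (d * N) * (- z * (t - t\<^sup>2))) * card (lits k d N)"
    by (simp add: exp_of_nat_mult[symmetric] exp_add exp_diff exp_minus field_simps)
  also have "\<dots> \<le> exp (- (\<epsilon>\<^sup>2 * (d * N) / 16)) * card (lits k d N)"
  proof (intro mult_right_mono)
    have "t * \<tau> + (d * N) * (- z * (t - t\<^sup>2)) = (d * N) * (z * t\<^sup>2 - t * \<epsilon> / 2)"
      by (simp add: \<tau>_def algebra_simps power2_eq_square)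
    also have "\<dots> \<le> (d * N) * (1 * t\<^sup>2 - t * \<epsilon> / 2)"
      using z1 by (intro mult_left_mono diff_right_mono mult_right_mono) auto
    also have "\<dots> = - (\<epsilon>\<^sup>2 * (d * N) / 16)"
      by (simp add: t_def power2_eq_square algebra_simps)
    finally show "exp (t * \<tau> + (d * N) * (- z * (t - t\<^sup>2))) \<le> exp (- (\<epsilon>\<^sup>2 * (d * N) / 16))" by simp
  qed auto
  finally show ?thesis by (simp add: \<tau>_def)
qed

lemma mask_restrict:
  assumes H: "H \<in> hypers k d N" and e: "e \<in> {..<d} \<times> {..<N}"
  shows "mask k (vtx N H e) (restrict a {..<k * N}) y = mask k (vtx N H e) a y"
  using vtx_bounds(3)[OF H e] by (auto simp: mask_def)

lemma sat_con: "sat_constraint Q a (con k N H b e) \<longleftrightarrow> Q (mask k (vtx N H e) a (b e))"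
  by (simp add: sat_constraint_def con_def mask_def o_def)

text \<open>The removed constraints include all those violated by the assignment that satisfies the
  rest. Restricting it to the first \<open>k * N\<close> variables, the only ones that occur, leaves
  finitely many assignments for the union bound.\<close>

lemma far_or_few_violated:
  fixes \<epsilon>' :: real
  assumes H: "H \<in> hypers k d N" and nf: "\<not> far_from_sat Q k d n \<epsilon>' (inst k d N H b)"
  shows "\<exists>a\<in>PiE {..<k * N} (\<lambda>_. UNIV). real (card (violated k d N Q H a b)) < \<epsilon>' * real d * real n / real k"
proof -
  let ?I = "inst k d N H b"
  obtain R where R: "R \<subseteq> {..<length (constraints ?I)}" "satisfiable_without Q ?I R"
    "real (card R) < \<epsilon>' * real d * real n / real k" using nf by (auto simp: far_from_sat_def not_le)
  have len: "length (constraints ?I) = d * N" by (simp add: inst_def)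
  have finR: "finite R" using R(1) finite_subset by blast
  obtain a where a: "\<And>p. p < d * N \<Longrightarrow> p \<notin> R \<Longrightarrow> sat_constraint Q a (con k N H b (p div N, p mod N))"
    using R(2) unfolding satisfiable_without_def len by (auto simp: inst_def)
  let ?a = "restrict a {..<k * N}"
  have "violated k d N Q H ?a b \<subseteq> (\<lambda>p. (p div N, p mod N)) ` R"
  proof
    fix e assume e: "e \<in> violated k d N Q H ?a b"
    then have eA: "e \<in> {..<d} \<times> {..<N}" by (simp add: violated_def)
    obtain i t where it: "e = (i, t)" "i < d" "t < N" using eA by auto
    let ?p = "i * N + t"
    have p: "?p < d * N" "(?p div N, ?p mod N) = e" using it pos_less[OF it(2,3)] by auto
    have "?p \<in> R"
    proof (rule ccontr)
      assume "?p \<notin> R"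
      then have "Q (mask k (vtx N H e) a (b e))" using a[OF p(1)] unfolding p(2) sat_con by blast
      then have "mask k (vtx N H e) ?a (b e) \<in> ones k Q"
        unfolding mask_restrict[OF H eA] ones_def by (simp add: mask_cube)
      then show False using e by (simp add: violated_def)
    qed
    then show "e \<in> (\<lambda>p. (p div N, p mod N)) ` R" by (intro image_eqI[of _ _ ?p]) (simp_all add: p(2)[symmetric] del: div_mult_self4)
  qed
  then have "card (violated k d N Q H ?a b) \<le> card R"
    using finR by (meson card_image_le card_mono finite_imageI le_trans)
  then have "real (card (violated k d N Q H ?a b)) < \<epsilon>' * real d * real n / real k" using R(3) by linarith
  then show ?thesis by (intro bexI[of _ ?a]) auto
qed

text \<open>Union bound over \<open>2 ^ (k * N)\<close> assignments. The hypothesis on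
  \<open>d\<close> makes the Chernoff exponent at least \<open>(k + 1) * N\<close>, which beats
  their number and leaves \<open>exp (- real N)\<close>; this is what dictates the size of the
  degree.\<close>

lemma card_not_far:
  fixes k :: nat and Q :: predicate and \<epsilon> :: real
  defines "z \<equiv> real (card (zeros k Q)) / 2 ^ k"
  assumes eps: "0 < \<epsilon>" "\<epsilon> < z" and d: "16 * (real k + 1) \<le> \<epsilon>\<^sup>2 * real d" and k: "0 < k"
    and N: "2 \<le> \<epsilon> * real N" "n < k * (N + 1)" and H: "H \<in> hypers k d N"
  shows "card {b\<in>lits k d N. \<not> far_from_sat Q k d n (z - \<epsilon>) (inst k d N H b)} \<le> exp (- real N) * card (lits k d N)"
proof -
  let ?A = "PiE {..<k * N} (\<lambda>_. UNIV :: bool set)"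
  let ?few = "\<lambda>a. {b\<in>lits k d N. real (card (violated k d N Q H a b)) < (z - \<epsilon> / 2) * (d * N)}"
  have z1: "z \<le> 1" unfolding z_def by (rule zeros_density_le)
  \<comment> \<open>Farness is measured with \<open>n / k\<close>, which may exceed \<open>N\<close>
    by less than one. Half of \<open>\<epsilon>\<close> pays for the difference, by
    \<open>2 \<le> \<epsilon> * real N\<close>.\<close>
  have thr: "(z - \<epsilon>) * real d * real n / real k \<le> (z - \<epsilon> / 2) * (d * N)"
  proof -
    have "real n \<le> real (k * (N + 1))" using N(2) by (intro of_nat_mono) simp
    then have "real n / real k \<le> real N + 1" using k by (simp add: divide_le_eq algebra_simps)
    then have "(z - \<epsilon>) * real d * (real n / real k) \<le> (z - \<epsilon>) * real d * (real N + 1)"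
      using eps by (intro mult_left_mono) auto
    also have "\<dots> = real d * ((z - \<epsilon>) * (real N + 1))" by simp
    also have "\<dots> \<le> real d * ((z - \<epsilon> / 2) * real N)"
    proof (rule mult_left_mono)
      have "(z - \<epsilon>) * (real N + 1) = (z - \<epsilon> / 2) * real N + (z - \<epsilon> - \<epsilon> * real N / 2)" by (simp add: algebra_simps)
      then show "(z - \<epsilon>) * (real N + 1) \<le> (z - \<epsilon> / 2) * real N" using N(1) z1 eps by linarith
    qed simp
    also have "\<dots> = (z - \<epsilon> / 2) * (d * N)" by simp
    finally show ?thesis by simp
  qed
  have sub: "{b\<in>lits k d N. \<not> far_from_sat Q k d n (z - \<epsilon>) (inst k d N H b)} \<subseteq> (\<Union>a\<in>?A. ?few a)"
  proof
    fix b assume b: "b \<in> {b\<in>lits k d N. \<not> far_from_sat Q k d n (z - \<epsilon>) (inst k d N H b)}"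
    then obtain a where a: "a \<in> ?A" "real (card (violated k d N Q H a b)) < (z - \<epsilon>) * real d * real n / real k"
      using far_or_few_violated[OF H, of Q n "z - \<epsilon>" b] by auto
    then have "b \<in> ?few a" using b thr by simp
    then show "b \<in> (\<Union>a\<in>?A. ?few a)" using a(1) by blast
  qed
  have finA: "finite ?A" by (intro finite_PiE) auto
  have cA: "card ?A = 2 ^ (k * N)" by (simp add: card_PiE)
  have "card {b\<in>lits k d N. \<not> far_from_sat Q k d n (z - \<epsilon>) (inst k d N H b)} \<le> card (\<Union>a\<in>?A. ?few a)"
    using sub finA finite_lits by (intro card_mono) auto
  also have "\<dots> \<le> (\<Sum>a\<in>?A. card (?few a))" by (rule card_UN_le[OF finA])
  finally have "real (card {b\<in>lits k d N. \<not> far_from_sat Q k d n (z - \<epsilon>) (inst k d N H b)}) \<le> (\<Sum>a\<in>?A. real (card (?few a)))"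
    using of_nat_mono by fastforce
  also have "\<dots> \<le> (\<Sum>a\<in>?A. exp (- (\<epsilon>\<^sup>2 * (d * N) / 16)) * card (lits k d N))"
    using card_few_violated[of \<epsilon> k Q d N H] eps by (intro sum_mono) (simp add: z_def)
  also have "\<dots> = 2 ^ (k * N) * exp (- (\<epsilon>\<^sup>2 * (d * N) / 16)) * card (lits k d N)" by (simp add: cA)
  also have "\<dots> \<le> exp (- real N) * card (lits k d N)"
  proof (rule mult_right_mono)
    have "(2::real) \<le> exp 1" using exp_ge_add_one_self[of 1] by simp
    then have "(2::real) ^ (k * N) \<le> exp 1 ^ (k * N)" by (intro power_mono) auto
    also have "\<dots> = exp (real k * real N)" by (simp add: exp_of_nat_mult[symmetric])
    finally have "2 ^ (k * N) * exp (- (\<epsilon>\<^sup>2 * (d * N) / 16)) \<le> exp (real k * real N) * exp (- (\<epsilon>\<^sup>2 * (d * N) / 16))"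
      by (intro mult_right_mono) auto
    also have "\<dots> = exp (real k * real N - \<epsilon>\<^sup>2 * (d * N) / 16)" by (simp add: exp_add[symmetric])
    also have "\<dots> \<le> exp (- real N)"
    proof -
      have "(16 * (real k + 1)) * real N \<le> (\<epsilon>\<^sup>2 * real d) * real N" using d by (intro mult_right_mono) auto
      then show ?thesis by (simp add: algebra_simps)
    qed
    finally show "2 ^ (k * N) * exp (- (\<epsilon>\<^sup>2 * (d * N) / 16)) \<le> exp (- real N)" .
  qed simp
  finally show ?thesis .
qed

lemma planted_close:
  assumes A: "A \<subseteq> ones k Q" and ne: "(\<Prod>e\<in>{..<d} \<times> {..<N}. dens k A (mask k (vtx N H e) a (b e))) \<noteq> 0"
  shows "close_to_sat Q k d n 0 (inst k d N H b)"
proof -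
  have "Q (mask k (vtx N H e) a (b e))" if "e \<in> {..<d} \<times> {..<N}" for e
  proof -
    have "dens k A (mask k (vtx N H e) a (b e)) \<noteq> 0" using ne that by (auto simp: prod_zero_iff)
    then have "mask k (vtx N H e) a (b e) \<in> A" by (auto simp: dens_def split: if_splits)
    then show ?thesis using A by (auto simp: ones_def)
  qed
  then have "satisfiable_without Q (inst k d N H b) {}"
    unfolding satisfiable_without_def using pos_edge by (intro exI[of _ a]) (auto simp: inst_def sat_con)
  then show ?thesis unfolding close_to_sat_def by (intro exI[of _ "{}"]) auto
qed

text \<open>The passage from deterministic to randomized algorithms: an inequality linear in the
  indicators survives averaging over the trees, whatever the signs of \<open>w\<close>.\<close>

lemma sum_prob_ge:
  fixes w :: "'i \<Rightarrow> real" and T :: "'t pmf"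
  assumes "finite I" and "\<And>t. t \<in> set_pmf T \<Longrightarrow> c \<le> (\<Sum>i\<in>I. w i * of_bool (P i t))"
  shows "c \<le> (\<Sum>i\<in>I. w i * measure_pmf.prob T {t. P i t})"
proof -
  have int: "integrable (measure_pmf T) (\<lambda>t. of_bool (P i t) :: real)" for i
    by (rule measure_pmf.integrable_const_bound[of _ 1]) auto
  have e: "measure_pmf.expectation T (\<lambda>t. of_bool (P i t)) = measure_pmf.prob T {t. P i t}" for i
  proof -
    have "(\<lambda>t. of_bool (P i t) :: real) = indicator {t. P i t}" by (auto simp: indicator_def)
    then show ?thesis by simp
  qed
  have "c \<le> measure_pmf.expectation T (\<lambda>t. \<Sum>i\<in>I. w i * of_bool (P i t))"
  proof (rule measure_pmf.integral_ge_const)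
    show "integrable (measure_pmf T) (\<lambda>t. \<Sum>i\<in>I. w i * of_bool (P i t))"
      by (intro Bochner_Integration.integrable_sum integrable_mult_right int)
    show "AE t in measure_pmf T. c \<le> (\<Sum>i\<in>I. w i * of_bool (P i t))"
      unfolding AE_measure_pmf_iff using assms(2) by blast
  qed
  also have "\<dots> = (\<Sum>i\<in>I. w i * measure_pmf.prob T {t. P i t})"
    using int by (subst Bochner_Integration.integral_sum) (simp_all add: e del: sum_mult_of_bool_eq)
  finally show ?thesis .
qed

section \<open>A tester on planted and on uniform literals\<close>

lemma hypers_nonempty: "hypers k d N \<noteq> {}"
  unfolding hypers_def PiE_eq_empty_iff using permutes_id by blast

text \<open>Planted instances are satisfiable, hence rejected with probability at most 1/3. Uniform
  ones are far up to a fraction \<open>exp (- real N)\<close>, hence mostly rejected with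
  probability at least 2/3. Up to the exploration failure \<open>\<eta>\<close>, planted rejections
  amount to at least \<open>1 - s\<close> times the uniform ones. Small errors make the conclusion
  absurd.\<close>

lemma tester_inequality:
  fixes Q :: predicate and \<epsilon> s \<eta> :: real and T :: "dtree pmf"
  assumes k: "3 \<le> k" and A: "A \<subseteq> ones k Q" "A \<noteq> {}" "\<And>y. y \<in> A \<Longrightarrow> map Not y \<in> A"
    and rho: "0 \<le> \<rho>" "\<rho> \<le> 1" "\<And>S. S \<subseteq> {..<k} \<Longrightarrow> S \<noteq> {} \<Longrightarrow> S \<noteq> {..<k} \<Longrightarrow> \<bar>coef A S\<bar> \<le> \<rho>"
    and lk: "k \<le> l" and s: "(1 + 2 ^ k * \<rho> ^ (l - k)) ^ r \<le> 1 + s" "s \<le> 1"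
    and q: "q < N" and r: "1 \<le> r" and n: "k * N \<le> n" "n < k * (N + 1)"
  defines "z \<equiv> real (card (zeros k Q)) / 2 ^ k"
  assumes eta: "failure_bound k d N l r q \<le> \<eta>"
    and eps: "0 < \<epsilon>" "\<epsilon> < z" and d: "16 * (real k + 1) \<le> \<epsilon>\<^sup>2 * real d" and N: "2 \<le> \<epsilon> * real N"
    and T: "tester Q k d n (z - \<epsilon>) T" "query_complexity_le k d n T q"
  shows "(1 - s) * (2 / 3 * (1 - exp (- real N)) - \<eta>) \<le> 1 / 3"
proof -
  let ?Hs = "hypers k d N" and ?Bs = "lits k d N" and ?As = "PiE {..<k * N} (\<lambda>_. UNIV :: bool set)"
  let ?All = "{..<d} \<times> {..<N}"
  have Ac: "A \<subseteq> cube k" using A(1) by (auto simp: ones_def)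
  define D where "D H b a = (\<Prod>e\<in>?All. dens k A (mask k (vtx N H e) a (b e)))" for H :: hyper and b a
  define K where "K = 2 ^ (k * N) * (1 - s)"
  have K0: "0 \<le> K" using s by (simp add: K_def)
  define P where "P H b = measure_pmf.prob T {t. \<not> run (orc k d N H b) t}" for H b
  have sumD: "(\<Sum>b\<in>?Bs. D H b a) = card ?Bs" for H a
  proof -
    have "(\<Sum>b\<in>?Bs. D H b a) = (\<Prod>e\<in>?All. \<Sum>y\<in>cube k. dens k A (mask k (vtx N H e) a y))"
      unfolding D_def lits_def by (rule prod_sum_PiE[symmetric]) (auto simp: finite_cube)
    also have "\<dots> = card ?Bs" by (simp add: sum_dens_mask[OF Ac A(2)] card_lits card_cube)
    finally show ?thesis .
  qed
  have D0: "0 \<le> D H b a" for H b a unfolding D_def by (intro prod_nonneg) (auto simp: dens_def)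
  have orc_eq: "csp_oracle n (inst k d N H b) = orc k d N H b" if "H \<in> ?Hs" for H b
    by (rule csp_oracle_inst[OF that n(1)])
  have inst: "inst k d N H b \<in> csp_instances k d n" if "H \<in> ?Hs" for H b
    by (rule inst_in_csp_instances[OF that n(1)])
  have P01: "0 \<le> P H b" "P H b \<le> 1" for H b by (auto simp: P_def)
  have yes: "D H b a * P H b \<le> D H b a * (1 / 3)" if H: "H \<in> ?Hs" for H b a
  proof (cases "D H b a = 0")
    case False
    then have "close_to_sat Q k d n 0 (inst k d N H b)" unfolding D_def by (rule planted_close[OF A(1)])
    then have acc: "2 / 3 \<le> measure_pmf.prob T {t. run (orc k d N H b) t}"
      using T(1) inst[OF H, of b] orc_eq[OF H, of b] unfolding tester_def tester2_def by metis
    have "P H b = 1 - measure_pmf.prob T {t. run (orc k d N H b) t}"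
      unfolding P_def using measure_pmf.prob_compl[of "{t. run (orc k d N H b) t}" T]
      by (simp add: Compl_eq_Diff_UNIV[symmetric] Collect_neg_eq)
    then show ?thesis using acc D0 by (intro mult_left_mono) auto
  qed simp
  have far: "2 / 3 * (1 - exp (- real N)) * card ?Bs \<le> (\<Sum>b\<in>?Bs. P H b)" if H: "H \<in> ?Hs" for H
  proof -
    let ?F = "\<lambda>b. far_from_sat Q k d n (z - \<epsilon>) (inst k d N H b)"
    have c: "real (card {b\<in>?Bs. \<not> ?F b}) \<le> exp (- real N) * card ?Bs"
      unfolding z_def using k eps(2) by (intro card_not_far[OF eps(1) _ d _ N n(2) H]) (auto simp: z_def)
    have "(1 - exp (- real N)) * card ?Bs \<le> real (card ?Bs) - real (card {b\<in>?Bs. \<not> ?F b})"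
      using c by (simp add: left_diff_distrib)
    then have "2 / 3 * (1 - exp (- real N)) * card ?Bs \<le> 2 / 3 * (real (card ?Bs) - real (card {b\<in>?Bs. \<not> ?F b}))"
      by (simp only: mult.assoc) (intro mult_left_mono, simp_all)
    also have "\<dots> = (\<Sum>b\<in>?Bs. 2 / 3 * (1 - of_bool (\<not> ?F b)))"
    proof -
      have "(\<Sum>b\<in>?Bs. of_bool (\<not> ?F b)) = real (card {b\<in>?Bs. \<not> ?F b})"
        using finite_lits by (simp add: Int_def del: of_bool_not_iff)
      then show ?thesis by (simp only: sum_distrib_left[symmetric] sum_subtractf) simp
    qed
    also have "\<dots> \<le> (\<Sum>b\<in>?Bs. P H b)"
    proof (rule sum_mono)
      fix b
      have "2 / 3 \<le> P H b" if "?F b"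
        using T(1) inst[OF H, of b] orc_eq[OF H, of b] that unfolding tester_def tester2_def P_def by metis
      then show "2 / 3 * (1 - of_bool (\<not> ?F b)) \<le> P H b" using P01 by auto
    qed
    finally show ?thesis .
  qed
  \<comment> \<open>One signed sum holds both sides of the comparison, as \<open>sum_prob_ge\<close>
    requires. The likelihood bound fixes \<open>H\<close> and sums over \<open>b\<close>, the
    exploration bound fixes \<open>b\<close> and sums over \<open>H\<close>; the two are joined by
    exchanging the sums.\<close>
  have tree: "- (K * \<eta> * (card ?Hs * card ?Bs)) \<le>
      (\<Sum>(H, b)\<in>?Hs \<times> ?Bs. ((\<Sum>a\<in>?As. D H b a) - K) * of_bool (\<not> run (orc k d N H b) t))"
    if t: "t \<in> set_pmf T" for t
  proof -
    let ?rej = "\<lambda>H b. of_bool (\<not> run (orc k d N H b) t) :: real"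
    let ?bad = "\<lambda>H b. of_bool (\<not> ok l r k N H (expl k d N H b t)) :: real"
    have qt: "queries (orc k d N H b) t \<le> q" if "H \<in> ?Hs" for H b
      using T(2) inst[OF that, of b] t orc_eq[OF that, of b] unfolding query_complexity_le_def by metis
    have bad: "(\<Sum>H\<in>?Hs. ?bad H b) \<le> \<eta> * card ?Hs" for b
    proof -
      have "(\<Sum>H\<in>?Hs. ?bad H b) = real (card {H\<in>?Hs. \<not> ok l r k N H (expl k d N H b t)})"
        using finite_hypers by (simp add: Int_def del: of_bool_not_iff)
      also have "\<dots> \<le> failure_bound k d N l r q * card ?Hs"
        by (rule exploration_bound_initial[OF q r qt])
      also have "\<dots> \<le> \<eta> * card ?Hs" using eta by (intro mult_right_mono) auto
      finally show ?thesis .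
    qed
    have "(\<Sum>H\<in>?Hs. \<Sum>b\<in>?Bs. (\<Sum>a\<in>?As. D H b a) * ?rej H b) \<ge> (\<Sum>H\<in>?Hs. K * (\<Sum>b\<in>?Bs. ?rej H b - ?bad H b))"
    proof (rule sum_mono)
      fix H assume H: "H \<in> ?Hs"
      have "K * (\<Sum>b\<in>?Bs. ?rej H b - ?bad H b) \<le> K * (\<Sum>b\<in>?Bs. of_bool (\<not> run (orc k d N H b) t \<and> ok l r k N H (expl k d N H b t)))"
        using K0 by (intro mult_left_mono sum_mono) auto
      also have "\<dots> \<le> (\<Sum>b\<in>?Bs. \<Sum>a\<in>?As. ?rej H b * D H b a)"
        unfolding K_def D_def by (rule planted_rejection_ge[OF k Ac A(2,3) rho H lk s])
      also have "\<dots> = (\<Sum>b\<in>?Bs. (\<Sum>a\<in>?As. D H b a) * ?rej H b)"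
        unfolding sum_distrib_right by (intro sum.cong refl mult.commute)
      finally show "K * (\<Sum>b\<in>?Bs. ?rej H b - ?bad H b) \<le> (\<Sum>b\<in>?Bs. (\<Sum>a\<in>?As. D H b a) * ?rej H b)" .
    qed
    moreover have "(\<Sum>H\<in>?Hs. K * (\<Sum>b\<in>?Bs. ?rej H b - ?bad H b))
        = (\<Sum>H\<in>?Hs. \<Sum>b\<in>?Bs. K * ?rej H b) - K * (\<Sum>b\<in>?Bs. \<Sum>H\<in>?Hs. ?bad H b)"
      by (simp only: sum_subtractf right_diff_distrib sum_distrib_left sum.swap[of _ ?Bs ?Hs])
    moreover have "K * (\<Sum>b\<in>?Bs. \<Sum>H\<in>?Hs. ?bad H b) \<le> K * (\<Sum>b\<in>?Bs. \<eta> * card ?Hs)"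
      using bad K0 by (intro mult_left_mono sum_mono) auto
    ultimately have "(\<Sum>H\<in>?Hs. \<Sum>b\<in>?Bs. K * ?rej H b) - K * (\<Sum>b\<in>?Bs. \<eta> * card ?Hs)
        \<le> (\<Sum>H\<in>?Hs. \<Sum>b\<in>?Bs. (\<Sum>a\<in>?As. D H b a) * ?rej H b)" by linarith
    moreover have "K * (\<Sum>b\<in>?Bs. \<eta> * card ?Hs) = K * \<eta> * (card ?Hs * card ?Bs)" by simp
    ultimately show ?thesis
      unfolding sum.cartesian_product[symmetric] left_diff_distrib sum_subtractf by linarith
  qed
  have fin: "finite (?Hs \<times> ?Bs)" using finite_hypers finite_lits by blast
  have "- (K * \<eta> * (card ?Hs * card ?Bs)) \<le>
      (\<Sum>i\<in>?Hs \<times> ?Bs. ((\<Sum>a\<in>?As. D (fst i) (snd i) a) - K) * measure_pmf.prob T {t. \<not> run (orc k d N (fst i) (snd i)) t})"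
    by (rule sum_prob_ge[OF fin]) (use tree in \<open>simp add: case_prod_unfold\<close>)
  also have "\<dots> = (\<Sum>H\<in>?Hs. \<Sum>b\<in>?Bs. \<Sum>a\<in>?As. D H b a * P H b) - K * (\<Sum>H\<in>?Hs. \<Sum>b\<in>?Bs. P H b)"
  proof -
    have "(\<Sum>i\<in>?Hs \<times> ?Bs. ((\<Sum>a\<in>?As. D (fst i) (snd i) a) - K) * P (fst i) (snd i))
        = (\<Sum>H\<in>?Hs. \<Sum>b\<in>?Bs. ((\<Sum>a\<in>?As. D H b a) - K) * P H b)"
      by (simp add: sum.cartesian_product case_prod_unfold)
    then show ?thesis
      by (simp only: P_def[symmetric] left_diff_distrib sum_subtractf sum_distrib_left sum_distrib_right)
  qed
  finally have 1: "- (K * \<eta> * (card ?Hs * card ?Bs)) \<le>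
      (\<Sum>H\<in>?Hs. \<Sum>b\<in>?Bs. \<Sum>a\<in>?As. D H b a * P H b) - K * (\<Sum>H\<in>?Hs. \<Sum>b\<in>?Bs. P H b)" .
  have "(\<Sum>H\<in>?Hs. \<Sum>b\<in>?Bs. \<Sum>a\<in>?As. D H b a * P H b) \<le> (\<Sum>H\<in>?Hs. \<Sum>b\<in>?Bs. \<Sum>a\<in>?As. D H b a * (1 / 3))"
    using yes by (intro sum_mono) auto
  also have "\<dots> = (\<Sum>H\<in>?Hs. \<Sum>a\<in>?As. (\<Sum>b\<in>?Bs. D H b a) * (1 / 3))"
    by (simp only: sum_distrib_right sum.swap[of _ ?As ?Bs])
  also have "\<dots> = 2 ^ (k * N) * (1 / 3) * (card ?Hs * card ?Bs)"
    by (simp add: sumD card_PiE)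
  finally have 2: "(\<Sum>H\<in>?Hs. \<Sum>b\<in>?Bs. \<Sum>a\<in>?As. D H b a * P H b) \<le> 2 ^ (k * N) * (1 / 3) * (card ?Hs * card ?Bs)" .
  have "K * (\<Sum>H\<in>?Hs. 2 / 3 * (1 - exp (- real N)) * card ?Bs) \<le> K * (\<Sum>H\<in>?Hs. \<Sum>b\<in>?Bs. P H b)"
    using far K0 by (intro mult_left_mono sum_mono) auto
  moreover have "K * (\<Sum>H\<in>?Hs. 2 / 3 * (1 - exp (- real N)) * card ?Bs)
      = K * (2 / 3 * (1 - exp (- real N))) * (card ?Hs * card ?Bs)" by simp
  ultimately have "K * (2 / 3 * (1 - exp (- real N))) * (card ?Hs * card ?Bs) - K * \<eta> * (card ?Hs * card ?Bs)
      \<le> 2 ^ (k * N) * (1 / 3) * (card ?Hs * card ?Bs)" using 1 2 by linarith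
  then have "K * (2 / 3 * (1 - exp (- real N)) - \<eta>) * (card ?Hs * card ?Bs) \<le> 2 ^ (k * N) * (1 / 3) * (card ?Hs * card ?Bs)"
    by (simp only: right_diff_distrib left_diff_distrib)
  moreover have "0 < real (card ?Hs * card ?Bs)"
    using hypers_nonempty finite_hypers card_lits by (simp add: card_gt_0_iff)
  ultimately have "K * (2 / 3 * (1 - exp (- real N)) - \<eta>) \<le> 2 ^ (k * N) * (1 / 3)"
    by (rule mult_right_le_imp_le)
  then have "2 ^ (k * N) * ((1 - s) * (2 / 3 * (1 - exp (- real N)) - \<eta>)) \<le> 2 ^ (k * N) * (1 / 3)"
    by (simp only: K_def mult.assoc)
  then show ?thesis by (rule mult_left_le_imp_le) simp
qed

section \<open>Choice of the parameters\<close>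

lemma hamming_weight_indicator:
  assumes "U \<subseteq> {..<k}"
  shows "hamming_weight (map (\<lambda>m. m \<in> U) [0..<k]) = card U"
proof -
  have "{i. i < k \<and> i \<in> U} = U" using assms by auto
  then show ?thesis
    by (simp add: hamming_weight_def count_list_eq_length_filter length_filter_conv_card cong: conj_cong)
qed

text \<open>Some accepted word is not constant; let \<open>w\<close> be its weight. For
  \<open>i\<close> in \<open>S\<close>, \<open>j\<close> outside \<open>S\<close> and a set
  \<open>U\<close> of \<open>w - 1\<close> other positions, \<open>insert i U\<close> and
  \<open>insert j U\<close> describe words of weight \<open>w\<close>, again accepted, whose
  parities on \<open>S\<close> differ.\<close>

lemma symmetric_pred_mixing:
  assumes k: "3 \<le> k" and P: "card (ones k P) > 0" "symmetric_pred k P" "\<exists>x\<in>cube k. P x \<noteq> EQU x"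
    and S: "S \<subseteq> {..<k}" "S \<noteq> {}" "S \<noteq> {..<k}"
  shows "\<exists>y\<in>ones k P. \<exists>z\<in>ones k P. (\<Prod>j\<in>S. sg (y ! j)) \<noteq> (\<Prod>j\<in>S. sg (z ! j))"
proof -
  have weight: "P x = P y" if "x \<in> cube k" "y \<in> cube k" "hamming_weight x = hamming_weight y" for x y
    using P(2) that unfolding symmetric_pred_def by blast
  have compl: "P x = P (map Not x)" if "x \<in> cube k" for x
    using P(2) that unfolding symmetric_pred_def by blast
  \<comment> \<open>Otherwise only constant words are accepted. One of them is, so by
    complementation the other is too, and \<open>P\<close> agrees with \<open>EQU\<close>.\<close>
  have "\<exists>x\<in>cube k. P x \<and> \<not> EQU x"
  proof (rule ccontr)
    assume "\<not> ?thesis"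
    then have all: "EQU x" if "x \<in> cube k" "P x" for x using that by blast
    then obtain x where x: "x \<in> cube k" "EQU x" "\<not> P x" using P(3) by blast
    obtain y where y: "y \<in> cube k" "P y" using P(1) by (auto simp: ones_def card_gt_0_iff)
    have const: "\<exists>c. u = replicate k c" if "u \<in> cube k" "EQU u" for u
    proof -
      have "u \<noteq> []" using that k by (auto simp: cube_def)
      then have "\<forall>a\<in>set u. a = hd u" using that(2) by (auto simp: EQU_def)
      then have "u = replicate (length u) (hd u)" using replicate_length_same[of u "hd u"] by auto
      then show ?thesis using that(1) by (auto simp: cube_def)
    qed
    obtain a c where "x = replicate k a" "y = replicate k c" using const x y all by meson
    then have "x = y \<or> x = map Not y" by (cases a; cases c) auto
    then show False using x y compl by auto
  qed
  then obtain x where x: "x \<in> cube k" "P x" "\<not> EQU x" by auto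
  define w where "w = hamming_weight x"
  have wc: "w = card {i. i < k \<and> x ! i}"
    using x(1) by (simp add: w_def hamming_weight_def count_list_eq_length_filter length_filter_conv_card cube_def)
  obtain a b where ab: "a < k" "x ! a" "b < k" "\<not> x ! b"
    using x(1,3) unfolding EQU_def cube_def by (auto simp: in_set_conv_nth) metis+
  have w: "1 \<le> w" "w \<le> k - 1"
  proof -
    have "{a} \<subseteq> {i. i < k \<and> x ! i}" using ab by auto
    then have "card {a} \<le> w" unfolding wc by (intro card_mono) auto
    then show "1 \<le> w" by simp
    have "{i. i < k \<and> x ! i} \<subseteq> {..<k} - {b}" using ab by auto
    then have "w \<le> card ({..<k} - {b})" unfolding wc by (intro card_mono) auto
    then show "w \<le> k - 1" using ab by simp
  qed
  obtain i where i: "i \<in> S" using S by auto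
  obtain j where j: "j < k" "j \<notin> S" using S by auto
  have ij: "i < k" "i \<noteq> j" using i j S by auto
  have "w - 1 \<le> card ({..<k} - {i, j})" using w ij j by (simp add: card_Diff_subset)
  then obtain U where U: "U \<subseteq> {..<k} - {i, j}" "card U = w - 1" "finite U"
    using obtain_subset_with_card_n by metis
  let ?y = "\<lambda>m. map (\<lambda>l. l \<in> insert m U) [0..<k]"
  have "P (?y m)" if m: "m = i \<or> m = j" for m
  proof -
    have "insert m U \<subseteq> {..<k}" using U m ij j by auto
    moreover have "m \<notin> U" using U m by auto
    ultimately have "hamming_weight (?y m) = w"
      using hamming_weight_indicator[of "insert m U" k] U w by simp
    then show ?thesis using weight[of x "?y m"] x by (simp add: w_def cube_def)
  qed
  then have mem: "?y i \<in> ones k P" "?y j \<in> ones k P" by (auto simp: ones_def cube_def)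
  have finS: "finite S" using S finite_subset by blast
  have "(\<Prod>m\<in>S. sg (?y i ! m)) = sg (?y i ! i) * (\<Prod>m\<in>S - {i}. sg (?y i ! m))"
    by (rule prod.remove[OF finS i])
  also have "(\<Prod>m\<in>S - {i}. sg (?y i ! m)) = (\<Prod>m\<in>S - {i}. sg (?y j ! m))"
    using j S by (intro prod.cong refl arg_cong[of _ _ sg]) (auto simp: subset_iff)
  also have "sg (?y i ! i) = - sg (?y j ! i)" using U ij by (auto simp: sg_def)
  also have "- sg (?y j ! i) * (\<Prod>m\<in>S - {i}. sg (?y j ! m)) = - (\<Prod>m\<in>S. sg (?y j ! m))"
    by (simp add: prod.remove[OF finS i])
  finally have "(\<Prod>m\<in>S. sg (?y i ! m)) = - (\<Prod>m\<in>S. sg (?y j ! m))" .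
  moreover have "\<bar>\<Prod>m\<in>S. sg (?y j ! m)\<bar> = 1" by (rule abs_prod_sg)
  ultimately have "(\<Prod>m\<in>S. sg (?y i ! m)) \<noteq> (\<Prod>m\<in>S. sg (?y j ! m))" by linarith
  then show ?thesis using mem by blast
qed

text \<open>Take \<open>l\<close> about \<open>\<kappa> * ln n\<close>; the choice of
  \<open>\<kappa>\<close> keeps the growth factor of balls of radius \<open>2 * l\<close> below
  \<open>n powr (1 / 8)\<close>. Take \<open>r\<close> about \<open>n powr (3 * \<delta>)\<close>,
  which exceeds the order \<open>n powr (2 * \<delta>)\<close> of the expected collisions by
  \<open>n powr \<delta>\<close>. The bound on \<open>\<delta>\<close> by \<open>\<kappa>\<close>
  makes \<open>r * \<rho> ^ l\<close> of order at most \<open>n powr (- \<delta>)\<close>, and 1/48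
  is a convenient value that keeps the exponents of all error terms at most
  \<open>- \<delta>\<close>.\<close>

lemma asymptotic_parameters:
  fixes k d :: nat and \<rho> \<delta> \<epsilon> \<kappa> :: real
  assumes k: "3 \<le> k" and d: "1 \<le> d" and rho: "0 < \<rho>" "\<rho> < 1" and eps: "0 < \<epsilon>"
    and kappa: "\<kappa> = 1 / (16 * ln (1 + real d * real k))"
    and delta: "0 < \<delta>" "\<delta> \<le> 1 / 48" "\<delta> \<le> \<kappa> * (- ln \<rho>) / 4"
  shows "\<forall>\<^sub>F n in sequentially. \<forall>q. real q \<le> real n powr (1 / 2 + \<delta>) \<longrightarrow>
    (\<exists>l r. k \<le> l \<and> q < n div k \<and> 1 \<le> r \<and> (1 + 2 ^ k * \<rho> ^ (l - k)) ^ r \<le> 1 + 1 / 10 \<and>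
       failure_bound k d (n div k) l r q \<le> 1 / 10 \<and> exp (- real (n div k)) \<le> 1 / 10 \<and> 2 \<le> \<epsilon> * real (n div k))"
proof -
  define lam where "lam = - ln \<rho>"
  have lam: "0 < lam" using rho by (simp add: lam_def)
  have dk: "1 < 1 + real d * real k" using d k by simp
  have kap: "0 < \<kappa>" using dk kappa by simp
  \<comment> \<open>The four coefficients belong to the estimates \<open>T1\<close> to
    \<open>T4\<close> of the failure bound. Besides \<open>2 ^ k\<close>, the constant
    \<open>c2\<close> absorbs the rounding of \<open>r\<close> and \<open>l\<close> and the loss of
    \<open>k\<close> in the exponent \<open>l - k\<close>.\<close>
  define c1 where "c1 = 4 * real k ^ 6 + 6 * real k ^ 3 + 4 * real d * real k ^ 4 + 2 * real k ^ 3"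
  define c2 where "c2 = 2 * 2 ^ k * exp (lam * (real k + 1))"
  have k0: "0 < real k" using k by simp
  have real_top: "filterlim real at_top sequentially" by (rule filterlim_real_sequentially)
  have pw: "(\<lambda>n. c * real n powr (- \<delta>)) \<longlonglongrightarrow> c * 0" for c
    by (intro tendsto_mult tendsto_const tendsto_neg_powr real_top) (use delta in auto)
  have ev1: "\<forall>\<^sub>F n in sequentially. c1 * real n powr (- \<delta>) < 1 / 10"
    using order_tendstoD(2)[OF pw[of c1], of "1/10"] by simp
  have ev2: "\<forall>\<^sub>F n in sequentially. c2 * real n powr (- \<delta>) < 1 / 20"
    using order_tendstoD(2)[OF pw[of c2], of "1/20"] by simp
  have ev3: "\<forall>\<^sub>F n in sequentially. \<kappa> * ln (real n) \<ge> real k + 1"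
    using kap by real_asymp
  \<comment> \<open>Since \<open>1 / 2 + \<delta> \<le> 3 / 4\<close>, the subtracted power
    dominates the number of queries, which gives a lower bound on \<open>N - q\<close> linear in
    \<open>n\<close>.\<close>
  have ev4: "\<forall>\<^sub>F n in sequentially. real n / real k - 1 - real n powr (3 / 4) \<ge> real n / (2 * real k)"
    using k0 by real_asymp
  have ev5: "\<forall>\<^sub>F n in sequentially. exp (- (real n / real k - 1)) \<le> 1 / 10"
    using k0 by real_asymp
  have ev6: "\<forall>\<^sub>F n in sequentially. 2 \<le> \<epsilon> * (real n / real k - 1)"
    using k0 eps by real_asymp
  have ev7: "\<forall>\<^sub>F n in sequentially. 1 \<le> n" by (rule eventually_ge_at_top)
  show ?thesis
    using ev1 ev2 ev3 ev4 ev5 ev6 ev7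
  proof eventually_elim
    case (elim n)
    define x where "x = real n"
    have x1: "1 \<le> x" using elim(7) by (simp add: x_def)
    have pm: "x powr a \<le> x powr b" if "a \<le> b" for a b using powr_mono[OF that x1] .
    have pw1: "1 \<le> x powr a" if "0 \<le> a" for a using ge_one_powr_ge_zero[OF x1 that] .
    define N where "N = n div k"
    have Nge: "x / real k - 1 \<le> real N"
    proof -
      have "n < k * (N + 1)" unfolding N_def using k by (metis dividend_less_times_div Suc_eq_plus1 mult_Suc_right add.commute gr0I not_numeral_le_zero)
      then have "real n \<le> real (k * (N + 1))" by (intro of_nat_mono) simp
      then have "x \<le> real k * (real N + 1)" by (simp add: x_def algebra_simps)
      then show ?thesis using k0 by (simp add: field_simps)
    qed
    define l where "l = nat \<lfloor>\<kappa> * ln x\<rfloor>"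
    have lnx: "0 \<le> \<kappa> * ln x" using x1 kap by simp
    have l_le: "real l \<le> \<kappa> * ln x" unfolding l_def using lnx by (simp add: of_nat_floor)
    have l_ge: "\<kappa> * ln x - 1 \<le> real l" unfolding l_def using lnx by linarith
    have lk: "k \<le> l"
    proof -
      have "real k \<le> real l" using l_ge elim(3) by (simp add: x_def)
      then show ?thesis by simp
    qed
    define r where "r = nat \<lceil>x powr (3 * \<delta>)\<rceil>"
    have r_ge: "x powr (3 * \<delta>) \<le> real r" unfolding r_def by (rule of_nat_ceiling)
    have x3: "1 \<le> x powr (3 * \<delta>)" by (rule pw1) (use delta in auto)
    have r1: "1 \<le> r" using r_ge x3 by linarith
    have r_le: "real r \<le> 2 * x powr (3 * \<delta>)" unfolding r_def using x3 by linarith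
    define B where "B = (1 + real d * real k) ^ (2 * l)"
    have B0: "0 \<le> B" by (simp add: B_def)
    have B_le: "B \<le> x powr (1 / 8)"
    proof -
      have "B = exp (ln (1 + real d * real k)) ^ (2 * l)" using dk by (simp add: B_def)
      also have "\<dots> = exp (2 * real l * ln (1 + real d * real k))" by (simp add: exp_of_nat_mult[symmetric])
      also have "\<dots> \<le> exp (2 * (\<kappa> * ln x) * ln (1 + real d * real k))"
        using l_le dk by (simp add: mult_right_mono)
      also have "2 * (\<kappa> * ln x) * ln (1 + real d * real k) = ln x / 8"
      proof -
        have "ln (1 + real d * real k) \<noteq> 0" using ln_gt_zero[OF dk] by simp
        then show ?thesis unfolding kappa by (simp del: ln_eq_zero_iff)
      qed
      also have "exp (ln x / 8) = x powr (1 / 8)" using x1 by (simp add: powr_def)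
      finally show ?thesis .
    qed
    have pow: "(1 + 2 ^ k * \<rho> ^ (l - k)) ^ r \<le> 1 + 1 / 10"
    proof -
      have "\<rho> ^ (l - k) = exp (- lam) ^ (l - k)" using rho by (simp add: lam_def)
      also have "\<dots> = exp (- lam * real (l - k))" by (simp add: exp_of_nat_mult[symmetric] mult.commute)
      also have "\<dots> \<le> exp (- lam * (\<kappa> * ln x - 1 - real k))"
        using l_ge lk lam by (simp add: of_nat_diff)
      also have "- lam * (\<kappa> * ln x - 1 - real k) = lam * (real k + 1) + (- (\<kappa> * lam)) * ln x" by (simp add: algebra_simps)
      also have "exp \<dots> = exp (lam * (real k + 1)) * x powr (- (\<kappa> * lam))" using x1 by (simp only: exp_add) (simp add: powr_def)
      finally have rl: "\<rho> ^ (l - k) \<le> exp (lam * (real k + 1)) * x powr (- (\<kappa> * lam))" .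
      have "real r * (2 ^ k * \<rho> ^ (l - k)) \<le> (2 * x powr (3 * \<delta>)) * (2 ^ k * (exp (lam * (real k + 1)) * x powr (- (\<kappa> * lam))))"
        using r_le rl rho by (intro mult_mono mult_left_mono) auto
      also have "\<dots> = c2 * x powr (3 * \<delta> - \<kappa> * lam)"
        using x1 by (simp add: c2_def powr_diff powr_minus field_simps)
      also have "\<dots> \<le> c2 * x powr (- \<delta>)"
        using delta(3) by (intro mult_left_mono pm) (auto simp: c2_def lam_def)
      also have "\<dots> \<le> 1 / 20" using elim(2) by (simp add: x_def)
      finally have small: "real r * (2 ^ k * \<rho> ^ (l - k)) \<le> 1 / 20" .
      have "(1 + 2 ^ k * \<rho> ^ (l - k)) ^ r \<le> exp (2 ^ k * \<rho> ^ (l - k)) ^ r"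
        using rho by (intro power_mono exp_ge_add_one_self add_nonneg_nonneg) auto
      also have "\<dots> = exp (real r * (2 ^ k * \<rho> ^ (l - k)))" by (simp add: exp_of_nat_mult)
      also have "\<dots> \<le> exp (1 / 20)" using small by simp
      also have "\<dots> \<le> 1 + 1 / 10"
      proof -
        have "1 + - (1 / 20) \<le> exp (- (1 / 20) :: real)" by (rule exp_ge_add_one_self)
        then have "exp (1 / 20) * (19 / 20) \<le> exp (1 / 20) * exp (- (1 / 20) :: real)" by (intro mult_left_mono) auto
        also have "\<dots> = 1" by (simp add: exp_minus)
        finally show ?thesis by simp
      qed
      finally show ?thesis .
    qed
    have main: "q < N \<and> failure_bound k d N l r q \<le> 1 / 10"
      if q: "real q \<le> real n powr (1 / 2 + \<delta>)" for q
    proof -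
      define p where p: "p = real k * (real k * real q) / (real N - real q)"
      have qx: "real q \<le> x powr (1 / 2 + \<delta>)" using q by (simp add: x_def)
      also have "\<dots> \<le> x powr (3 / 4)" by (rule pm) (use delta in auto)
      finally have Nq: "x / (2 * real k) \<le> real N - real q" using Nge elim(4) by (simp add: x_def)
      have pos: "0 < x / (2 * real k)" using x1 k0 by simp
      then have qN: "q < N" using Nq by linarith
      have inv: "1 / (real N - real q) \<le> 2 * real k * x powr (-1)"
      proof -
        have "1 / (real N - real q) \<le> 1 / (x / (2 * real k))"
          using Nq pos by (intro divide_left_mono mult_pos_pos) auto
        then show ?thesis using x1 by (simp add: powr_minus_divide)
      qed
      have inv0: "0 \<le> 1 / (real N - real q)" using Nq pos by simp
      have p0: "0 \<le> p" using inv0 unfolding p by simp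
      have pl: "p \<le> 2 * real k ^ 3 * x powr (\<delta> - 1 / 2)"
      proof -
        have "p = real k * real k * real q * (1 / (real N - real q))" by (simp add: p)
        also have "\<dots> \<le> real k * real k * x powr (1 / 2 + \<delta>) * (2 * real k * x powr (-1))"
          using qx inv inv0 by (intro mult_mono mult_left_mono) auto
        also have "\<dots> = 2 * real k ^ 3 * (x powr (1 / 2 + \<delta>) * x powr (-1))"
          by (simp add: power3_eq_cube)
        also have "x powr (1 / 2 + \<delta>) * x powr (-1) = x powr (\<delta> - 1 / 2)"
          by (simp only: powr_add[symmetric]) (rule arg_cong[of _ _ "(powr) x"], simp)
        finally show ?thesis .
      qed
      have T1: "real q * (p * p) \<le> 4 * real k ^ 6 * x powr (- \<delta>)"
      proof -
        have "real q * (p * p) \<le> x powr (1 / 2 + \<delta>) * ((2 * real k ^ 3 * x powr (\<delta> - 1 / 2)) * (2 * real k ^ 3 * x powr (\<delta> - 1 / 2)))"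
          using qx pl p0 by (intro mult_mono) auto
        also have "\<dots> = 4 * real k ^ 6 * (x powr (1 / 2 + \<delta>) * x powr (\<delta> - 1 / 2) * x powr (\<delta> - 1 / 2))"
          by (simp add: eval_nat_numeral)
        also have "x powr (1 / 2 + \<delta>) * x powr (\<delta> - 1 / 2) * x powr (\<delta> - 1 / 2) = x powr (3 * \<delta> - 1 / 2)"
          by (simp only: powr_add[symmetric]) (rule arg_cong[of _ _ "(powr) x"], simp)
        also have "4 * real k ^ 6 * \<dots> \<le> 4 * real k ^ 6 * x powr (- \<delta>)"
          using delta by (intro mult_left_mono pm) auto
        finally show ?thesis .
      qed
      have kr: "real k * real r + 1 \<le> 3 * real k * x powr (3 * \<delta>)"
      proof -
        have "real k * real r \<le> real k * (2 * x powr (3 * \<delta>))" using r_le k0 by (intro mult_left_mono) auto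
        moreover have "1 * 1 \<le> real k * x powr (3 * \<delta>)" using k x3 by (intro mult_mono) auto
        ultimately show ?thesis by simp
      qed
      have T2: "real q * (real k * ((real k * real r + 1) * B) * (1 / (real N - real q))) \<le> 6 * real k ^ 3 * x powr (- \<delta>)"
      proof -
        have "real q * (real k * ((real k * real r + 1) * B) * (1 / (real N - real q)))
            \<le> x powr (1 / 2 + \<delta>) * (real k * ((3 * real k * x powr (3 * \<delta>)) * x powr (1 / 8)) * (2 * real k * x powr (-1)))"
          using qx kr B_le B0 inv inv0 k0 by (intro mult_mono mult_nonneg_nonneg) auto
        also have "\<dots> = 6 * real k ^ 3 * (x powr (1 / 2 + \<delta>) * x powr (3 * \<delta>) * x powr (1 / 8) * x powr (-1))"
          by (simp add: power3_eq_cube)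
        also have "x powr (1 / 2 + \<delta>) * x powr (3 * \<delta>) * x powr (1 / 8) * x powr (-1) = x powr (4 * \<delta> - 3 / 8)"
          by (simp only: powr_add[symmetric]) (rule arg_cong[of _ _ "(powr) x"], simp)
        also have "6 * real k ^ 3 * \<dots> \<le> 6 * real k ^ 3 * x powr (- \<delta>)"
          using delta by (intro mult_left_mono pm) auto
        finally show ?thesis .
      qed
      have T3: "real d * (real k * real r * B) * p \<le> 4 * real d * real k ^ 4 * x powr (- \<delta>)"
      proof -
        have "real d * (real k * real r * B) * p
            \<le> real d * (real k * (2 * x powr (3 * \<delta>)) * x powr (1 / 8)) * (2 * real k ^ 3 * x powr (\<delta> - 1 / 2))"
          using r_le B_le B0 pl p0 k0 by (intro mult_mono mult_nonneg_nonneg) auto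
        also have "\<dots> = 4 * real d * real k ^ 4 * (x powr (3 * \<delta>) * x powr (1 / 8) * x powr (\<delta> - 1 / 2))"
          by (simp add: eval_nat_numeral)
        also have "x powr (3 * \<delta>) * x powr (1 / 8) * x powr (\<delta> - 1 / 2) = x powr (4 * \<delta> - 3 / 8)"
          by (simp only: powr_add[symmetric]) (rule arg_cong[of _ _ "(powr) x"], simp)
        also have "4 * real d * real k ^ 4 * \<dots> \<le> 4 * real d * real k ^ 4 * x powr (- \<delta>)"
          using delta by (intro mult_left_mono pm) auto
        finally show ?thesis .
      qed
      have T4: "real q * p / real r \<le> 2 * real k ^ 3 * x powr (- \<delta>)"
      proof -
        have "real q * p / real r \<le> x powr (1 / 2 + \<delta>) * (2 * real k ^ 3 * x powr (\<delta> - 1 / 2)) / x powr (3 * \<delta>)"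
          using qx pl p0 r_ge x1 by (intro frac_le mult_mono mult_nonneg_nonneg) auto
        also have "\<dots> = 2 * real k ^ 3 * (x powr (1 / 2 + \<delta>) * x powr (\<delta> - 1 / 2) / x powr (3 * \<delta>))" by simp
        also have "x powr (1 / 2 + \<delta>) * x powr (\<delta> - 1 / 2) / x powr (3 * \<delta>) = x powr (- \<delta>)"
          by (simp add: powr_add[symmetric] powr_diff[symmetric])
        finally show ?thesis .
      qed
      have "failure_bound k d N l r q = real q * (p * p + real k * real ((k * r + 1) * (1 + d * k) ^ (2 * l)) / (real N - real q)) +
          real (d * (k * r * (1 + d * k) ^ (2 * l))) * p + real q * p / real r"
        by (simp only: failure_bound_def Let_def p)
      also have "\<dots> = real q * (p * p) + real q * (real k * ((real k * real r + 1) * B) * (1 / (real N - real q))) +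
          real d * (real k * real r * B) * p + real q * p / real r"
        by (simp add: B_def algebra_simps add_divide_distrib)
      also have "\<dots> \<le> c1 * x powr (- \<delta>)"
        using T1 T2 T3 T4 unfolding c1_def distrib_right by linarith
      also have "\<dots> \<le> 1 / 10" using elim(1) by (simp add: x_def)
      finally show ?thesis using qN by simp
    qed
    have "- real N \<le> - (real n / real k - 1)" using Nge unfolding x_def by linarith
    then have "exp (- real N) \<le> exp (- (real n / real k - 1))" by (simp only: exp_le_cancel_iff)
    then have eN: "exp (- real N) \<le> 1 / 10" using elim(5) by (rule order_trans)
    have "\<epsilon> * (x / real k - 1) \<le> \<epsilon> * real N" using Nge eps by (intro mult_left_mono) auto
    then have e2: "2 \<le> \<epsilon> * real N" using elim(6) by (simp add: x_def)
    show ?case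
      unfolding N_def[symmetric]
    proof (intro allI impI)
      fix q :: nat assume q: "real q \<le> real n powr (1 / 2 + \<delta>)"
      note m = main[OF q]
      show "\<exists>l r. k \<le> l \<and> q < N \<and> 1 \<le> r \<and> (1 + 2 ^ k * \<rho> ^ (l - k)) ^ r \<le> 1 + 1 / 10 \<and>
          failure_bound k d N l r q \<le> 1 / 10 \<and> exp (- real N) \<le> 1 / 10 \<and> 2 \<le> \<epsilon> * real N"
        by (intro exI[of _ l] exI[of _ r] conjI lk r1 pow eN e2 conjunct1[OF m] conjunct2[OF m])
    qed
  qed
qed

text \<open>The instance without constraints is satisfiable and, for a nonpositive distance, also
  far.\<close>

lemma no_tester_nonpos:
  assumes "\<epsilon> \<le> 0"
  shows "\<not> tester Q k d n \<epsilon> T"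
proof
  assume T: "tester Q k d n \<epsilon> T"
  let ?I = "\<lparr>constraints = [], incidence = (\<lambda>_. [])\<rparr> :: csp_instance"
  have I: "?I \<in> csp_instances k d n" by (simp add: csp_instances_def)
  have close: "close_to_sat Q k d n 0 ?I" by (auto simp: close_to_sat_def satisfiable_without_def)
  have "\<epsilon> * real d * real n / real k \<le> 0"
    using assms by (simp add: divide_nonpos_nonneg mult_nonpos_nonneg)
  then have far: "far_from_sat Q k d n \<epsilon> ?I"
    unfolding far_from_sat_def by (auto intro: order_trans[OF _ of_nat_0_le_iff])
  let ?acc = "{t. run (csp_oracle n ?I) t}"
  have "2 / 3 \<le> measure_pmf.prob T ?acc" "2 / 3 \<le> measure_pmf.prob T {t. \<not> run (csp_oracle n ?I) t}"
    using T I close far unfolding tester_def tester2_def by blast+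
  moreover have "measure_pmf.prob T {t. \<not> run (csp_oracle n ?I) t} = 1 - measure_pmf.prob T ?acc"
    using measure_pmf.prob_compl[of ?acc T] by (simp add: Compl_eq_Diff_UNIV[symmetric] Collect_neg_eq)
  ultimately show False by linarith
qed

lemma testing_lower_bound:
  assumes k: "3 \<le> k" and P: "card (ones k P) > 0" "symmetric_pred k P" "\<exists>x\<in>cube k. P x \<noteq> EQU x"
    and PQ: "ones k P \<subseteq> ones k Q" and eps: "0 < \<epsilon>"
  shows "\<exists>(\<delta>::real) (d::nat). \<delta> > 0 \<and> d \<ge> 1 \<and>
    (\<epsilon> < 1 \<longrightarrow> \<delta> \<le> 1 / ln (real k / \<epsilon>\<^sup>2) \<and> real d \<le> (16 * real k + 17) * (1 / \<epsilon>\<^sup>2)) \<and>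
    testers_require Q k d (real (card (zeros k Q)) / 2 ^ k - \<epsilon>) (\<lambda>n. real n powr (1 / 2 + \<delta>))"
proof -
  define A where "A = ones k P"
  have Ac: "A \<subseteq> cube k" and Ane: "A \<noteq> {}" using P(1) by (auto simp: A_def ones_def card_gt_0_iff)
  have Acompl: "map Not y \<in> A" if "y \<in> A" for y
  proof -
    have y: "y \<in> cube k" "P y" using that by (auto simp: A_def ones_def)
    then have "P (map Not y)" using P(2) unfolding symmetric_pred_def by blast
    then show ?thesis using y(1) by (simp add: A_def ones_def cube_def)
  qed
  obtain \<rho> where rho: "0 < \<rho>" "\<rho> < 1"
    "\<And>S. S \<subseteq> {..<k} \<Longrightarrow> S \<noteq> {} \<Longrightarrow> S \<noteq> {..<k} \<Longrightarrow> \<bar>coef A S\<bar> \<le> \<rho>"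
    using coef_bound_exists[OF Ac Ane] symmetric_pred_mixing[OF k P] unfolding A_def by blast
  \<comment> \<open>The smallest degree meeting the hypothesis of \<open>card_not_far\<close>.
    Rounding up adds at most one, which turns 16 into 17 in the bound for
    \<open>\<epsilon> < 1\<close>.\<close>
  define d where "d = nat \<lceil>16 * (real k + 1) / \<epsilon>\<^sup>2\<rceil>"
  have dpos: "0 < 16 * (real k + 1) / \<epsilon>\<^sup>2" using eps by simp
  have d_ge: "16 * (real k + 1) / \<epsilon>\<^sup>2 \<le> real d" unfolding d_def by (rule of_nat_ceiling)
  have d1: "1 \<le> d" using dpos d_ge by linarith
  have deps: "16 * (real k + 1) \<le> \<epsilon>\<^sup>2 * real d" using d_ge eps by (simp add: divide_le_eq mult.commute)
  have d_le: "real d \<le> (16 * real k + 17) * (1 / \<epsilon>\<^sup>2)" if "\<epsilon> < 1"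
  proof -
    have "real d \<le> 16 * (real k + 1) / \<epsilon>\<^sup>2 + 1" unfolding d_def using dpos by linarith
    moreover have "1 \<le> 1 / \<epsilon>\<^sup>2" using eps that by (simp add: power_le_one)
    ultimately show ?thesis by (simp add: add_divide_distrib field_simps)
  qed
  define \<kappa> where "\<kappa> = 1 / (16 * ln (1 + real d * real k))"
  have "0 < real d * real k" using d1 k by simp
  then have kap: "0 < \<kappa>" by (simp add: \<kappa>_def)
  \<comment> \<open>Any smaller positive \<open>\<delta>\<close> serves as well, so the required
    upper bound is simply built into the minimum. For \<open>\<epsilon> \<ge> 1\<close> the default
    1 has no effect beside 1/48.\<close>
  define \<delta> where "\<delta> = min (min (1 / 48) (\<kappa> * (- ln \<rho>) / 4)) (if \<epsilon> < 1 then 1 / ln (real k / \<epsilon>\<^sup>2) else 1)"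
  have lnpos: "0 < ln (real k / \<epsilon>\<^sup>2)" if "\<epsilon> < 1"
  proof -
    have "\<epsilon>\<^sup>2 \<le> 1" using eps that by (simp add: power_le_one)
    then show ?thesis using k eps by simp
  qed
  have "0 < \<kappa> * (- ln \<rho>) / 4" using kap rho(1,2) by (intro divide_pos_pos mult_pos_pos) auto
  then have delta: "0 < \<delta>" "\<delta> \<le> 1 / 48" "\<delta> \<le> \<kappa> * (- ln \<rho>) / 4"
    using lnpos by (auto simp: \<delta>_def)
  have delta_C: "\<delta> \<le> 1 / ln (real k / \<epsilon>\<^sup>2)" if "\<epsilon> < 1" using that by (simp add: \<delta>_def)
  define z where "z = real (card (zeros k Q)) / 2 ^ k"
  have "testers_require Q k d (z - \<epsilon>) (\<lambda>n. real n powr (1 / 2 + \<delta>))"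
  \<comment> \<open>If \<open>\<epsilon>\<close> is at least the density \<open>z\<close>, the
    tested distance is nonpositive and no tester exists.\<close>
  proof (cases "\<epsilon> < z")
    case False
    then have "\<not> tester Q k d n (z - \<epsilon>) T" for n T using no_tester_nonpos by simp
    then show ?thesis unfolding testers_require_def by (intro exI[of _ 1]) simp
  next
    case True
    show ?thesis
      unfolding testers_require_def
    proof (intro exI[of _ 1] conjI zero_less_one)
      show "\<forall>\<^sub>F n in sequentially. \<forall>T q. tester Q k d n (z - \<epsilon>) T \<and> query_complexity_le k d n T q \<longrightarrow>
          1 * real n powr (1 / 2 + \<delta>) \<le> real q"
        using asymptotic_parameters[OF k d1 rho(1,2) eps \<kappa>_def delta]
      proof eventually_elim
        case (elim n)
        show ?case
        proof (intro allI impI, rule ccontr)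
          fix T q assume T: "tester Q k d n (z - \<epsilon>) T \<and> query_complexity_le k d n T q"
            and "\<not> 1 * real n powr (1 / 2 + \<delta>) \<le> real q"
          then have q: "real q \<le> real n powr (1 / 2 + \<delta>)" by simp
          obtain l r where lr: "k \<le> l" "q < n div k" "1 \<le> r" "(1 + 2 ^ k * \<rho> ^ (l - k)) ^ r \<le> 1 + 1 / 10"
            "failure_bound k d (n div k) l r q \<le> 1 / 10" "exp (- real (n div k)) \<le> 1 / 10" "2 \<le> \<epsilon> * real (n div k)"
            using elim[rule_format, OF q] by (elim exE conjE) (rule that)
          \<comment> \<open>With all three errors at most 1/10, \<open>tester_inequality\<close>
            would give 9/20 \<le> 1/3.\<close>
          have half: "1 / 2 \<le> 2 / 3 * (1 - e) - 1 / 10" if "e \<le> 1 / 10" for e :: real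
          proof -
            have "1 / 2 = 2 / 3 * (9 / 10) - (1 / 10 :: real)" by simp
            also have "\<dots> \<le> 2 / 3 * (1 - e) - 1 / 10"
              by (intro diff_right_mono mult_left_mono) (use that in auto)
            finally show ?thesis .
          qed
          have n: "k * (n div k) \<le> n" "n < k * (n div k + 1)"
            using dividend_less_times_div[of k n] k by auto
          have "(1 - 1 / 10) * (2 / 3 * (1 - exp (- real (n div k))) - 1 / 10) \<le> 1 / (3 :: real)"
          proof (rule tester_inequality[OF k _ Ane Acompl _ _ rho(3) lr(1,4) _ lr(2,3) n lr(5) eps _ deps lr(7)])
            show "A \<subseteq> ones k Q" using PQ by (simp add: A_def)
          qed (use T True rho in \<open>auto simp: z_def\<close>)
          moreover have "(1 - 1 / 10) * (1 / 2 :: real) \<le> (1 - 1 / 10) * (2 / 3 * (1 - exp (- real (n div k))) - 1 / 10)"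
          proof (rule mult_left_mono)
            show "1 / 2 \<le> 2 / 3 * (1 - exp (- real (n div k))) - 1 / 10" using half lr(6) by blast
          qed simp
          ultimately have "(1 - 1 / 10) * (1 / 2) \<le> 1 / (3 :: real)" by (rule order_trans[rotated])
          then show False by simp
        qed
      qed
    qed
  qed
  then show ?thesis using delta(1) d1 delta_C d_le unfolding z_def by blast
qed

(* For eps >= 1 the logarithm may vanish or be negative and 1/eps^2 may drop below 1, so the
   O-bounds are only meaningful, and only stated, for eps < 1. (If eps >= 1, the tested
   distance is negative and no tester exists.)  The constant C is absolute; D depends on k. *)
theorem theorem1:
  "\<exists>C>0. \<forall>k\<ge>3. \<exists>D>0. \<forall>(P::predicate) (Q::predicate) (\<epsilon>::real).
     card (ones k P) > 0 \<and> symmetric_pred k P \<and> (\<exists>x\<in>cube k. P x \<noteq> EQU x) \<and>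
     ones k P \<subseteq> ones k Q \<and> \<epsilon> > 0 \<longrightarrow>
     (\<exists>(\<delta>::real) (d::nat).
        \<delta> > 0 \<and> d \<ge> 1 \<and>
        (\<epsilon> < 1 \<longrightarrow> \<delta> \<le> C * (1 / ln (real k / \<epsilon>\<^sup>2)) \<and> real d \<le> D * (1 / \<epsilon>\<^sup>2)) \<and>
        testers_require Q k d (real (card (zeros k Q)) / 2 ^ k - \<epsilon>)
          (\<lambda>n. real n powr (1 / 2 + \<delta>)))"
proof (rule exI[of _ 1], intro conjI zero_less_one allI impI)
  fix k :: nat assume "3 \<le> k"
  note bound = testing_lower_bound[OF this]
  show "\<exists>D>0. \<forall>(P::predicate) (Q::predicate) (\<epsilon>::real).
     card (ones k P) > 0 \<and> symmetric_pred k P \<and> (\<exists>x\<in>cube k. P x \<noteq> EQU x) \<and>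
     ones k P \<subseteq> ones k Q \<and> \<epsilon> > 0 \<longrightarrow>
     (\<exists>(\<delta>::real) (d::nat).
        \<delta> > 0 \<and> d \<ge> 1 \<and>
        (\<epsilon> < 1 \<longrightarrow> \<delta> \<le> 1 * (1 / ln (real k / \<epsilon>\<^sup>2)) \<and> real d \<le> D * (1 / \<epsilon>\<^sup>2)) \<and>
        testers_require Q k d (real (card (zeros k Q)) / 2 ^ k - \<epsilon>)
          (\<lambda>n. real n powr (1 / 2 + \<delta>)))"
    unfolding mult_1_left
    by (rule exI[of _ "16 * real k + 17"], rule conjI, simp, intro allI impI, elim conjE) (rule bound; assumption)
qed

end
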